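(* If the underlying topological space of a scheme $X$ is Hausdorff, then every finite union of affine opens of $X$ is an affine open of $X$. In particular, every compact scheme is an affine scheme.
   Context: A compact space means a quasi-compact and Hausdorff topological space; a compact scheme is a scheme whose underlying space is compact in this sense. An affine open of $X$ is an open subset which, with the induced scheme structure, is an affine scheme. *)

theory Defs
  imports "HOL-Analysis.T1_Spaces" "HOL-Algebra.RingHom"
begin

definition local_ring :: "('a, 'm) ring_scheme \<Rightarrow> bool" where
  "local_ring R \<longleftrightarrow> cring R \<and> (\<exists>!M. maximalideal M R)"

definition local_ring_hom ::
    "('a, 'm) ring_scheme \<Rightarrow> ('b, 'n) ring_scheme \<Rightarrow> ('a \<Rightarrow> 'b) \<Rightarrow> bool" where
  "local_ring_hom R S h \<longleftrightarrow> h \<in> ring_hom R S \<and>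
     (\<forall>M N. maximalideal M R \<longrightarrow> maximalideal N S \<longrightarrow> {a \<in> carrier R. h a \<in> N} = M)"

text \<open>
  The data of a topological space with a presheaf of rings. Only the values of
  \<open>sections\<close> on open sets, and of \<open>res U V\<close> (restriction from \<open>U\<close> to \<open>V\<close>) for open
  sets \<open>V \<subseteq> U\<close> and on the carrier, are meaningful. All rings of sections live in one
  type \<open>'a\<close>; a family of rings over distinct types can be put into this form by tagging.
\<close>

record ('p, 'a) rspace =
  pts :: "'p topology"
  sections :: "'p set \<Rightarrow> 'a ring"
  res :: "'p set \<Rightarrow> 'p set \<Rightarrow> 'a \<Rightarrow> 'a"

text \<open>
  In the two sheaf axioms the family \<open>\<V>\<close> may be empty, so that \<open>sections X {}\<close> is
  the zero ring.
\<close>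

locale ringed_space =
  fixes X :: "('p, 'a) rspace"
  assumes sections_cring: "openin (pts X) U \<Longrightarrow> cring (sections X U)"
    and res_hom: "\<lbrakk>openin (pts X) U; openin (pts X) V; V \<subseteq> U\<rbrakk>
      \<Longrightarrow> res X U V \<in> ring_hom (sections X U) (sections X V)"
    and res_id: "\<lbrakk>openin (pts X) U; s \<in> carrier (sections X U)\<rbrakk> \<Longrightarrow> res X U U s = s"
    and res_comp: "\<lbrakk>openin (pts X) U; openin (pts X) V; openin (pts X) W; W \<subseteq> V; V \<subseteq> U;
        s \<in> carrier (sections X U)\<rbrakk> \<Longrightarrow> res X V W (res X U V s) = res X U W s"
    and sheaf_locality: "\<lbrakk>\<forall>V\<in>\<V>. openin (pts X) V;
        s \<in> carrier (sections X (\<Union>\<V>)); t \<in> carrier (sections X (\<Union>\<V>));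
        \<forall>V\<in>\<V>. res X (\<Union>\<V>) V s = res X (\<Union>\<V>) V t\<rbrakk> \<Longrightarrow> s = t"
    and sheaf_gluing: "\<lbrakk>\<forall>V\<in>\<V>. openin (pts X) V; \<forall>V\<in>\<V>. \<sigma> V \<in> carrier (sections X V);
        \<forall>V\<in>\<V>. \<forall>W\<in>\<V>. res X V (V \<inter> W) (\<sigma> V) = res X W (V \<inter> W) (\<sigma> W)\<rbrakk>
      \<Longrightarrow> \<exists>s\<in>carrier (sections X (\<Union>\<V>)). \<forall>V\<in>\<V>. res X (\<Union>\<V>) V s = \<sigma> V"

text \<open>The ringed space induced on an open subset: on opens of \<open>U\<close> the sheaf is unchanged.\<close>

definition restrict_space :: "('p, 'a) rspace \<Rightarrow> 'p set \<Rightarrow> ('p, 'a) rspace" where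
  "restrict_space X U = X\<lparr>pts := subtopology (pts X) U\<rparr>"

definition germ :: "('p, 'a) rspace \<Rightarrow> 'p \<Rightarrow> 'p set \<Rightarrow> 'a \<Rightarrow> ('p set \<times> 'a) set" where
  "germ X p U s = {(V, t). openin (pts X) V \<and> p \<in> V \<and> t \<in> carrier (sections X V) \<and>
     (\<exists>W. openin (pts X) W \<and> p \<in> W \<and> W \<subseteq> U \<inter> V \<and> res X U W s = res X V W t)}"

text \<open>
  The direct limit of the rings of sections over the open neighbourhoods of \<open>p\<close>, as
  equivalence classes of pairs. The operations take the union of the classes computed
  from all representatives; these classes all coincide.
\<close>

definition stalk :: "('p, 'a) rspace \<Rightarrow> 'p \<Rightarrow> ('p set \<times> 'a) set ring" where
  "stalk X p = \<lparr>
     carrier = {germ X p U s | U s. openin (pts X) U \<and> p \<in> U \<and> s \<in> carrier (sections X U)},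
     mult = (\<lambda>A B. \<Union>(U, s)\<in>A. \<Union>(V, t)\<in>B. germ X p (U \<inter> V)
       (res X U (U \<inter> V) s \<otimes>\<^bsub>sections X (U \<inter> V)\<^esub> res X V (U \<inter> V) t)),
     one = germ X p (topspace (pts X)) \<one>\<^bsub>sections X (topspace (pts X))\<^esub>,
     zero = germ X p (topspace (pts X)) \<zero>\<^bsub>sections X (topspace (pts X))\<^esub>,
     add = (\<lambda>A B. \<Union>(U, s)\<in>A. \<Union>(V, t)\<in>B. germ X p (U \<inter> V)
       (res X U (U \<inter> V) s \<oplus>\<^bsub>sections X (U \<inter> V)\<^esub> res X V (U \<inter> V) t))\<rparr>"

locale locally_ringed_space = ringed_space +
  assumes stalk_local: "p \<in> topspace (pts X) \<Longrightarrow> local_ring (stalk X p)"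

abbreviation preim :: "('p, 'a) rspace \<Rightarrow> ('p \<Rightarrow> 'q) \<Rightarrow> 'q set \<Rightarrow> 'p set" where
  "preim X f V \<equiv> {x \<in> topspace (pts X). f x \<in> V}"

definition stalk_map :: "('p, 'a) rspace \<Rightarrow> ('p \<Rightarrow> 'q) \<Rightarrow> ('q set \<Rightarrow> 'b \<Rightarrow> 'a) \<Rightarrow> 'p
    \<Rightarrow> ('q set \<times> 'b) set \<Rightarrow> ('p set \<times> 'a) set" where
  "stalk_map X f \<phi> p A = (\<Union>(V, t)\<in>A. germ X p (preim X f V) (\<phi> V t))"

text \<open>
  A morphism \<open>X \<rightarrow> Y\<close> consists of \<open>f\<close> on points and, for \<open>V\<close> open in \<open>Y\<close>, of ring
  homomorphisms \<open>\<phi> V\<close> from the sections of \<open>Y\<close> over \<open>V\<close> to those of \<open>X\<close> over the preimage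
  of \<open>V\<close>. The locale does not repeat that \<open>X\<close> and \<open>Y\<close> are locally ringed spaces.
\<close>

locale lrs_morphism =
  fixes X :: "('p, 'a) rspace" and Y :: "('q, 'b) rspace"
    and f :: "'p \<Rightarrow> 'q" and \<phi> :: "'q set \<Rightarrow> 'b \<Rightarrow> 'a"
  assumes continuous: "continuous_map (pts X) (pts Y) f"
    and sections_hom: "openin (pts Y) V
      \<Longrightarrow> \<phi> V \<in> ring_hom (sections Y V) (sections X (preim X f V))"
    and sections_natural: "\<lbrakk>openin (pts Y) V; openin (pts Y) W; W \<subseteq> V;
        t \<in> carrier (sections Y V)\<rbrakk>
      \<Longrightarrow> \<phi> W (res Y V W t) = res X (preim X f V) (preim X f W) (\<phi> V t)"
    and stalk_map_local: "p \<in> topspace (pts X)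
      \<Longrightarrow> local_ring_hom (stalk Y (f p)) (stalk X p) (stalk_map X f \<phi> p)"

definition lrs_isomorphic :: "('p, 'a) rspace \<Rightarrow> ('q, 'b) rspace \<Rightarrow> bool" where
  "lrs_isomorphic X Y \<longleftrightarrow> (\<exists>f \<phi> g \<psi>. lrs_morphism X Y f \<phi> \<and> lrs_morphism Y X g \<psi> \<and>
     (\<forall>x\<in>topspace (pts X). g (f x) = x) \<and> (\<forall>y\<in>topspace (pts Y). f (g y) = y) \<and>
     (\<forall>U. openin (pts X) U \<longrightarrow>
        (\<forall>s\<in>carrier (sections X U). \<phi> (preim Y g U) (\<psi> U s) = s)) \<and>
     (\<forall>V. openin (pts Y) V \<longrightarrow>
        (\<forall>t\<in>carrier (sections Y V). \<psi> (preim X f V) (\<phi> V t) = t)))"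

definition zariski :: "('a, 'm) ring_scheme \<Rightarrow> 'a set topology" where
  "zariski R = topology (\<lambda>U. \<exists>I. ideal I R \<and> U = {P. primeideal P R \<and> \<not> I \<subseteq> P})"

lemma openin_zariski:
  assumes "cring R"
  shows "openin (zariski R) U \<longleftrightarrow> (\<exists>I. ideal I R \<and> U = {P. primeideal P R \<and> \<not> I \<subseteq> P})"
proof -
  interpret cring R by fact
  let ?D = "\<lambda>I. {P. primeideal P R \<and> \<not> I \<subseteq> P}"
  have "istopology (\<lambda>U. \<exists>I. ideal I R \<and> U = ?D I)"
    unfolding istopology_def
  proof (intro conjI allI impI)
    fix S T assume "\<exists>I. ideal I R \<and> S = ?D I" "\<exists>I. ideal I R \<and> T = ?D I"
    then obtain I J where I: "ideal I R" "S = ?D I" and J: "ideal J R" "T = ?D J" by blast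
    have "?D I \<inter> ?D J \<subseteq> ?D (I \<inter> J)"
    proof clarsimp
      fix P a b assume P: "primeideal P R" and a: "a \<in> I" "a \<notin> P" and b: "b \<in> J" "b \<notin> P"
        and sub: "I \<inter> J \<subseteq> P"
      have ab: "a \<in> carrier R" "b \<in> carrier R"
        using a b I(1) J(1) by (auto dest: ideal.Icarr)
      have "a \<otimes>\<^bsub>R\<^esub> b \<in> I \<inter> J"
        using a b ab I(1) J(1) by (auto intro: ideal.I_r_closed ideal.I_l_closed)
      then show False using primeideal.I_prime[OF P ab] sub a b by blast
    qed
    moreover have "?D (I \<inter> J) \<subseteq> ?D I \<inter> ?D J" by auto
    ultimately have "S \<inter> T = ?D (I \<inter> J)" unfolding I(2) J(2) by (rule equalityI)
    then show "\<exists>I. ideal I R \<and> S \<inter> T = ?D I"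
      using i_intersect[OF I(1) J(1)] by (intro exI conjI)
  next
    fix \<K> assume "\<forall>K\<in>\<K>. \<exists>I. ideal I R \<and> K = ?D I"
    then obtain J where J: "\<And>K. K \<in> \<K> \<Longrightarrow> ideal (J K) R \<and> K = ?D (J K)" by metis
    define I where "I = Idl\<^bsub>R\<^esub> (\<Union>K\<in>\<K>. J K)"
    have sub: "(\<Union>K\<in>\<K>. J K) \<subseteq> carrier R"
    proof (rule UN_least)
      fix K assume "K \<in> \<K>"
      then have "ideal (J K) R" by (rule conjunct1[OF J])
      then show "J K \<subseteq> carrier R" by (auto dest: ideal.Icarr)
    qed
    have "I \<subseteq> P \<longleftrightarrow> (\<forall>K\<in>\<K>. J K \<subseteq> P)" if "primeideal P R" for P
    proof -
      have "ideal P R" using that by (simp add: primeideal_def)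
      then show ?thesis
        using genideal_self[OF sub] genideal_minimal[of P "\<Union>K\<in>\<K>. J K"]
        unfolding I_def by (meson UN_least UN_upper order_trans)
    qed
    then have "?D I = (\<Union>K\<in>\<K>. ?D (J K))" by auto
    also have "\<dots> = (\<Union>K\<in>\<K>. K)" by (rule SUP_cong) (use J in metis)+
    finally have "\<Union>\<K> = ?D I" by simp
    then show "\<exists>I. ideal I R \<and> \<Union>\<K> = ?D I"
      using genideal_ideal[OF sub] unfolding I_def by (intro exI conjI)
  qed
  then show ?thesis by (simp add: zariski_def topology_inverse')
qed

text \<open>
  \<open>fraction R S a s\<close> is the fraction \<open>a/s\<close> in the localization of \<open>R\<close> at the multiplicative
  set \<open>S\<close>, as an equivalence class of pairs.
\<close>

definition fraction :: "('a, 'm) ring_scheme \<Rightarrow> 'a set \<Rightarrow> 'a \<Rightarrow> 'a \<Rightarrow> ('a \<times> 'a) set" where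
  "fraction R S a s = {(b, t). b \<in> carrier R \<and> t \<in> S \<and>
     (\<exists>u\<in>S. u \<otimes>\<^bsub>R\<^esub> (t \<otimes>\<^bsub>R\<^esub> a) = u \<otimes>\<^bsub>R\<^esub> (s \<otimes>\<^bsub>R\<^esub> b))}"

definition localization :: "('a, 'm) ring_scheme \<Rightarrow> 'a set \<Rightarrow> ('a \<times> 'a) set ring" where
  "localization R S = \<lparr>
     carrier = {fraction R S a s | a s. a \<in> carrier R \<and> s \<in> S},
     mult = (\<lambda>A B. \<Union>(a, s)\<in>A. \<Union>(b, t)\<in>B. fraction R S (a \<otimes>\<^bsub>R\<^esub> b) (s \<otimes>\<^bsub>R\<^esub> t)),
     one = fraction R S \<one>\<^bsub>R\<^esub> \<one>\<^bsub>R\<^esub>,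
     zero = fraction R S \<zero>\<^bsub>R\<^esub> \<one>\<^bsub>R\<^esub>,
     add = (\<lambda>A B. \<Union>(a, s)\<in>A. \<Union>(b, t)\<in>B.
       fraction R S ((t \<otimes>\<^bsub>R\<^esub> a) \<oplus>\<^bsub>R\<^esub> (s \<otimes>\<^bsub>R\<^esub> b)) (s \<otimes>\<^bsub>R\<^esub> t))\<rparr>"

abbreviation local_at :: "('a, 'm) ring_scheme \<Rightarrow> 'a set \<Rightarrow> ('a \<times> 'a) set ring" where
  "local_at R P \<equiv> localization R (carrier R - P)"

text \<open>
  Sections over \<open>U\<close> are the families of elements of the local rings at the points of \<open>U\<close>
  that are locally given by a single fraction.
\<close>

definition spec_sections ::
    "('a, 'm) ring_scheme \<Rightarrow> 'a set set \<Rightarrow> ('a set \<Rightarrow> ('a \<times> 'a) set) ring" where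
  "spec_sections R U = \<lparr>
     carrier = {s \<in> (\<Pi>\<^sub>E P\<in>U. carrier (local_at R P)). \<forall>P\<in>U. \<exists>V a b.
        openin (zariski R) V \<and> P \<in> V \<and> V \<subseteq> U \<and> a \<in> carrier R \<and> b \<in> carrier R \<and>
        (\<forall>Q\<in>V. b \<notin> Q \<and> s Q = fraction R (carrier R - Q) a b)},
     mult = (\<lambda>s t. \<lambda>P\<in>U. s P \<otimes>\<^bsub>local_at R P\<^esub> t P),
     one = (\<lambda>P\<in>U. \<one>\<^bsub>local_at R P\<^esub>),
     zero = (\<lambda>P\<in>U. \<zero>\<^bsub>local_at R P\<^esub>),
     add = (\<lambda>s t. \<lambda>P\<in>U. s P \<oplus>\<^bsub>local_at R P\<^esub> t P)\<rparr>"

definition Spec :: "('a, 'm) ring_scheme \<Rightarrow> ('a set, 'a set \<Rightarrow> ('a \<times> 'a) set) rspace" where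
  "Spec R = \<lparr>pts = zariski R, sections = spec_sections R, res = (\<lambda>U V s. restrict s V)\<rparr>"

text \<open>
  Requiring the ring \<open>R\<close> to live in the type \<open>'a\<close> of the sections is no restriction: if
  \<open>X\<close> is isomorphic to \<open>Spec R\<close> for \<open>R\<close> over any type, then \<open>R\<close> is isomorphic to the ring
  of global sections of \<open>X\<close>.
\<close>

definition affine_scheme :: "('p, 'a) rspace \<Rightarrow> bool" where
  "affine_scheme X \<longleftrightarrow> locally_ringed_space X \<and>
     (\<exists>R :: 'a ring. cring R \<and> lrs_isomorphic X (Spec R))"

definition affine_open :: "('p, 'a) rspace \<Rightarrow> 'p set \<Rightarrow> bool" where
  "affine_open X U \<longleftrightarrow> openin (pts X) U \<and> affine_scheme (restrict_space X U)"

definition scheme :: "('p, 'a) rspace \<Rightarrow> bool" where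
  "scheme X \<longleftrightarrow> locally_ringed_space X \<and> (\<forall>p\<in>topspace (pts X). \<exists>U. p \<in> U \<and> affine_open X U)"

definition compact_scheme :: "('p, 'a) rspace \<Rightarrow> bool" where
  "compact_scheme X \<longleftrightarrow> scheme X \<and> compact_space (pts X) \<and> Hausdorff_space (pts X)"

end

theory Submission
  imports Defs "HOL-Algebra.Divisibility" "HOL-Algebra.Multiplicative_Group"
begin

text \<open>
  In a Hausdorff scheme the only thing an open set can lack for being affine is compactness.
  Suppose that the spectrum of \<open>R\<close> is a T1 space. Then no prime ideal is strictly contained in
  another, so every element \<open>a\<close> of a prime \<open>P\<close> satisfies \<open>s a^n = 0\<close> for some \<open>n\<close> and some \<open>s\<close>
  outside \<open>P\<close>; otherwise a prime avoiding all the products \<open>s a^n\<close> would lie strictly below \<open>P\<close>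
  (\<open>T1_zariski_killed\<close>). Two consequences follow: near every point a section of the structure
  sheaf is a unit or nilpotent (\<open>nil_ringed_space_Spec\<close>), and the basic open sets are clopen
  (\<open>T1_zariski_closed_basic\<close>). Both pass to a Hausdorff scheme \<open>X\<close>
  (\<open>scheme_Hausdorff_facts\<close>): the first is local, and for the second one uses that an affine
  open is compact (\<open>compact_zariski\<close>), hence closed in \<open>X\<close>, so that its clopen subsets are clopen
  in \<open>X\<close>.

  A finite union of affine opens is compact and open. With the induced structure it is therefore
  a compact Hausdorff ringed space with a basis of clopen sets on which sections are locally
  units or nilpotent. Every such space \<open>X\<close> is isomorphic to the spectrum of its ring \<open>A\<close> of
  global sections (\<open>affine\<close>), so the given affine pieces never have to be glued. The reason is
  that sections over clopen sets extend by zero (\<open>extend_by_zero\<close>): every germ comes from a global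
  section, and every clopen set has an idempotent in \<open>A\<close> that is one on the set and zero off it.
  To a point \<open>p\<close> corresponds the prime ideal \<open>pt_ideal p\<close> of the global sections whose germ at
  \<open>p\<close> is not a unit. Idempotents separate points. Conversely, for a prime \<open>Q\<close>, compactness gives
  a point \<open>p\<close> near which no element of \<open>Q\<close> equals one, and since every germ is a unit or
  nilpotent this forces \<open>Q = pt_ideal p\<close> (\<open>pt_ideal_surj\<close>). Fractions of \<open>A\<close> are equal in the
  local ring at \<open>pt_ideal p\<close> exactly when they agree near \<open>p\<close> (\<open>fraction_eq_iff_germ\<close>); hence
  sections of \<open>X\<close> over \<open>U\<close> are the same as sections of the spectrum over the image of \<open>U\<close>
  (\<open>to_spec_inj\<close>, \<open>to_spec_surj\<close>).

  The isomorphism has to consist of morphisms of locally ringed spaces, and this comes for free: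
  a homomorphism between rings in which every nonunit is nilpotent preserves units and
  nilpotents, so it is local (\<open>nil_local_ring_hom_local\<close>, \<open>lrs_morphism_nil\<close>).
\<close>

section \<open>Prime ideals and the Zariski topology\<close>

lemma (in cring) idealI_cring:
  assumes "I \<subseteq> carrier R" and "\<zero> \<in> I"
    and add: "\<And>a b. a \<in> I \<Longrightarrow> b \<in> I \<Longrightarrow> a \<oplus> b \<in> I"
    and mult: "\<And>a x. a \<in> I \<Longrightarrow> x \<in> carrier R \<Longrightarrow> x \<otimes> a \<in> I"
  shows "ideal I R"
proof (rule idealI)
  show "subgroup I (add_monoid R)"
  proof (rule add.subgroupI)
    show "\<ominus> a \<in> I" if "a \<in> I" for a
    proof -
      have "(\<ominus> \<one>) \<otimes> a = \<ominus> a"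
        using that assms(1) by (simp add: l_minus subset_iff)
      then show ?thesis using mult[OF that, of "\<ominus> \<one>"] by simp
    qed
  qed (use assms in auto)
  show "a \<otimes> x \<in> I" if "a \<in> I" "x \<in> carrier R" for a x
    using mult[OF that] that assms(1) by (simp add: m_comm subset_iff)
qed (use ring_axioms mult in auto)

text \<open>
  An ideal that is maximal among those containing \<open>I\<close> and disjoint from \<open>S\<close> is prime: if neither
  \<open>a\<close> nor \<open>b\<close> lies in it, the two ideals obtained by adjoining \<open>a\<close> and \<open>b\<close> both meet \<open>S\<close>, and
  the product of two such elements of \<open>S\<close> lies in the ideal as soon as \<open>a b\<close> does.
\<close>

lemma (in cring) prime_ideal_avoiding:
  assumes I: "ideal I R" and S: "S \<subseteq> carrier R" "\<one> \<in> S"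
    and mult: "\<And>s t. s \<in> S \<Longrightarrow> t \<in> S \<Longrightarrow> s \<otimes> t \<in> S"
    and disj: "I \<inter> S = {}"
  shows "\<exists>P. primeideal P R \<and> I \<subseteq> P \<and> P \<inter> S = {}"
proof -
  define \<A> where "\<A> = {J. ideal J R \<and> I \<subseteq> J \<and> J \<inter> S = {}}"
  have "\<exists>M\<in>\<A>. \<forall>X\<in>\<A>. M \<subseteq> X \<longrightarrow> X = M"
  proof (rule subset_Zorn_nonempty)
    show "\<A> \<noteq> {}" using I disj by (auto simp: \<A>_def)
    fix C assume ne: "C \<noteq> {}" and ch: "subset.chain \<A> C"
    have A: "\<And>J. J \<in> C \<Longrightarrow> ideal J R \<and> I \<subseteq> J \<and> J \<inter> S = {}"
      using ch by (auto simp: subset_chain_def \<A>_def)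
    have "ideal (\<Union>C) R"
    proof (rule idealI_cring)
      show "\<Union>C \<subseteq> carrier R" using A by (auto dest: ideal.Icarr)
      show "\<zero> \<in> \<Union>C"
        using A ne by (meson UnionI additive_subgroup.zero_closed ex_in_conv ideal.axioms(1))
      fix a b assume "a \<in> \<Union>C" "b \<in> \<Union>C"
      then obtain J K where JK: "J \<in> C" "a \<in> J" "K \<in> C" "b \<in> K" by auto
      then have "J \<subseteq> K \<or> K \<subseteq> J" using ch by (auto simp: subset_chain_def)
      then obtain L where L: "L \<in> C" "a \<in> L" "b \<in> L" using JK by blast
      then have "a \<oplus> b \<in> L"
        using A[OF L(1)] by (simp add: additive_subgroup.a_closed ideal.axioms(1))
      then show "a \<oplus> b \<in> \<Union>C" using L by auto
    next
      fix a x assume "a \<in> \<Union>C" "x \<in> carrier R"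
      then show "x \<otimes> a \<in> \<Union>C" using A ideal.I_l_closed[of _ R a x] by blast
    qed
    then show "\<Union>C \<in> \<A>" using A ne by (auto simp: \<A>_def)
  qed
  then obtain M where MA: "M \<in> \<A>" and maxA: "\<And>X. X \<in> \<A> \<Longrightarrow> M \<subseteq> X \<Longrightarrow> X = M"
    by blast
  have M: "ideal M R" "I \<subseteq> M" "M \<inter> S = {}" using MA by (auto simp: \<A>_def)
  have max: "X = M" if "ideal X R" "M \<subseteq> X" "X \<inter> S = {}" for X
    by (rule maxA) (use that M in \<open>auto simp: \<A>_def\<close>)
  interpret M: ideal M R by fact
  have key: "\<exists>m x. m \<in> M \<and> x \<in> carrier R \<and> m \<oplus> x \<otimes> a \<in> S" if a: "a \<in> carrier R" "a \<notin> M" for a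
  proof (rule ccontr)
    assume no: "\<not> ?thesis"
    \<comment> \<open>The ideal generated by M and a.\<close>
    define K where "K = {m \<oplus> x \<otimes> a | m x. m \<in> M \<and> x \<in> carrier R}"
    have "ideal K R"
    proof (rule idealI_cring)
      show "K \<subseteq> carrier R" using a M.Icarr by (auto simp: K_def)
      show "\<zero> \<in> K" unfolding K_def
        by (rule CollectI, rule exI[of _ \<zero>], rule exI[of _ \<zero>]) (use a in auto)
      fix c d assume "c \<in> K" "d \<in> K"
      then obtain m x n y where h: "c = m \<oplus> x \<otimes> a" "d = n \<oplus> y \<otimes> a"
        "m \<in> M" "x \<in> carrier R" "n \<in> M" "y \<in> carrier R" by (auto simp: K_def)
      have "c \<oplus> d = (m \<oplus> n) \<oplus> (x \<oplus> y) \<otimes> a"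
        using h a M.Icarr by (simp add: l_distr a_ac)
      then show "c \<oplus> d \<in> K" using h by (auto simp: K_def)
    next
      fix c z assume "c \<in> K" and z: "z \<in> carrier R"
      then obtain m x where h: "c = m \<oplus> x \<otimes> a" "m \<in> M" "x \<in> carrier R" by (auto simp: K_def)
      have "z \<otimes> c = z \<otimes> m \<oplus> (z \<otimes> x) \<otimes> a"
        using h a z M.Icarr by (simp add: r_distr m_assoc)
      then show "z \<otimes> c \<in> K" using h z M.I_l_closed unfolding K_def by blast
    qed
    moreover have "M \<subseteq> K"
    proof
      fix m assume "m \<in> M"
      then have "m = m \<oplus> \<zero> \<otimes> a" using a M.Icarr by simp
      then show "m \<in> K" using \<open>m \<in> M\<close> unfolding K_def by blast
    qed
    moreover have "K \<inter> S = {}" using no by (auto simp: K_def)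
    ultimately have "K = M" by (rule max)
    moreover have "a \<in> K"
    proof -
      have "a = \<zero> \<oplus> \<one> \<otimes> a" using a by simp
      then show ?thesis unfolding K_def using M.zero_closed by blast
    qed
    ultimately show False using a by simp
  qed
  have "primeideal M R"
  proof (rule primeidealI[OF M(1) is_cring])
    show "carrier R \<noteq> M" using M(3) S by auto
    fix a b assume ab: "a \<in> carrier R" "b \<in> carrier R" "a \<otimes> b \<in> M"
    show "a \<in> M \<or> b \<in> M"
    proof (rule ccontr)
      assume "\<not> ?thesis"
      then have nM: "a \<notin> M" "b \<notin> M" by auto
      obtain m x n y where h: "m \<in> M" "x \<in> carrier R" "m \<oplus> x \<otimes> a \<in> S"
        "n \<in> M" "y \<in> carrier R" "n \<oplus> y \<otimes> b \<in> S"
        using key[OF ab(1) nM(1)] key[OF ab(2) nM(2)] by blast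
      have c: "m \<in> carrier R" "n \<in> carrier R" using h M.Icarr by auto
      have "(m \<oplus> x \<otimes> a) \<otimes> (n \<oplus> y \<otimes> b)
          = (n \<oplus> y \<otimes> b) \<otimes> m \<oplus> ((x \<otimes> a) \<otimes> n \<oplus> (x \<otimes> y) \<otimes> (a \<otimes> b))"
        using h(2,5) c ab(1,2) by (simp add: l_distr r_distr m_ac a_ac)
      also have "\<dots> \<in> M"
        by (rule M.a_closed, rule M.I_l_closed, use h in simp, use h c ab in simp,
            rule M.a_closed, rule M.I_l_closed, use h in simp, use h c ab in simp,
            rule M.I_l_closed, use h c ab in simp_all)
      finally show False using mult[OF h(3,6)] M(3) by blast
    qed
  qed
  then show ?thesis using M by blast
qed

lemma (in cring) zariski_basic_open:
  assumes "a \<in> carrier R"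
  shows "openin (zariski R) {P. primeideal P R \<and> a \<notin> P}"
proof -
  have "PIdl a \<subseteq> P \<longleftrightarrow> a \<in> P" if "primeideal P R" for P
    using that cgenideal_self[OF assms] cgenideal_minimal[of P a]
    by (auto simp: primeideal_def)
  then show ?thesis
    using cgenideal_ideal[OF assms] by (auto simp: openin_zariski[OF is_cring] intro!: exI[of _ "PIdl a"])
qed

lemma (in cring) openin_zariskiE:
  assumes "openin (zariski R) U" "P \<in> U"
  obtains a where "a \<in> carrier R" "a \<notin> P" "{P. primeideal P R \<and> a \<notin> P} \<subseteq> U"
proof -
  obtain I where I: "ideal I R" "U = {P. primeideal P R \<and> \<not> I \<subseteq> P}"
    using assms by (auto simp: openin_zariski[OF is_cring])
  then obtain a where "a \<in> I" "a \<notin> P" using assms by auto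
  then show ?thesis using that[of a] I ideal.Icarr by fastforce
qed

lemma (in cring) one_notin_prime:
  assumes "primeideal P R"
  shows "\<one> \<notin> P"
  using assms primeideal.I_notcarr ideal.one_imp_carrier primeideal.axioms(1) by metis

lemma (in cring) zero_in_prime:
  assumes "primeideal P R"
  shows "\<zero> \<in> P"
  using assms by (simp add: additive_subgroup.zero_closed ideal_def primeideal_def)

lemma (in cring) topspace_zariski: "topspace (zariski R) = {P. primeideal P R}"
proof
  have "openin (zariski R) (topspace (zariski R))" by simp
  then show "topspace (zariski R) \<subseteq> {P. primeideal P R}"
    unfolding openin_zariski[OF is_cring] by blast
  have "{P. primeideal P R \<and> \<one> \<notin> P} = {P. primeideal P R}"
    using one_notin_prime by auto
  then show "{P. primeideal P R} \<subseteq> topspace (zariski R)"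
    using openin_subset[OF zariski_basic_open[of \<one>]] by simp
qed

text \<open>
  For an open cover, the elements whose basic open set is covered by finitely many members form
  an ideal. No prime contains it, because each prime lies in a basic open set inside a member of
  the cover; so it contains one.
\<close>

lemma (in cring) compact_zariski: "compact_space (zariski R)"
  unfolding compact_space
proof (intro allI impI, elim conjE)
  fix \<U> assume op: "\<forall>U\<in>\<U>. openin (zariski R) U" and cov: "\<Union>\<U> = topspace (zariski R)"
  define J where "J = {a \<in> carrier R. \<exists>\<F>. finite \<F> \<and> \<F> \<subseteq> \<U> \<and> {P. primeideal P R \<and> a \<notin> P} \<subseteq> \<Union>\<F>}"
  have J: "ideal J R"
  proof (rule idealI_cring)
    show "J \<subseteq> carrier R" by (auto simp: J_def)
    show "\<zero> \<in> J" using zero_in_prime by (auto simp: J_def intro!: exI[of _ "{}"])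
  next
    fix a b assume "a \<in> J" "b \<in> J"
    then obtain F G where h: "a \<in> carrier R" "finite F" "F \<subseteq> \<U>" "{P. primeideal P R \<and> a \<notin> P} \<subseteq> \<Union>F"
      "b \<in> carrier R" "finite G" "G \<subseteq> \<U>" "{P. primeideal P R \<and> b \<notin> P} \<subseteq> \<Union>G"
      by (auto simp: J_def)
    have "a \<notin> P \<or> b \<notin> P" if "primeideal P R" "a \<oplus> b \<notin> P" for P
      using that additive_subgroup.a_closed[of P R a b] by (auto simp: primeideal_def ideal_def)
    then have "{P. primeideal P R \<and> a \<oplus> b \<notin> P} \<subseteq> \<Union>(F \<union> G)" using h by blast
    then show "a \<oplus> b \<in> J" using h unfolding J_def
      by (intro CollectI conjI exI[of _ "F \<union> G"]) auto
  next
    fix a x assume "a \<in> J" and x: "x \<in> carrier R"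
    then obtain F where h: "a \<in> carrier R" "finite F" "F \<subseteq> \<U>" "{P. primeideal P R \<and> a \<notin> P} \<subseteq> \<Union>F"
      by (auto simp: J_def)
    have "a \<notin> P" if "primeideal P R" "x \<otimes> a \<notin> P" for P
      using that x ideal.I_l_closed[of P R a x] by (auto simp: primeideal_def)
    then have "{P. primeideal P R \<and> x \<otimes> a \<notin> P} \<subseteq> \<Union>F" using h by blast
    then show "x \<otimes> a \<in> J" using h x unfolding J_def
      by (intro CollectI conjI exI[of _ F]) auto
  qed
  have "\<one> \<in> J"
  proof (rule ccontr)
    assume "\<one> \<notin> J"
    then obtain P where P: "primeideal P R" "J \<subseteq> P"
      using prime_ideal_avoiding[OF J, of "{\<one>}"] by auto
    then obtain U where U: "U \<in> \<U>" "P \<in> U" using cov topspace_zariski by blast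
    then obtain a where a: "a \<in> carrier R" "a \<notin> P" "{P. primeideal P R \<and> a \<notin> P} \<subseteq> U"
      using op openin_zariskiE by metis
    then have "a \<in> J" using U unfolding J_def by (intro CollectI conjI exI[of _ "{U}"]) auto
    then show False using a P by auto
  qed
  then obtain \<F> where F: "finite \<F>" "\<F> \<subseteq> \<U>" "{P. primeideal P R \<and> \<one> \<notin> P} \<subseteq> \<Union>\<F>"
    by (auto simp: J_def)
  have "topspace (zariski R) \<subseteq> \<Union>\<F>" using F(3) one_notin_prime unfolding topspace_zariski by blast
  moreover have "\<Union>\<F> \<subseteq> topspace (zariski R)" using F(2) cov by blast
  ultimately show "\<exists>\<F>. finite \<F> \<and> \<F> \<subseteq> \<U> \<and> \<Union>\<F> = topspace (zariski R)" using F by blast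
qed

text \<open>
  The algebraic content of the T1 axiom. It says that an element of a prime \<open>P\<close> becomes nilpotent
  in the local ring at \<open>P\<close>.
\<close>

lemma (in cring) T1_zariski_killed:
  assumes T1: "t1_space (zariski R)" and P: "primeideal P R" and a: "a \<in> P"
  shows "\<exists>s\<in>carrier R - P. \<exists>n::nat. s \<otimes> a [^] n = \<zero>"
proof (rule ccontr)
  assume no: "\<not> ?thesis"
  interpret P: primeideal P R by fact
  have ac: "a \<in> carrier R" using a P.Icarr by auto
  \<comment> \<open>A prime disjoint from this set is contained in P and omits a, contradicting T1.\<close>
  define S where "S = {s \<otimes> a [^] n | s (n::nat). s \<in> carrier R - P}"
  have one: "\<one> \<notin> P" using P by (rule one_notin_prime)
  have "\<exists>Q. primeideal Q R \<and> {\<zero>} \<subseteq> Q \<and> Q \<inter> S = {}"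
  proof (rule prime_ideal_avoiding)
    show "ideal {\<zero>} R" by (rule zeroideal)
    show "S \<subseteq> carrier R" using ac by (auto simp: S_def)
    show "\<one> \<in> S" unfolding S_def
      by (rule CollectI, rule exI[of _ \<one>], rule exI[of _ 0]) (use one in auto)
    have "\<zero> \<notin> S"
    proof
      assume "\<zero> \<in> S"
      then obtain s n where "\<zero> = s \<otimes> a [^] (n::nat)" "s \<in> carrier R - P" unfolding S_def by blast
      then show False using no by metis
    qed
    then show "{\<zero>} \<inter> S = {}" by blast
    fix s t assume "s \<in> S" "t \<in> S"
    then obtain u m v n where h: "s = u \<otimes> a [^] (m::nat)" "t = v \<otimes> a [^] (n::nat)"
      "u \<in> carrier R - P" "v \<in> carrier R - P" by (auto simp: S_def)
    have "s \<otimes> t = (u \<otimes> v) \<otimes> a [^] (m + n)"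
      using h ac by (simp add: m_ac nat_pow_mult[symmetric])
    moreover have "u \<otimes> v \<in> carrier R - P" using h P.I_prime by auto
    ultimately show "s \<otimes> t \<in> S" unfolding S_def by blast
  qed
  then obtain Q where Q: "primeideal Q R" "Q \<inter> S = {}" by auto
  interpret Q: primeideal Q R by fact
  have "\<one> \<otimes> a [^] (1::nat) \<in> S" unfolding S_def using one by blast
  then have aQ: "a \<notin> Q" using Q(2) ac by auto
  have "Q \<subseteq> P"
  proof
    fix x assume x: "x \<in> Q"
    have "x \<otimes> a [^] (0::nat) \<in> S" if "x \<notin> P" unfolding S_def using that x Q.Icarr by blast
    then show "x \<in> P" using Q(2) x Q.Icarr by auto
  qed
  obtain U where U: "openin (zariski R) U" "P \<in> U" "Q \<notin> U"
    using T1 P Q aQ a unfolding t1_space_def topspace_zariski by blast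
  obtain b where "b \<in> carrier R" "b \<notin> P" "{P. primeideal P R \<and> b \<notin> P} \<subseteq> U"
    using openin_zariskiE[OF U(1,2)] by metis
  then show False using U Q \<open>Q \<subseteq> P\<close> by blast
qed

lemma (in cring) prime_pow_notin:
  assumes "primeideal P R" "a \<in> carrier R" "a \<notin> P"
  shows "a [^] (n::nat) \<notin> P"
proof (induction n)
  case 0
  then show ?case using one_notin_prime[OF assms(1)] by simp
next
  case (Suc n)
  then show ?case using assms primeideal.I_prime[OF assms(1), of "a [^] n" a] by auto
qed

text \<open>
  If \<open>s a^n = 0\<close> with \<open>s\<close> outside \<open>P\<close>, then every prime that omits \<open>s\<close> contains \<open>a\<close>, so the
  basic open set of \<open>s\<close> is a neighbourhood of \<open>P\<close> in the zero set of \<open>a\<close>.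
\<close>

lemma (in cring) T1_zariski_closed_basic:
  assumes T1: "t1_space (zariski R)" and a: "a \<in> carrier R"
  shows "openin (zariski R) {P. primeideal P R \<and> a \<in> P}"
proof (subst openin_subopen, intro ballI)
  fix P assume "P \<in> {P. primeideal P R \<and> a \<in> P}"
  then have P: "primeideal P R" "a \<in> P" by auto
  obtain s n where s: "s \<in> carrier R - P" "s \<otimes> a [^] (n::nat) = \<zero>"
    using T1_zariski_killed[OF T1 P] by blast
  have "a \<in> Q" if Q: "primeideal Q R" "s \<notin> Q" for Q
  proof (rule ccontr)
    assume "a \<notin> Q"
    moreover have "\<zero> \<in> Q" using Q(1) by (rule zero_in_prime)
    ultimately show False
      using primeideal.I_prime[OF Q(1), of s "a [^] n"] prime_pow_notin[OF Q(1) a] s Q(2) a by auto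
  qed
  then show "\<exists>T. openin (zariski R) T \<and> P \<in> T \<and> T \<subseteq> {P. primeideal P R \<and> a \<in> P}"
    using zariski_basic_open[of s] s P by (intro exI[of _ "{P. primeideal P R \<and> s \<notin> P}"]) auto
qed

lemma primeideal_vimage:
  assumes R: "cring R" and S: "cring S" and h: "h \<in> ring_hom R S" and P: "primeideal P S"
  shows "primeideal {a \<in> carrier R. h a \<in> P} R"
proof -
  interpret ring_hom_cring R S h by (simp add: R S h ring_hom_cring_axioms_def ring_hom_cring_def)
  interpret P: primeideal P S by fact
  show ?thesis
  proof (rule primeidealI[OF _ R])
    show "ideal {a \<in> carrier R. h a \<in> P} R"
      by (rule R.idealI_cring) (auto intro: P.I_l_closed)
    have "\<one>\<^bsub>R\<^esub> \<notin> {a \<in> carrier R. h a \<in> P}" using S.one_notin_prime[OF P] by simp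
    then show "carrier R \<noteq> {a \<in> carrier R. h a \<in> P}" using R.one_closed by blast
    fix a b assume ab: "a \<in> carrier R" "b \<in> carrier R" "a \<otimes>\<^bsub>R\<^esub> b \<in> {a \<in> carrier R. h a \<in> P}"
    then show "a \<in> {a \<in> carrier R. h a \<in> P} \<or> b \<in> {a \<in> carrier R. h a \<in> P}"
      using P.I_prime[of "h a" "h b"] by simp
  qed
qed

section \<open>Local rings with nil maximal ideal\<close>

text \<open>
  Equivalently, a commutative ring with exactly one prime ideal. The form with units and
  nilpotents is the one that can be checked on germs.
\<close>

definition nil_local_ring :: "('a, 'm) ring_scheme \<Rightarrow> bool" where
  "nil_local_ring R \<longleftrightarrow> cring R \<and> \<one>\<^bsub>R\<^esub> \<noteq> \<zero>\<^bsub>R\<^esub> \<and>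
     (\<forall>x\<in>carrier R. x \<in> Units R \<or> (\<exists>n::nat. x [^]\<^bsub>R\<^esub> n = \<zero>\<^bsub>R\<^esub>))"

lemma (in cring) unit_not_nilpotent:
  assumes "x \<in> Units R" "x [^] (n::nat) = \<zero>"
  shows "\<one> = \<zero>"
proof -
  obtain y where "y \<in> carrier R" "x [^] n \<otimes> y = \<one>"
    using Units_r_inv_ex[OF Units_pow_closed[OF assms(1)]] by blast
  then show ?thesis using assms(2) by simp
qed

text \<open>
  The point is closure under addition. Suppose that \<open>a\<close> and \<open>b\<close> are nilpotent and \<open>a + b\<close> is a
  unit, and let \<open>j + 1\<close> be the least exponent that kills \<open>a\<close>. Multiplication by \<open>a^j\<close> identifies
  \<open>b\<close> with \<open>a + b\<close>, so \<open>a^j\<close> is killed by a power of a unit and vanishes. This avoids the binomial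
  theorem.
\<close>

lemma (in cring) nonunits_ideal:
  assumes "nil_local_ring R"
  shows "ideal {x \<in> carrier R. x \<notin> Units R} R"
proof -
  have ne: "\<one> \<noteq> \<zero>" and nil: "\<And>x. x \<in> carrier R \<Longrightarrow> x \<notin> Units R \<Longrightarrow> \<exists>n::nat. x [^] n = \<zero>"
    using assms by (auto simp: nil_local_ring_def)
  show ?thesis
  proof (rule idealI_cring)
    show "\<zero> \<in> {x \<in> carrier R. x \<notin> Units R}" using unit_not_nilpotent[of \<zero> 1] ne by auto
    fix a b assume "a \<in> {x \<in> carrier R. x \<notin> Units R}" "b \<in> {x \<in> carrier R. x \<notin> Units R}"
    then have ab: "a \<in> carrier R" "b \<in> carrier R" "a \<notin> Units R" "b \<notin> Units R" by auto
    obtain m n where m: "a [^] (m::nat) = \<zero>" and n: "b [^] (n::nat) = \<zero>" using nil ab by meson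
    have "a \<oplus> b \<notin> Units R"
    proof
      assume u: "a \<oplus> b \<in> Units R"
      define k where "k = (LEAST m. a [^] (m::nat) = \<zero>)"
      have k: "a [^] k = \<zero>" unfolding k_def using m by (rule LeastI)
      have "k \<noteq> 0"
      proof
        assume "k = 0"
        then show False using k ne by simp
      qed
      then obtain j where j: "k = Suc j" by (cases k) auto
      have nz: "a [^] j \<noteq> \<zero>" using not_less_Least[of j "\<lambda>m. a [^] m = \<zero>"] j unfolding k_def[symmetric] by auto
      have step: "a [^] j \<otimes> b [^] i = a [^] j \<otimes> (a \<oplus> b) [^] i" for i :: nat
      proof (induction i)
        case (Suc i)
        have "a [^] j \<otimes> (a \<oplus> b) [^] Suc i = (a [^] j \<otimes> b [^] i) \<otimes> (a \<oplus> b)"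
          using Suc ab by (simp add: m_assoc)
        also have "\<dots> = b [^] i \<otimes> a [^] Suc j \<oplus> a [^] j \<otimes> b [^] Suc i"
          using ab by (simp add: r_distr m_ac)
        also have "\<dots> = a [^] j \<otimes> b [^] Suc i" using k j ab by simp
        finally show ?case by simp
      qed simp
      have "(a [^] j) \<otimes> (a \<oplus> b) [^] n = \<zero>" using step[of n] n ab by simp
      moreover obtain v where v: "v \<in> carrier R" "(a \<oplus> b) [^] n \<otimes> v = \<one>"
        using Units_r_inv_ex[OF Units_pow_closed[OF u]] by blast
      moreover have "a [^] j = (a [^] j \<otimes> (a \<oplus> b) [^] n) \<otimes> v"
        using v ab by (simp add: m_assoc)
      ultimately show False using v(1) nz by simp
    qed
    then show "a \<oplus> b \<in> {x \<in> carrier R. x \<notin> Units R}" using ab by auto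
  next
    fix a x assume "a \<in> {x \<in> carrier R. x \<notin> Units R}" "x \<in> carrier R"
    moreover from this have "x \<otimes> a \<notin> Units R" using unit_factor[of a x] m_comm[of x a] by auto
    ultimately show "x \<otimes> a \<in> {x \<in> carrier R. x \<notin> Units R}" by auto
  qed auto
qed

lemma nil_local_ring_maximalideal_iff:
  assumes R: "nil_local_ring R"
  shows "maximalideal M R \<longleftrightarrow> M = {x \<in> carrier R. x \<notin> Units R}"
proof -
  interpret cring R using R by (simp add: nil_local_ring_def)
  have unit: "I = carrier R" if I: "ideal I R" and x: "x \<in> I" "x \<in> Units R" for I x
  proof -
    obtain y where "y \<in> carrier R" "x \<otimes>\<^bsub>R\<^esub> y = \<one>\<^bsub>R\<^esub>" using Units_r_inv_ex[OF x(2)] by blast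
    then show ?thesis using ideal.one_imp_carrier[OF I] ideal.I_r_closed[OF I x(1)] by metis
  qed
  let ?N = "{x \<in> carrier R. x \<notin> Units R}"
  have N: "ideal ?N R" by (rule nonunits_ideal[OF R])
  have max: "maximalideal ?N R"
  proof (rule maximalidealI[OF N])
    show "carrier R \<noteq> ?N" using Units_one_closed by blast
    fix J assume "ideal J R" "?N \<subseteq> J" "J \<subseteq> carrier R"
    then show "J = ?N \<or> J = carrier R" using unit by blast
  qed
  show ?thesis
  proof
    assume M: "maximalideal M R"
    then interpret M: maximalideal M R .
    have "M \<subseteq> ?N" using unit[OF M.is_ideal] M.I_notcarr M.Icarr by blast
    then show "M = ?N" using M.I_maximal[OF N] N maximalideal.I_notcarr[OF max] by auto
  qed (use max in simp)
qed

lemma nil_local_ring_local: "nil_local_ring R \<Longrightarrow> local_ring R"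
  by (auto simp: local_ring_def nil_local_ring_maximalideal_iff) (simp add: nil_local_ring_def)

lemma ring_hom_nat_pow:
  assumes "cring R" "cring S" "h \<in> ring_hom R S" "x \<in> carrier R"
  shows "h (x [^]\<^bsub>R\<^esub> (n::nat)) = h x [^]\<^bsub>S\<^esub> n"
  using assms by (intro ring_hom_ring.hom_nat_pow ring_hom_ringI2) (simp_all add: cring_def)

lemma ring_hom_Units:
  assumes "cring R" "cring S" "h \<in> ring_hom R S" "x \<in> Units R"
  shows "h x \<in> Units S"
proof -
  interpret ring_hom_cring R S h by (simp add: assms ring_hom_cring_axioms_def ring_hom_cring_def)
  obtain y where y: "y \<in> carrier R" "x \<otimes>\<^bsub>R\<^esub> y = \<one>\<^bsub>R\<^esub>" "x \<in> carrier R"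
    using assms(4) R.Units_r_inv_ex by blast
  then have "h x \<otimes>\<^bsub>S\<^esub> h y = \<one>\<^bsub>S\<^esub>" using hom_mult[of x y] by simp
  moreover from this have "h y \<otimes>\<^bsub>S\<^esub> h x = \<one>\<^bsub>S\<^esub>" using y S.m_comm[of "h x" "h y"] by simp
  moreover have "h x \<in> carrier S" "h y \<in> carrier S" using y by auto
  ultimately show ?thesis unfolding Units_def by blast
qed

text \<open>
  Units go to units and nilpotents to nilpotents; in rings of this kind there is nothing else, so
  a homomorphism also reflects units.
\<close>

lemma nil_local_ring_hom_local:
  assumes R: "nil_local_ring R" and S: "nil_local_ring S" and h: "h \<in> ring_hom R S"
  shows "local_ring_hom R S h"
proof -
  have c: "cring R" "cring S" using R S by (auto simp: nil_local_ring_def)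
  have z: "h \<zero>\<^bsub>R\<^esub> = \<zero>\<^bsub>S\<^esub>" using ring_hom_zero[OF h] c by (simp add: cring_def)
  have "h a \<in> Units S \<longleftrightarrow> a \<in> Units R" if a: "a \<in> carrier R" for a
  proof
    assume u: "h a \<in> Units S"
    show "a \<in> Units R"
    proof (rule ccontr)
      assume "a \<notin> Units R"
      then obtain n where "a [^]\<^bsub>R\<^esub> (n::nat) = \<zero>\<^bsub>R\<^esub>" using R a by (auto simp: nil_local_ring_def)
      then have "h a [^]\<^bsub>S\<^esub> n = \<zero>\<^bsub>S\<^esub>" using ring_hom_nat_pow[OF c h a, of n] z by simp
      then show False using cring.unit_not_nilpotent[OF c(2) u] S by (auto simp: nil_local_ring_def)
    qed
  qed (rule ring_hom_Units[OF c h])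
  then have "{a \<in> carrier R. h a \<in> {y \<in> carrier S. y \<notin> Units S}} = {x \<in> carrier R. x \<notin> Units R}"
    using ring_hom_closed[OF h] by blast
  then show ?thesis
    unfolding local_ring_hom_def nil_local_ring_maximalideal_iff[OF R]
        nil_local_ring_maximalideal_iff[OF S] using h by (intro conjI allI impI) (simp only:)+
qed

section \<open>Localizations\<close>

text \<open>
  Operations on localizations and on stalks are defined as a union over all representatives; they
  are computed by showing that every choice of representatives gives the same class.
\<close>

lemma UN_UN_constant:
  assumes "A \<noteq> {}" "B \<noteq> {}" "\<And>a s b t. (a, s) \<in> A \<Longrightarrow> (b, t) \<in> B \<Longrightarrow> F a s b t = C"
  shows "(\<Union>(a, s)\<in>A. \<Union>(b, t)\<in>B. F a s b t) = C"
  using assms by fast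

locale localized_ring = cring R for R (structure) +
  fixes S
  assumes S_subset: "S \<subseteq> carrier R" and one_in_S: "\<one> \<in> S"
    and mult_in_S: "s \<in> S \<Longrightarrow> t \<in> S \<Longrightarrow> s \<otimes> t \<in> S"
begin

abbreviation frac where "frac \<equiv> fraction R S"
abbreviation L where "L \<equiv> localization R S"

lemma S_carrier [simp]: "s \<in> S \<Longrightarrow> s \<in> carrier R"
  using S_subset by auto

lemma fraction_subset:
  assumes "a \<in> carrier R" "b \<in> carrier R" "s \<in> S" "t \<in> S" "u \<in> S"
    and eq: "u \<otimes> (t \<otimes> a) = u \<otimes> (s \<otimes> b)"
  shows "frac b t \<subseteq> frac a s"
proof clarify
  fix c r assume "(c, r) \<in> frac b t"
  then obtain v where c: "c \<in> carrier R" "r \<in> S" "v \<in> S" "v \<otimes> (r \<otimes> b) = v \<otimes> (t \<otimes> c)"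
    by (auto simp: fraction_def)
  have "(u \<otimes> v \<otimes> t) \<otimes> (r \<otimes> a) = (v \<otimes> r) \<otimes> (u \<otimes> (t \<otimes> a))"
    using assms(1-5) c(1-3) by (simp add: m_ac)
  also have "\<dots> = (u \<otimes> s) \<otimes> (v \<otimes> (r \<otimes> b))"
    unfolding eq using assms(1-5) c(1-3) by (simp add: m_ac)
  also have "\<dots> = (u \<otimes> v \<otimes> t) \<otimes> (s \<otimes> c)"
    unfolding c(4) using assms(1-5) c(1-3) by (simp add: m_ac)
  finally have "(u \<otimes> v \<otimes> t) \<otimes> (r \<otimes> a) = (u \<otimes> v \<otimes> t) \<otimes> (s \<otimes> c)" .
  moreover have "u \<otimes> v \<otimes> t \<in> S" using assms c mult_in_S by auto
  ultimately show "(c, r) \<in> frac a s" using c by (auto simp: fraction_def)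
qed

lemma fraction_eqI:
  assumes "a \<in> carrier R" "b \<in> carrier R" "s \<in> S" "t \<in> S" "u \<in> S"
    and "u \<otimes> (t \<otimes> a) = u \<otimes> (s \<otimes> b)"
  shows "frac a s = frac b t"
  using fraction_subset[OF assms] fraction_subset[OF assms(2,1,4,3,5) assms(6)[symmetric]] by auto

lemma fraction_self: "a \<in> carrier R \<Longrightarrow> s \<in> S \<Longrightarrow> (a, s) \<in> frac a s"
  using one_in_S by (auto simp: fraction_def)

lemma fraction_eqE:
  assumes "frac a s = frac b t" "b \<in> carrier R" "t \<in> S"
  obtains u where "u \<in> S" "u \<otimes> (t \<otimes> a) = u \<otimes> (s \<otimes> b)"
proof -
  have "(b, t) \<in> frac a s" using fraction_self[OF assms(2,3)] assms(1) by simp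
  then show ?thesis using that by (auto simp: fraction_def)
qed

lemma fraction_cancel:
  assumes "a \<in> carrier R" "s \<in> S" "t \<in> S"
  shows "frac (t \<otimes> a) (t \<otimes> s) = frac a s"
  by (rule fraction_eqI[OF _ _ _ _ one_in_S]) (use assms mult_in_S in \<open>auto simp: m_ac\<close>)

lemma fraction_carrier: "a \<in> carrier R \<Longrightarrow> s \<in> S \<Longrightarrow> frac a s \<in> carrier L"
  by (auto simp: localization_def)

lemma fraction_mult:
  assumes "a \<in> carrier R" "b \<in> carrier R" "s \<in> S" "t \<in> S"
  shows "frac a s \<otimes>\<^bsub>L\<^esub> frac b t = frac (a \<otimes> b) (s \<otimes> t)"
proof -
  have "frac (a' \<otimes> b') (s' \<otimes> t') = frac (a \<otimes> b) (s \<otimes> t)"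
    if "(a', s') \<in> frac a s" "(b', t') \<in> frac b t" for a' s' b' t'
  proof -
    obtain u v where h: "a' \<in> carrier R" "b' \<in> carrier R" "s' \<in> S" "t' \<in> S" "u \<in> S" "v \<in> S"
      and e: "u \<otimes> (s' \<otimes> a) = u \<otimes> (s \<otimes> a')" "v \<otimes> (t' \<otimes> b) = v \<otimes> (t \<otimes> b')"
      using \<open>(a', s') \<in> _\<close> \<open>(b', t') \<in> _\<close> by (auto simp: fraction_def)
    have "(u \<otimes> v) \<otimes> ((s \<otimes> t) \<otimes> (a' \<otimes> b')) = (u \<otimes> (s \<otimes> a')) \<otimes> (v \<otimes> (t \<otimes> b'))"
      using h assms by (simp add: m_ac)
    also have "\<dots> = (u \<otimes> v) \<otimes> ((s' \<otimes> t') \<otimes> (a \<otimes> b))"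
      unfolding e[symmetric] using h assms by (simp add: m_ac)
    finally show ?thesis
      using h assms mult_in_S by (intro fraction_eqI[of _ _ _ _ "u \<otimes> v"]) auto
  qed
  then show ?thesis
    unfolding localization_def monoid.simps
    by (intro UN_UN_constant) (use fraction_self assms in blast)+
qed

lemma fraction_add:
  assumes "a \<in> carrier R" "b \<in> carrier R" "s \<in> S" "t \<in> S"
  shows "frac a s \<oplus>\<^bsub>L\<^esub> frac b t = frac ((t \<otimes> a) \<oplus> (s \<otimes> b)) (s \<otimes> t)"
proof -
  have "frac ((t' \<otimes> a') \<oplus> (s' \<otimes> b')) (s' \<otimes> t') = frac ((t \<otimes> a) \<oplus> (s \<otimes> b)) (s \<otimes> t)"
    if "(a', s') \<in> frac a s" "(b', t') \<in> frac b t" for a' s' b' t'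
  proof -
    obtain u v where h: "a' \<in> carrier R" "b' \<in> carrier R" "s' \<in> S" "t' \<in> S" "u \<in> S" "v \<in> S"
      and e: "u \<otimes> (s' \<otimes> a) = u \<otimes> (s \<otimes> a')" "v \<otimes> (t' \<otimes> b) = v \<otimes> (t \<otimes> b')"
      using \<open>(a', s') \<in> _\<close> \<open>(b', t') \<in> _\<close> by (auto simp: fraction_def)
    have "(u \<otimes> v) \<otimes> ((s \<otimes> t) \<otimes> ((t' \<otimes> a') \<oplus> (s' \<otimes> b')))
      = (v \<otimes> t \<otimes> t') \<otimes> (u \<otimes> (s \<otimes> a')) \<oplus> (u \<otimes> s \<otimes> s') \<otimes> (v \<otimes> (t \<otimes> b'))"
      using h assms by (simp add: r_distr m_ac)
    also have "\<dots> = (u \<otimes> v) \<otimes> ((s' \<otimes> t') \<otimes> ((t \<otimes> a) \<oplus> (s \<otimes> b)))"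
      unfolding e[symmetric] using h assms by (simp add: r_distr m_ac)
    finally show ?thesis
      using h assms mult_in_S by (intro fraction_eqI[of _ _ _ _ "u \<otimes> v"]) auto
  qed
  then show ?thesis
    unfolding localization_def ring.simps
    by (intro UN_UN_constant) (use fraction_self assms in blast)+
qed

lemma fraction_add_same:
  assumes "a \<in> carrier R" "b \<in> carrier R" "s \<in> S"
  shows "frac a s \<oplus>\<^bsub>L\<^esub> frac b s = frac (a \<oplus> b) s"
  using assms fraction_cancel[of "a \<oplus> b" s s] by (simp add: fraction_add r_distr)

lemma localization_one: "\<one>\<^bsub>L\<^esub> = frac \<one> \<one>" and localization_zero: "\<zero>\<^bsub>L\<^esub> = frac \<zero> \<one>"
  by (simp_all add: localization_def)

lemma localization_zero_eq: "s \<in> S \<Longrightarrow> \<zero>\<^bsub>L\<^esub> = frac \<zero> s"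
  unfolding localization_zero using one_in_S by (intro fraction_eqI[of _ _ _ _ \<one>]) auto

lemma localization_one_eq: "s \<in> S \<Longrightarrow> \<one>\<^bsub>L\<^esub> = frac s s"
  unfolding localization_one using one_in_S by (intro fraction_eqI[of _ _ _ _ \<one>]) auto

lemma localization_carrierE:
  assumes "x \<in> carrier L"
  obtains a s where "a \<in> carrier R" "s \<in> S" "x = frac a s"
  using assms by (auto simp: localization_def)

text \<open>
  The ring axioms involve at most three elements, and over a common denominator they reduce to
  the axioms of \<open>R\<close>.
\<close>

lemma common_denominator:
  assumes "x \<in> carrier L" "y \<in> carrier L" "z \<in> carrier L"
  obtains a b c s where "a \<in> carrier R" "b \<in> carrier R" "c \<in> carrier R" "s \<in> S"
    "x = frac a s" "y = frac b s" "z = frac c s"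
proof -
  obtain a r b s c t where h: "a \<in> carrier R" "r \<in> S" "x = frac a r" "b \<in> carrier R" "s \<in> S" "y = frac b s"
    "c \<in> carrier R" "t \<in> S" "z = frac c t"
    using assms by (metis localization_carrierE)
  have "x = frac ((s \<otimes> t) \<otimes> a) (r \<otimes> s \<otimes> t)" "y = frac ((r \<otimes> t) \<otimes> b) (r \<otimes> s \<otimes> t)"
    "z = frac ((r \<otimes> s) \<otimes> c) (r \<otimes> s \<otimes> t)"
    unfolding h by (rule fraction_eqI[OF _ _ _ _ one_in_S]; use h mult_in_S in \<open>simp add: m_ac\<close>)+
  then show ?thesis using that h mult_in_S by (metis S_carrier m_closed)
qed

lemma localization_cring: "cring L"
proof (rule cringI)
  show "abelian_group L"
  proof (rule abelian_groupI)
    show "\<zero>\<^bsub>L\<^esub> \<in> carrier L" using one_in_S by (simp add: localization_zero fraction_carrier)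
    fix x y z assume xyz: "x \<in> carrier L" "y \<in> carrier L" "z \<in> carrier L"
    obtain a b c s where "a \<in> carrier R" "b \<in> carrier R" "c \<in> carrier R" "s \<in> S"
      "x = frac a s" "y = frac b s" "z = frac c s"
      using common_denominator[OF xyz] .
    then show "x \<oplus>\<^bsub>L\<^esub> y \<oplus>\<^bsub>L\<^esub> z = x \<oplus>\<^bsub>L\<^esub> (y \<oplus>\<^bsub>L\<^esub> z)"
      by (simp add: fraction_add_same a_assoc)
  next
    fix x y assume xy: "x \<in> carrier L" "y \<in> carrier L"
    obtain a b c s where "a \<in> carrier R" "b \<in> carrier R" "s \<in> S" "x = frac a s" "y = frac b s"
      using common_denominator[OF xy xy(1)] .
    then show "x \<oplus>\<^bsub>L\<^esub> y = y \<oplus>\<^bsub>L\<^esub> x" "x \<oplus>\<^bsub>L\<^esub> y \<in> carrier L"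
      by (auto simp: fraction_add_same a_comm fraction_carrier)
  next
    fix x assume "x \<in> carrier L"
    then obtain a s where h: "a \<in> carrier R" "s \<in> S" "x = frac a s" by (rule localization_carrierE)
    then show "\<zero>\<^bsub>L\<^esub> \<oplus>\<^bsub>L\<^esub> x = x"
      by (simp add: localization_zero_eq[OF h(2)] fraction_add_same)
    show "\<exists>y\<in>carrier L. y \<oplus>\<^bsub>L\<^esub> x = \<zero>\<^bsub>L\<^esub>"
      using h by (intro bexI[of _ "frac (\<ominus> a) s"])
        (simp_all add: localization_zero_eq[OF h(2)] fraction_add_same l_neg fraction_carrier)
  qed
  show "comm_monoid L"
  proof (rule comm_monoidI)
    show "\<one>\<^bsub>L\<^esub> \<in> carrier L" using one_in_S by (simp add: localization_one fraction_carrier)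
    fix x y z assume xyz: "x \<in> carrier L" "y \<in> carrier L" "z \<in> carrier L"
    obtain a b c s where "a \<in> carrier R" "b \<in> carrier R" "c \<in> carrier R" "s \<in> S"
      "x = frac a s" "y = frac b s" "z = frac c s"
      using common_denominator[OF xyz] .
    then show "x \<otimes>\<^bsub>L\<^esub> y \<otimes>\<^bsub>L\<^esub> z = x \<otimes>\<^bsub>L\<^esub> (y \<otimes>\<^bsub>L\<^esub> z)"
      by (simp add: fraction_mult m_assoc mult_in_S)
  next
    fix x y assume xy: "x \<in> carrier L" "y \<in> carrier L"
    obtain a b c s where "a \<in> carrier R" "b \<in> carrier R" "s \<in> S" "x = frac a s" "y = frac b s"
      using common_denominator[OF xy xy(1)] .
    then show "x \<otimes>\<^bsub>L\<^esub> y = y \<otimes>\<^bsub>L\<^esub> x" "x \<otimes>\<^bsub>L\<^esub> y \<in> carrier L"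
      by (auto simp: fraction_mult m_comm fraction_carrier mult_in_S)
  next
    fix x assume "x \<in> carrier L"
    then obtain a s where h: "a \<in> carrier R" "s \<in> S" "x = frac a s" by (rule localization_carrierE)
    then show "\<one>\<^bsub>L\<^esub> \<otimes>\<^bsub>L\<^esub> x = x"
      by (simp add: localization_one fraction_mult one_in_S)
  qed
  fix x y z assume xyz: "x \<in> carrier L" "y \<in> carrier L" "z \<in> carrier L"
  obtain a b c s where "a \<in> carrier R" "b \<in> carrier R" "c \<in> carrier R" "s \<in> S"
    "x = frac a s" "y = frac b s" "z = frac c s"
    using common_denominator[OF xyz] .
  then show "(x \<oplus>\<^bsub>L\<^esub> y) \<otimes>\<^bsub>L\<^esub> z = x \<otimes>\<^bsub>L\<^esub> z \<oplus>\<^bsub>L\<^esub> y \<otimes>\<^bsub>L\<^esub> z"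
    by (simp add: fraction_add_same fraction_mult l_distr mult_in_S)
qed

end

lemma (in cring) localized_at_prime:
  assumes "primeideal P R"
  shows "localized_ring R (carrier R - P)"
proof -
  interpret P: primeideal P R by fact
  show ?thesis
    by unfold_locales (use P.I_prime one_notin_prime[OF assms] in auto)
qed

section \<open>The spectrum as a ringed space\<close>

lemma spec_sections_simps:
  "monoid.mult (spec_sections R U) s t = (\<lambda>P\<in>U. s P \<otimes>\<^bsub>local_at R P\<^esub> t P)"
  "add (spec_sections R U) s t = (\<lambda>P\<in>U. s P \<oplus>\<^bsub>local_at R P\<^esub> t P)"
  "one (spec_sections R U) = (\<lambda>P\<in>U. \<one>\<^bsub>local_at R P\<^esub>)"
  "zero (spec_sections R U) = (\<lambda>P\<in>U. \<zero>\<^bsub>local_at R P\<^esub>)"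
  by (simp_all add: spec_sections_def)

context cring begin

definition locally_fraction where
  "locally_fraction U s P \<longleftrightarrow> (\<exists>V a b. openin (zariski R) V \<and> P \<in> V \<and> V \<subseteq> U \<and>
     a \<in> carrier R \<and> b \<in> carrier R \<and> (\<forall>Q\<in>V. b \<notin> Q \<and> s Q = fraction R (carrier R - Q) a b))"

lemma spec_sections_carrier:
  "s \<in> carrier (spec_sections R U) \<longleftrightarrow>
     s \<in> (\<Pi>\<^sub>E P\<in>U. carrier (local_at R P)) \<and> (\<forall>P\<in>U. locally_fraction U s P)"
  by (simp add: spec_sections_def locally_fraction_def)

lemma open_prime: "openin (zariski R) U \<Longrightarrow> P \<in> U \<Longrightarrow> primeideal P R"
  using openin_subset topspace_zariski by blast

lemma spec_sections_at:
  "s \<in> carrier (spec_sections R U) \<Longrightarrow> P \<in> U \<Longrightarrow> s P \<in> carrier (local_at R P)"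
  by (auto simp: spec_sections_carrier)

lemma local_at_cring: "primeideal P R \<Longrightarrow> cring (local_at R P)"
  by (rule localized_ring.localization_cring[OF localized_at_prime])

lemma locally_fractionI:
  assumes "openin (zariski R) V" "P \<in> V" "V \<subseteq> U" "a \<in> carrier R" "b \<in> carrier R"
    "\<And>Q. Q \<in> V \<Longrightarrow> b \<notin> Q \<and> s Q = fraction R (carrier R - Q) a b"
  shows "locally_fraction U s P"
  using assms unfolding locally_fraction_def by blast

text \<open>
  A common argument for sums and products: two local fraction representations are intersected and
  combined by a formula \<open>F\<close> for the numerator over the product of the denominators.
\<close>

lemma locally_fraction_combine:
  assumes U: "openin (zariski R) U" and st: "locally_fraction U s P" "locally_fraction U t P"
    and c: "\<And>a b c d. a \<in> carrier R \<Longrightarrow> b \<in> carrier R \<Longrightarrow> c \<in> carrier R \<Longrightarrow> d \<in> carrier R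
      \<Longrightarrow> F a b c d \<in> carrier R"
    and r: "\<And>Q a b c d. Q \<in> U \<Longrightarrow> primeideal Q R \<Longrightarrow> a \<in> carrier R \<Longrightarrow> b \<in> carrier R - Q \<Longrightarrow>
      c \<in> carrier R \<Longrightarrow> d \<in> carrier R - Q \<Longrightarrow>
      s Q = fraction R (carrier R - Q) a b \<Longrightarrow> t Q = fraction R (carrier R - Q) c d \<Longrightarrow>
      r Q = fraction R (carrier R - Q) (F a b c d) (b \<otimes> d)"
  shows "locally_fraction U r P"
proof -
  obtain V a b where 1: "openin (zariski R) V" "P \<in> V" "V \<subseteq> U" "a \<in> carrier R" "b \<in> carrier R"
    "\<forall>Q\<in>V. b \<notin> Q \<and> s Q = fraction R (carrier R - Q) a b"
    using st(1) unfolding locally_fraction_def by blast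
  obtain W c d where 2: "openin (zariski R) W" "P \<in> W" "W \<subseteq> U" "c \<in> carrier R" "d \<in> carrier R"
    "\<forall>Q\<in>W. d \<notin> Q \<and> t Q = fraction R (carrier R - Q) c d"
    using st(2) unfolding locally_fraction_def by blast
  show ?thesis
  proof (rule locally_fractionI[of "V \<inter> W"])
    fix Q assume Q: "Q \<in> V \<inter> W"
    then have p: "primeideal Q R" using open_prime 1(1) by blast
    have "b \<otimes> d \<notin> Q" using primeideal.I_prime[OF p 1(5) 2(5)] 1(6) 2(6) Q by blast
    then show "b \<otimes> d \<notin> Q \<and> r Q = fraction R (carrier R - Q) (F a b c d) (b \<otimes> d)"
      using r[OF _ p, of a b c d] Q 1 2 by blast
  qed (use 1 2 c in auto)
qed

lemma spec_sections_closed: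
  assumes U: "openin (zariski R) U"
    and s: "s \<in> carrier (spec_sections R U)" and t: "t \<in> carrier (spec_sections R U)"
  shows "s \<otimes>\<^bsub>spec_sections R U\<^esub> t \<in> carrier (spec_sections R U)"
    and "s \<oplus>\<^bsub>spec_sections R U\<^esub> t \<in> carrier (spec_sections R U)"
proof -
  have "s \<otimes>\<^bsub>spec_sections R U\<^esub> t \<in> (\<Pi>\<^sub>E P\<in>U. carrier (local_at R P))"
    "s \<oplus>\<^bsub>spec_sections R U\<^esub> t \<in> (\<Pi>\<^sub>E P\<in>U. carrier (local_at R P))"
    unfolding spec_sections_simps
    using spec_sections_at[OF s] spec_sections_at[OF t] local_at_cring[OF open_prime[OF U]]
    by (auto simp: cring.cring_simprules)
  moreover have "locally_fraction U (s \<otimes>\<^bsub>spec_sections R U\<^esub> t) P" if "P \<in> U" for P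
    by (rule locally_fraction_combine[of U s P t "\<lambda>a b c d. a \<otimes> c"])
      (use U s t that localized_ring.fraction_mult[OF localized_at_prime] in
        \<open>auto simp: spec_sections_carrier spec_sections_simps\<close>)
  moreover have "locally_fraction U (s \<oplus>\<^bsub>spec_sections R U\<^esub> t) P" if "P \<in> U" for P
    by (rule locally_fraction_combine[of U s P t "\<lambda>a b c d. d \<otimes> a \<oplus> b \<otimes> c"])
      (use U s t that localized_ring.fraction_add[OF localized_at_prime] in
        \<open>auto simp: spec_sections_carrier spec_sections_simps\<close>)
  ultimately show "s \<otimes>\<^bsub>spec_sections R U\<^esub> t \<in> carrier (spec_sections R U)"
    "s \<oplus>\<^bsub>spec_sections R U\<^esub> t \<in> carrier (spec_sections R U)"
    by (auto simp: spec_sections_carrier)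
qed

lemma constant_fraction_section:
  assumes W: "openin (zariski R) W" and a: "a \<in> carrier R" "b \<in> carrier R"
    and b: "\<And>Q. Q \<in> W \<Longrightarrow> b \<notin> Q"
  shows "(\<lambda>Q\<in>W. fraction R (carrier R - Q) a b) \<in> carrier (spec_sections R W)"
  unfolding spec_sections_carrier
proof (intro conjI ballI PiE_I)
  fix Q assume Q: "Q \<in> W"
  show "(\<lambda>Q\<in>W. fraction R (carrier R - Q) a b) Q \<in> carrier (local_at R Q)"
    using localized_ring.fraction_carrier[OF localized_at_prime[OF open_prime[OF W Q]], of a b] a b Q by simp
  show "locally_fraction W (\<lambda>Q\<in>W. fraction R (carrier R - Q) a b) Q"
    by (rule locally_fractionI[OF W Q order_refl a]) (simp add: b)
qed simp

lemma constant_section: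
  assumes U: "openin (zariski R) U" and a: "a \<in> carrier R"
  shows "(\<lambda>P\<in>U. fraction R (carrier R - P) a \<one>) \<in> carrier (spec_sections R U)"
  by (rule constant_fraction_section[OF U a one_closed]) (rule one_notin_prime[OF open_prime[OF U]])

text \<open>
  The negative is the product with the section given by the fraction of minus one, so its local
  representability follows from that of products.
\<close>

lemma spec_section_minus:
  assumes U: "openin (zariski R) U" and s: "s \<in> carrier (spec_sections R U)"
  shows "(\<lambda>P\<in>U. \<ominus>\<^bsub>local_at R P\<^esub> s P) \<in> carrier (spec_sections R U)"
proof -
  have m: "(\<lambda>P\<in>U. fraction R (carrier R - P) (\<ominus> \<one>) \<one>) \<in> carrier (spec_sections R U)"
    using constant_section[OF U, of "\<ominus> \<one>"] by simp
  have "(\<ominus>\<^bsub>local_at R P\<^esub> s P) = fraction R (carrier R - P) (\<ominus> \<one>) \<one> \<otimes>\<^bsub>local_at R P\<^esub> s P"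
    if P: "P \<in> U" for P
  proof -
    interpret loc: localized_ring R "carrier R - P"
      using localized_at_prime[OF open_prime[OF U P]] .
    interpret LP: cring "local_at R P" by (rule loc.localization_cring)
    have e: "fraction R (carrier R - P) (\<ominus> \<one>) \<one> \<in> carrier (local_at R P)"
      using loc.one_in_S by (intro loc.fraction_carrier) auto
    have "fraction R (carrier R - P) (\<ominus> \<one>) \<one> \<oplus>\<^bsub>local_at R P\<^esub> \<one>\<^bsub>local_at R P\<^esub> = \<zero>\<^bsub>local_at R P\<^esub>"
      unfolding loc.localization_one loc.localization_zero
      using loc.one_in_S by (subst loc.fraction_add_same) (auto simp: l_neg)
    then have "fraction R (carrier R - P) (\<ominus> \<one>) \<one> = \<ominus>\<^bsub>local_at R P\<^esub> \<one>\<^bsub>local_at R P\<^esub>"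
      using e LP.sum_zero_eq_neg by simp
    then show ?thesis using spec_sections_at[OF s P] by (simp add: LP.l_minus)
  qed
  then have "(\<lambda>P\<in>U. \<ominus>\<^bsub>local_at R P\<^esub> s P)
    = (\<lambda>P\<in>U. fraction R (carrier R - P) (\<ominus> \<one>) \<one>) \<otimes>\<^bsub>spec_sections R U\<^esub> s"
    unfolding spec_sections_simps by (intro restrict_ext) simp
  then show ?thesis using spec_sections_closed(1)[OF U m s] by simp
qed

lemma spec_sections_one_zero:
  assumes "openin (zariski R) U"
  shows "\<one>\<^bsub>spec_sections R U\<^esub> \<in> carrier (spec_sections R U)"
    "\<zero>\<^bsub>spec_sections R U\<^esub> \<in> carrier (spec_sections R U)"
  using constant_section[OF assms, of \<one>] constant_section[OF assms, of \<zero>]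
  by (simp_all add: spec_sections_simps localization_def)

lemma spec_sections_restrict:
  "s \<in> carrier (spec_sections R U) \<Longrightarrow> restrict s U = s"
  by (auto simp: spec_sections_carrier intro: PiE_restrict)

lemma spec_sections_cring:
  assumes U: "openin (zariski R) U"
  shows "cring (spec_sections R U)"
proof -
  have at: "s P \<in> carrier (local_at R P)" if "s \<in> carrier (spec_sections R U)" "P \<in> U" for s P
    using spec_sections_at that .
  note c = cring.cring_simprules[OF local_at_cring[OF open_prime[OF U]]]
  have eqI: "restrict f U = s" if "s \<in> carrier (spec_sections R U)" "\<And>P. P \<in> U \<Longrightarrow> f P = s P" for f s
    using restrict_ext[of U f s, OF that(2)] spec_sections_restrict[OF that(1)] by simp
  show ?thesis
  proof (rule cringI)
    show "abelian_group (spec_sections R U)"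
    proof (rule abelian_groupI)
      fix x y z assume xyz: "x \<in> carrier (spec_sections R U)" "y \<in> carrier (spec_sections R U)"
        "z \<in> carrier (spec_sections R U)"
      show "x \<oplus>\<^bsub>spec_sections R U\<^esub> y \<oplus>\<^bsub>spec_sections R U\<^esub> z =
        x \<oplus>\<^bsub>spec_sections R U\<^esub> (y \<oplus>\<^bsub>spec_sections R U\<^esub> z)"
        unfolding spec_sections_simps by (rule restrict_ext) (simp add: at xyz c(7))
    next
      fix x y assume xy: "x \<in> carrier (spec_sections R U)" "y \<in> carrier (spec_sections R U)"
      show "x \<oplus>\<^bsub>spec_sections R U\<^esub> y \<in> carrier (spec_sections R U)"
        by (rule spec_sections_closed(2)[OF U xy])
      show "x \<oplus>\<^bsub>spec_sections R U\<^esub> y = y \<oplus>\<^bsub>spec_sections R U\<^esub> x"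
        unfolding spec_sections_simps by (rule restrict_ext) (rule c(10)[OF _ at[OF xy(1)] at[OF xy(2)]])
    next
      fix x assume x: "x \<in> carrier (spec_sections R U)"
      show "\<zero>\<^bsub>spec_sections R U\<^esub> \<oplus>\<^bsub>spec_sections R U\<^esub> x = x"
        unfolding spec_sections_simps by (rule eqI[OF x]) (simp add: at[OF x] c(8))
      show "\<exists>y\<in>carrier (spec_sections R U). y \<oplus>\<^bsub>spec_sections R U\<^esub> x = \<zero>\<^bsub>spec_sections R U\<^esub>"
        by (rule bexI[OF _ spec_section_minus[OF U x]], unfold spec_sections_simps, rule restrict_ext)
          (simp add: at[OF x] c(9))
    qed (rule spec_sections_one_zero(2)[OF U])
    show "comm_monoid (spec_sections R U)"
    proof (rule comm_monoidI)
      fix x y z assume xyz: "x \<in> carrier (spec_sections R U)" "y \<in> carrier (spec_sections R U)"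
        "z \<in> carrier (spec_sections R U)"
      show "x \<otimes>\<^bsub>spec_sections R U\<^esub> y \<otimes>\<^bsub>spec_sections R U\<^esub> z =
        x \<otimes>\<^bsub>spec_sections R U\<^esub> (y \<otimes>\<^bsub>spec_sections R U\<^esub> z)"
        unfolding spec_sections_simps by (rule restrict_ext) (simp add: at xyz c(11))
    next
      fix x y assume xy: "x \<in> carrier (spec_sections R U)" "y \<in> carrier (spec_sections R U)"
      show "x \<otimes>\<^bsub>spec_sections R U\<^esub> y \<in> carrier (spec_sections R U)"
        by (rule spec_sections_closed(1)[OF U xy])
      show "x \<otimes>\<^bsub>spec_sections R U\<^esub> y = y \<otimes>\<^bsub>spec_sections R U\<^esub> x"
        unfolding spec_sections_simps by (rule restrict_ext) (rule c(14)[OF _ at[OF xy(1)] at[OF xy(2)]])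
    next
      fix x assume x: "x \<in> carrier (spec_sections R U)"
      show "\<one>\<^bsub>spec_sections R U\<^esub> \<otimes>\<^bsub>spec_sections R U\<^esub> x = x"
        unfolding spec_sections_simps by (rule eqI[OF x]) (simp add: at[OF x] c(12))
    qed (rule spec_sections_one_zero(1)[OF U])
    fix x y z assume xyz: "x \<in> carrier (spec_sections R U)" "y \<in> carrier (spec_sections R U)"
      "z \<in> carrier (spec_sections R U)"
    show "(x \<oplus>\<^bsub>spec_sections R U\<^esub> y) \<otimes>\<^bsub>spec_sections R U\<^esub> z =
      x \<otimes>\<^bsub>spec_sections R U\<^esub> z \<oplus>\<^bsub>spec_sections R U\<^esub> y \<otimes>\<^bsub>spec_sections R U\<^esub> z"
      unfolding spec_sections_simps by (rule restrict_ext) (simp add: at xyz c(13))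
  qed
qed

lemma locally_fraction_mono:
  assumes "locally_fraction U s P" "openin (zariski R) V" "P \<in> V" "V \<subseteq> U'"
    and "\<And>Q. Q \<in> V \<Longrightarrow> t Q = s Q"
  shows "locally_fraction U' t P"
proof -
  obtain W a b where 1: "openin (zariski R) W" "P \<in> W" "W \<subseteq> U" "a \<in> carrier R" "b \<in> carrier R"
    "\<forall>Q\<in>W. b \<notin> Q \<and> s Q = fraction R (carrier R - Q) a b"
    using assms(1) unfolding locally_fraction_def by blast
  show ?thesis
    by (rule locally_fractionI[of "W \<inter> V" _ _ a b]) (use 1 assms in auto)
qed

lemma Spec_simps: "pts (Spec R) = zariski R" "sections (Spec R) = spec_sections R"
  "res (Spec R) U V s = restrict s V"
  by (simp_all add: Spec_def)

lemma ringed_space_Spec: "ringed_space (Spec R)"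
proof (rule ringed_space.intro, unfold Spec_simps)
  fix U assume "openin (zariski R) U"
  then show "cring (spec_sections R U)" by (rule spec_sections_cring)
next
  fix U V assume U: "openin (zariski R) U" and V: "openin (zariski R) V" and VU: "V \<subseteq> U"
  have "restrict s V \<in> carrier (spec_sections R V)" if s: "s \<in> carrier (spec_sections R U)" for s
    unfolding spec_sections_carrier
  proof (intro conjI ballI)
    show "restrict s V \<in> (\<Pi>\<^sub>E P\<in>V. carrier (local_at R P))"
      using spec_sections_at[OF s subsetD[OF VU]] by simp
    fix P assume P: "P \<in> V"
    have "locally_fraction U s P" using s P VU unfolding spec_sections_carrier by blast
    then show "locally_fraction V (restrict s V) P"
      by (rule locally_fraction_mono[OF _ V P order_refl]) simp
  qed
  note closed = this
  have binop: "restrict (\<lambda>P\<in>U. F P (s P) (t P)) V = (\<lambda>P\<in>V. F P (restrict s V P) (restrict t V P))"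
    for s t :: "'a set \<Rightarrow> ('a \<times> 'a) set" and F
    unfolding restrict_restrict Int_absorb1[OF VU] by (rule restrict_ext) simp
  have const: "restrict (\<lambda>P\<in>U. F P) V = (\<lambda>P\<in>V. F P)" for F :: "'a set \<Rightarrow> ('a \<times> 'a) set"
    unfolding restrict_restrict Int_absorb1[OF VU] ..
  show "(\<lambda>s. restrict s V) \<in> ring_hom (spec_sections R U) (spec_sections R V)"
    by (rule ring_hom_memI, erule closed; unfold spec_sections_simps)
      (rule binop[of "\<lambda>P. monoid.mult (local_at R P)"]
        binop[of "\<lambda>P. add (local_at R P)"] const)+
next
  fix U s assume "s \<in> carrier (spec_sections R U)"
  then show "restrict s U = s" by (rule spec_sections_restrict)
next
  fix W V :: "'a set set" and s :: "'a set \<Rightarrow> ('a \<times> 'a) set"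
  assume "W \<subseteq> V"
  then show "restrict (restrict s V) W = restrict s W" by (simp add: Int_absorb1)
next
  fix \<V> s t assume s: "s \<in> carrier (spec_sections R (\<Union>\<V>))" "t \<in> carrier (spec_sections R (\<Union>\<V>))"
    and eq: "\<forall>V\<in>\<V>. restrict s V = restrict t V"
  show "s = t"
  proof (rule PiE_ext)
    show "s \<in> (\<Pi>\<^sub>E P\<in>\<Union>\<V>. carrier (local_at R P))" "t \<in> (\<Pi>\<^sub>E P\<in>\<Union>\<V>. carrier (local_at R P))"
      using s by (auto simp: spec_sections_carrier)
    fix P assume "P \<in> \<Union>\<V>"
    then show "s P = t P" using eq by (metis UnionE restrict_apply')
  qed
next
  fix \<V> \<sigma> assume op: "\<forall>V\<in>\<V>. openin (zariski R) V" and \<sigma>: "\<forall>V\<in>\<V>. \<sigma> V \<in> carrier (spec_sections R V)"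
    and eq: "\<forall>V\<in>\<V>. \<forall>W\<in>\<V>. restrict (\<sigma> V) (V \<inter> W) = restrict (\<sigma> W) (V \<inter> W)"
  define s where "s = (\<lambda>P\<in>\<Union>\<V>. \<sigma> (SOME V. V \<in> \<V> \<and> P \<in> V) P)"
  have sV: "s P = \<sigma> V P" if V: "V \<in> \<V>" "P \<in> V" for P V
  proof -
    define W where "W = (SOME V. V \<in> \<V> \<and> P \<in> V)"
    have W: "W \<in> \<V> \<and> P \<in> W" unfolding W_def by (rule someI[of _ V]) (use V in auto)
    have "restrict (\<sigma> V) (V \<inter> W) P = restrict (\<sigma> W) (V \<inter> W) P" using eq V W by metis
    then show ?thesis using V W by (auto simp: s_def W_def[symmetric])
  qed
  have "s \<in> carrier (spec_sections R (\<Union>\<V>))"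
    unfolding spec_sections_carrier
  proof (intro conjI ballI)
    show "s \<in> (\<Pi>\<^sub>E P\<in>\<Union>\<V>. carrier (local_at R P))"
    proof (rule PiE_I)
      fix P assume "P \<in> \<Union>\<V>"
      then show "s P \<in> carrier (local_at R P)" using sV \<sigma> spec_sections_at by (metis UnionE)
    qed (simp add: s_def)
    fix P assume "P \<in> \<Union>\<V>"
    then obtain V where V: "V \<in> \<V>" "P \<in> V" by auto
    have "locally_fraction V (\<sigma> V) P" using \<sigma> V unfolding spec_sections_carrier by blast
    then show "locally_fraction (\<Union>\<V>) s P"
      by (rule locally_fraction_mono[OF _ _ V(2)]) (use op V sV in auto)
  qed
  moreover have "restrict s V = \<sigma> V" if V: "V \<in> \<V>" for V
  proof -
    have "restrict s V = restrict (\<sigma> V) V" using sV[OF V] by (intro restrict_ext) auto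
    then show ?thesis using spec_sections_restrict \<sigma> V by metis
  qed
  ultimately show "\<exists>s\<in>carrier (spec_sections R (\<Union>\<V>)). \<forall>V\<in>\<V>. restrict s V = \<sigma> V" by blast
qed

end

section \<open>Stalks\<close>

context ringed_space begin

lemma res_closed:
  "\<lbrakk>openin (pts X) U; openin (pts X) V; V \<subseteq> U; s \<in> carrier (sections X U)\<rbrakk>
    \<Longrightarrow> res X U V s \<in> carrier (sections X V)"
  using res_hom ring_hom_closed by fast

lemma res_mult:
  "\<lbrakk>openin (pts X) U; openin (pts X) V; V \<subseteq> U; s \<in> carrier (sections X U); t \<in> carrier (sections X U)\<rbrakk>
    \<Longrightarrow> res X U V (s \<otimes>\<^bsub>sections X U\<^esub> t) = res X U V s \<otimes>\<^bsub>sections X V\<^esub> res X U V t"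
  by (rule ring_hom_mult[OF res_hom])

lemma res_add:
  "\<lbrakk>openin (pts X) U; openin (pts X) V; V \<subseteq> U; s \<in> carrier (sections X U); t \<in> carrier (sections X U)\<rbrakk>
    \<Longrightarrow> res X U V (s \<oplus>\<^bsub>sections X U\<^esub> t) = res X U V s \<oplus>\<^bsub>sections X V\<^esub> res X U V t"
  by (rule ring_hom_add[OF res_hom])

lemma res_one:
  "\<lbrakk>openin (pts X) U; openin (pts X) V; V \<subseteq> U\<rbrakk> \<Longrightarrow> res X U V \<one>\<^bsub>sections X U\<^esub> = \<one>\<^bsub>sections X V\<^esub>"
  by (rule ring_hom_one[OF res_hom])

lemma res_zero:
  "\<lbrakk>openin (pts X) U; openin (pts X) V; V \<subseteq> U\<rbrakk> \<Longrightarrow> res X U V \<zero>\<^bsub>sections X U\<^esub> = \<zero>\<^bsub>sections X V\<^esub>"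
  using ring_hom_zero[OF res_hom] sections_cring by (simp add: cring_def)

lemma res_pow:
  "\<lbrakk>openin (pts X) U; openin (pts X) V; V \<subseteq> U; s \<in> carrier (sections X U)\<rbrakk>
    \<Longrightarrow> res X U V (s [^]\<^bsub>sections X U\<^esub> (n::nat)) = res X U V s [^]\<^bsub>sections X V\<^esub> n"
  by (rule ring_hom_nat_pow[OF sections_cring sections_cring res_hom])

lemma res_Units:
  "\<lbrakk>openin (pts X) U; openin (pts X) V; V \<subseteq> U; s \<in> Units (sections X U)\<rbrakk>
    \<Longrightarrow> res X U V s \<in> Units (sections X V)"
  by (rule ring_hom_Units[OF sections_cring sections_cring res_hom])

text \<open>
  Equality of the germs at \<open>p\<close>, for sections over possibly different neighbourhoods of \<open>p\<close>.
\<close>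

definition agree where
  "agree p U s V t \<longleftrightarrow> (\<exists>W. openin (pts X) W \<and> p \<in> W \<and> W \<subseteq> U \<inter> V \<and> res X U W s = res X V W t)"

lemma agreeI:
  "\<lbrakk>openin (pts X) W; p \<in> W; W \<subseteq> U; W \<subseteq> V; res X U W s = res X V W t\<rbrakk> \<Longrightarrow> agree p U s V t"
  unfolding agree_def by blast

lemma agreeE:
  assumes "agree p U s V t"
  obtains W where "openin (pts X) W" "p \<in> W" "W \<subseteq> U" "W \<subseteq> V" "res X U W s = res X V W t"
  using assms unfolding agree_def by blast

lemma agree_refl: "openin (pts X) U \<Longrightarrow> p \<in> U \<Longrightarrow> agree p U s U s"
  by (rule agreeI) auto

lemma agree_sym: "agree p U s V t \<Longrightarrow> agree p V t U s"
  by (metis agreeE agreeI)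

text \<open>
  Sections that coincide on \<open>W\<close> coincide on every smaller open set. This is used to bring several
  agreements to one common neighbourhood.
\<close>

lemma agree_restrict:
  assumes "openin (pts X) U" "openin (pts X) V" "s \<in> carrier (sections X U)" "t \<in> carrier (sections X V)"
    and "openin (pts X) W" "W \<subseteq> U" "W \<subseteq> V" "res X U W s = res X V W t" "openin (pts X) W'" "W' \<subseteq> W"
  shows "res X U W' s = res X V W' t"
  using res_comp[of U W W' s] res_comp[of V W W' t] assms by simp

lemma agree_trans:
  assumes st: "agree p U s V t" and tr: "agree p V t T r"
    and o: "openin (pts X) U" "openin (pts X) V" "openin (pts X) T"
    and c: "s \<in> carrier (sections X U)" "t \<in> carrier (sections X V)" "r \<in> carrier (sections X T)"
  shows "agree p U s T r"
proof -
  obtain W where W: "openin (pts X) W" "p \<in> W" "W \<subseteq> U" "W \<subseteq> V" "res X U W s = res X V W t"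
    using st by (rule agreeE)
  obtain W' where W': "openin (pts X) W'" "p \<in> W'" "W' \<subseteq> V" "W' \<subseteq> T" "res X V W' t = res X T W' r"
    using tr by (rule agreeE)
  have i: "openin (pts X) (W \<inter> W')" using W W' by blast
  have "res X U (W \<inter> W') s = res X T (W \<inter> W') r"
    using agree_restrict[OF o(1,2) c(1,2) W(1,3,4,5) i] agree_restrict[OF o(2,3) c(2,3) W'(1,3,4,5) i]
    by simp
  then show ?thesis using W W' i by (intro agreeI[of "W \<inter> W'"]) auto
qed

lemma agree_res:
  assumes "openin (pts X) U" "openin (pts X) V" "V \<subseteq> U" "p \<in> V" "s \<in> carrier (sections X U)"
  shows "agree p V (res X U V s) U s"
  by (rule agreeI[of V]) (use assms res_id res_closed in auto)

lemma germ_agree: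
  "germ X p U s = {(V, t). openin (pts X) V \<and> p \<in> V \<and> t \<in> carrier (sections X V) \<and> agree p U s V t}"
  by (simp add: germ_def agree_def)

lemma germ_eqI:
  assumes "agree p U s V t" "openin (pts X) U" "openin (pts X) V"
    "s \<in> carrier (sections X U)" "t \<in> carrier (sections X V)"
  shows "germ X p U s = germ X p V t"
proof -
  have "agree p U s T r \<longleftrightarrow> agree p V t T r" if "openin (pts X) T" "r \<in> carrier (sections X T)" for T r
    using agree_trans[OF assms(1) _ assms(2,3) that(1) assms(4,5) that(2)]
      agree_trans[OF agree_sym[OF assms(1)] _ assms(3,2) that(1) assms(5,4) that(2)] by blast
  then show ?thesis unfolding germ_agree by blast
qed

lemma germ_self:
  "\<lbrakk>openin (pts X) U; p \<in> U; s \<in> carrier (sections X U)\<rbrakk> \<Longrightarrow> (U, s) \<in> germ X p U s"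
  by (simp add: germ_agree agree_refl)

lemma germ_eqD:
  assumes "germ X p U s = germ X p V t" "openin (pts X) V" "p \<in> V" "t \<in> carrier (sections X V)"
  shows "agree p U s V t"
proof -
  have "(V, t) \<in> germ X p U s" using germ_self[OF assms(2-4)] assms(1) by simp
  then show ?thesis by (simp add: germ_agree)
qed

lemma germ_res:
  assumes "openin (pts X) U" "openin (pts X) V" "V \<subseteq> U" "p \<in> V" "s \<in> carrier (sections X U)"
  shows "germ X p V (res X U V s) = germ X p U s"
  by (rule germ_eqI[OF agree_res[OF assms]]) (use assms res_closed in auto)

text \<open>
  The union over representatives in the definition of the stalk operations, for sum and product
  at once: an operation that commutes with restriction depends only on germs.
\<close>

lemma germ_binop:
  assumes U: "openin (pts X) U" "p \<in> U" and s: "s \<in> carrier (sections X U)" and t: "t \<in> carrier (sections X U)"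
    and F: "\<And>U s t. openin (pts X) U \<Longrightarrow> s \<in> carrier (sections X U) \<Longrightarrow> t \<in> carrier (sections X U)
      \<Longrightarrow> F U s t \<in> carrier (sections X U)"
    and Fres: "\<And>U V s t. openin (pts X) U \<Longrightarrow> openin (pts X) V \<Longrightarrow> V \<subseteq> U \<Longrightarrow>
      s \<in> carrier (sections X U) \<Longrightarrow> t \<in> carrier (sections X U)
      \<Longrightarrow> res X U V (F U s t) = F V (res X U V s) (res X U V t)"
  shows "(\<Union>(U', s')\<in>germ X p U s. \<Union>(V', t')\<in>germ X p U t.
    germ X p (U' \<inter> V') (F (U' \<inter> V') (res X U' (U' \<inter> V') s') (res X V' (U' \<inter> V') t'))) = germ X p U (F U s t)"
proof (rule UN_UN_constant)
  show "germ X p U s \<noteq> {}" "germ X p U t \<noteq> {}" using germ_self[OF U s] germ_self[OF U t] by blast+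
  fix U' s' V' t' assume "(U', s') \<in> germ X p U s" "(V', t') \<in> germ X p U t"
  then have h: "openin (pts X) U'" "p \<in> U'" "s' \<in> carrier (sections X U')" "agree p U s U' s'"
    "openin (pts X) V'" "p \<in> V'" "t' \<in> carrier (sections X V')" "agree p U t V' t'"
    by (auto simp: germ_agree)
  obtain W1 where W1: "openin (pts X) W1" "p \<in> W1" "W1 \<subseteq> U" "W1 \<subseteq> U'" "res X U W1 s = res X U' W1 s'"
    using h(4) by (rule agreeE)
  obtain W2 where W2: "openin (pts X) W2" "p \<in> W2" "W2 \<subseteq> U" "W2 \<subseteq> V'" "res X U W2 t = res X V' W2 t'"
    using h(8) by (rule agreeE)
  define W where "W = W1 \<inter> W2"
  have W: "openin (pts X) W" "p \<in> W" "W \<subseteq> U" "W \<subseteq> U' \<inter> V'" using W1 W2 by (auto simp: W_def)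
  have i: "openin (pts X) (U' \<inter> V')" using h by blast
  have eq: "res X U' W s' = res X U W s" "res X V' W t' = res X U W t"
    using agree_restrict[OF U(1) h(1) s h(3) W1(1,3,4,5) W(1)]
      agree_restrict[OF U(1) h(5) t h(7) W2(1,3,4,5) W(1)] by (auto simp: W_def)
  let ?s = "res X U' (U' \<inter> V') s'" and ?t = "res X V' (U' \<inter> V') t'"
  have st: "?s \<in> carrier (sections X (U' \<inter> V'))" "?t \<in> carrier (sections X (U' \<inter> V'))"
    using h i by (auto intro: res_closed)
  have "res X (U' \<inter> V') W (F (U' \<inter> V') ?s ?t)
    = F W (res X (U' \<inter> V') W ?s) (res X (U' \<inter> V') W ?t)"
    using Fres[OF i W(1) W(4) st] .
  also have "\<dots> = F W (res X U' W s') (res X V' W t')"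
    using res_comp[OF h(1) i W(1) W(4) _ h(3)] res_comp[OF h(5) i W(1) W(4) _ h(7)] by simp
  also have "\<dots> = res X U W (F U s t)"
    unfolding eq using Fres[OF U(1) W(1) W(3) s t] by simp
  finally have "agree p (U' \<inter> V') (F (U' \<inter> V') ?s ?t) U (F U s t)"
    by (intro agreeI[OF W(1,2,4,3)])
  then show "germ X p (U' \<inter> V') (F (U' \<inter> V') ?s ?t) = germ X p U (F U s t)"
    by (rule germ_eqI[OF _ i U(1) F[OF i st] F[OF U(1) s t]])
qed

lemma stalk_mult:
  assumes "openin (pts X) U" "p \<in> U" "s \<in> carrier (sections X U)" "t \<in> carrier (sections X U)"
  shows "germ X p U s \<otimes>\<^bsub>stalk X p\<^esub> germ X p U t = germ X p U (s \<otimes>\<^bsub>sections X U\<^esub> t)"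
  unfolding stalk_def monoid.simps
  by (rule germ_binop[OF assms, of "\<lambda>U. monoid.mult (sections X U)"])
    (simp_all add: res_mult cring.cring_simprules(5)[OF sections_cring])

lemma stalk_add:
  assumes "openin (pts X) U" "p \<in> U" "s \<in> carrier (sections X U)" "t \<in> carrier (sections X U)"
  shows "germ X p U s \<oplus>\<^bsub>stalk X p\<^esub> germ X p U t = germ X p U (s \<oplus>\<^bsub>sections X U\<^esub> t)"
  unfolding stalk_def ring.simps
  by (rule germ_binop[OF assms, of "\<lambda>U. add (sections X U)"])
    (simp_all add: res_add cring.cring_simprules(1)[OF sections_cring])

lemma stalk_one:
  assumes "openin (pts X) U" "p \<in> U"
  shows "\<one>\<^bsub>stalk X p\<^esub> = germ X p U \<one>\<^bsub>sections X U\<^esub>"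
proof -
  have U: "U \<subseteq> topspace (pts X)" using assms(1) by (rule openin_subset)
  have glob: "\<one>\<^bsub>sections X (topspace (pts X))\<^esub> \<in> carrier (sections X (topspace (pts X)))"
    using cring.cring_simprules(6)[OF sections_cring[OF openin_topspace]] .
  have "germ X p U \<one>\<^bsub>sections X U\<^esub> = germ X p (topspace (pts X)) \<one>\<^bsub>sections X (topspace (pts X))\<^esub>"
    using germ_res[OF openin_topspace assms(1) U assms(2) glob] res_one[OF openin_topspace assms(1) U] by simp
  then show ?thesis by (simp add: stalk_def)
qed

lemma stalk_zero:
  assumes "openin (pts X) U" "p \<in> U"
  shows "\<zero>\<^bsub>stalk X p\<^esub> = germ X p U \<zero>\<^bsub>sections X U\<^esub>"
proof -
  have U: "U \<subseteq> topspace (pts X)" using assms(1) by (rule openin_subset)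
  have glob: "\<zero>\<^bsub>sections X (topspace (pts X))\<^esub> \<in> carrier (sections X (topspace (pts X)))"
    using cring.cring_simprules(2)[OF sections_cring[OF openin_topspace]] .
  have "germ X p U \<zero>\<^bsub>sections X U\<^esub> = germ X p (topspace (pts X)) \<zero>\<^bsub>sections X (topspace (pts X))\<^esub>"
    using germ_res[OF openin_topspace assms(1) U assms(2) glob] res_zero[OF openin_topspace assms(1) U] by simp
  then show ?thesis by (simp add: stalk_def)
qed

lemma germ_in_stalk:
  "\<lbrakk>openin (pts X) U; p \<in> U; s \<in> carrier (sections X U)\<rbrakk> \<Longrightarrow> germ X p U s \<in> carrier (stalk X p)"
  unfolding stalk_def by auto

lemma stalkE:
  assumes "x \<in> carrier (stalk X p)"
  obtains U s where "openin (pts X) U" "p \<in> U" "s \<in> carrier (sections X U)" "x = germ X p U s"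
  using assms unfolding stalk_def by auto

text \<open>
  As for localizations, the axioms are verified after moving three germs to one common
  neighbourhood.
\<close>

lemma stalk_common:
  assumes "x \<in> carrier (stalk X p)" "y \<in> carrier (stalk X p)" "z \<in> carrier (stalk X p)"
  obtains U s t r where "openin (pts X) U" "p \<in> U" "s \<in> carrier (sections X U)"
    "t \<in> carrier (sections X U)" "r \<in> carrier (sections X U)"
    "x = germ X p U s" "y = germ X p U t" "z = germ X p U r"
proof -
  obtain U s where s: "openin (pts X) U" "p \<in> U" "s \<in> carrier (sections X U)" "x = germ X p U s"
    using assms(1) by (rule stalkE)
  obtain V t where t: "openin (pts X) V" "p \<in> V" "t \<in> carrier (sections X V)" "y = germ X p V t"
    using assms(2) by (rule stalkE)
  obtain W r where r: "openin (pts X) W" "p \<in> W" "r \<in> carrier (sections X W)" "z = germ X p W r"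
    using assms(3) by (rule stalkE)
  let ?T = "U \<inter> V \<inter> W"
  have T: "openin (pts X) ?T" "p \<in> ?T" "?T \<subseteq> U" "?T \<subseteq> V" "?T \<subseteq> W" using s t r by auto
  show ?thesis
    by (rule that[OF T(1,2), of "res X U ?T s" "res X V ?T t" "res X W ?T r"])
      (use s t r T in \<open>simp_all add: res_closed germ_res\<close>)
qed

lemma stalk_cring: "p \<in> topspace (pts X) \<Longrightarrow> cring (stalk X p)"
proof -
  assume p: "p \<in> topspace (pts X)"
  note c = cring.cring_simprules[OF sections_cring]
  show ?thesis
  proof (rule cringI)
    show "abelian_group (stalk X p)"
    proof (rule abelian_groupI)
      show "\<zero>\<^bsub>stalk X p\<^esub> \<in> carrier (stalk X p)"
        unfolding stalk_zero[OF openin_topspace p] using p c by (intro germ_in_stalk) auto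
      fix x y z assume xyz: "x \<in> carrier (stalk X p)" "y \<in> carrier (stalk X p)" "z \<in> carrier (stalk X p)"
      obtain U s t r where "openin (pts X) U" "p \<in> U" "s \<in> carrier (sections X U)"
        "t \<in> carrier (sections X U)" "r \<in> carrier (sections X U)"
        "x = germ X p U s" "y = germ X p U t" "z = germ X p U r"
        using stalk_common[OF xyz] .
      then show "x \<oplus>\<^bsub>stalk X p\<^esub> y \<oplus>\<^bsub>stalk X p\<^esub> z = x \<oplus>\<^bsub>stalk X p\<^esub> (y \<oplus>\<^bsub>stalk X p\<^esub> z)"
        by (simp add: stalk_add c)
    next
      fix x y assume xy: "x \<in> carrier (stalk X p)" "y \<in> carrier (stalk X p)"
      obtain U s t r where "openin (pts X) U" "p \<in> U" "s \<in> carrier (sections X U)"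
        "t \<in> carrier (sections X U)" "r \<in> carrier (sections X U)"
        "x = germ X p U s" "y = germ X p U t" "y = germ X p U r"
        using stalk_common[OF xy xy(2)] .
      then show "x \<oplus>\<^bsub>stalk X p\<^esub> y = y \<oplus>\<^bsub>stalk X p\<^esub> x" "x \<oplus>\<^bsub>stalk X p\<^esub> y \<in> carrier (stalk X p)"
        by (simp_all add: stalk_add c germ_in_stalk)
    next
      fix x assume "x \<in> carrier (stalk X p)"
      then obtain U s where h: "openin (pts X) U" "p \<in> U" "s \<in> carrier (sections X U)" "x = germ X p U s"
        by (rule stalkE)
      then show "\<zero>\<^bsub>stalk X p\<^esub> \<oplus>\<^bsub>stalk X p\<^esub> x = x"
        by (simp add: stalk_zero[OF h(1,2)] stalk_add c)
      have "germ X p U (\<ominus>\<^bsub>sections X U\<^esub> s) \<oplus>\<^bsub>stalk X p\<^esub> x = \<zero>\<^bsub>stalk X p\<^esub>"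
        using h by (simp add: stalk_zero[OF h(1,2)] stalk_add c)
      moreover have "germ X p U (\<ominus>\<^bsub>sections X U\<^esub> s) \<in> carrier (stalk X p)"
        using h by (simp add: germ_in_stalk c)
      ultimately show "\<exists>y\<in>carrier (stalk X p). y \<oplus>\<^bsub>stalk X p\<^esub> x = \<zero>\<^bsub>stalk X p\<^esub>" by blast
    qed
    show "comm_monoid (stalk X p)"
    proof (rule comm_monoidI)
      show "\<one>\<^bsub>stalk X p\<^esub> \<in> carrier (stalk X p)"
        unfolding stalk_one[OF openin_topspace p] using p c by (intro germ_in_stalk) auto
      fix x y z assume xyz: "x \<in> carrier (stalk X p)" "y \<in> carrier (stalk X p)" "z \<in> carrier (stalk X p)"
      obtain U s t r where "openin (pts X) U" "p \<in> U" "s \<in> carrier (sections X U)"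
        "t \<in> carrier (sections X U)" "r \<in> carrier (sections X U)"
        "x = germ X p U s" "y = germ X p U t" "z = germ X p U r"
        using stalk_common[OF xyz] .
      then show "x \<otimes>\<^bsub>stalk X p\<^esub> y \<otimes>\<^bsub>stalk X p\<^esub> z = x \<otimes>\<^bsub>stalk X p\<^esub> (y \<otimes>\<^bsub>stalk X p\<^esub> z)"
        by (simp add: stalk_mult c)
    next
      fix x y assume xy: "x \<in> carrier (stalk X p)" "y \<in> carrier (stalk X p)"
      obtain U s t r where h: "openin (pts X) U" "p \<in> U" "s \<in> carrier (sections X U)"
        "t \<in> carrier (sections X U)" "r \<in> carrier (sections X U)"
        "x = germ X p U s" "y = germ X p U t" "y = germ X p U r"
        using stalk_common[OF xy xy(2)] .
      then show "x \<otimes>\<^bsub>stalk X p\<^esub> y \<in> carrier (stalk X p)"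
        by (simp add: stalk_mult c germ_in_stalk)
      have "s \<otimes>\<^bsub>sections X U\<^esub> t = t \<otimes>\<^bsub>sections X U\<^esub> s" using h c by simp
      then show "x \<otimes>\<^bsub>stalk X p\<^esub> y = y \<otimes>\<^bsub>stalk X p\<^esub> x"
        unfolding h(6,7) using h by (simp add: stalk_mult)
    next
      fix x assume "x \<in> carrier (stalk X p)"
      then obtain U s where h: "openin (pts X) U" "p \<in> U" "s \<in> carrier (sections X U)" "x = germ X p U s"
        by (rule stalkE)
      have "\<one>\<^bsub>sections X U\<^esub> \<otimes>\<^bsub>sections X U\<^esub> s = s" "\<one>\<^bsub>sections X U\<^esub> \<in> carrier (sections X U)"
        using cring.cring_simprules(12)[OF sections_cring[OF h(1)] h(3)] c(6)[OF h(1)] by auto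
      then show "\<one>\<^bsub>stalk X p\<^esub> \<otimes>\<^bsub>stalk X p\<^esub> x = x"
        using h by (simp add: stalk_one[OF h(1,2)] stalk_mult)
    qed
    fix x y z assume xyz: "x \<in> carrier (stalk X p)" "y \<in> carrier (stalk X p)" "z \<in> carrier (stalk X p)"
    obtain U s t r where "openin (pts X) U" "p \<in> U" "s \<in> carrier (sections X U)"
      "t \<in> carrier (sections X U)" "r \<in> carrier (sections X U)"
      "x = germ X p U s" "y = germ X p U t" "z = germ X p U r"
      using stalk_common[OF xyz] .
    then show "(x \<oplus>\<^bsub>stalk X p\<^esub> y) \<otimes>\<^bsub>stalk X p\<^esub> z = x \<otimes>\<^bsub>stalk X p\<^esub> z \<oplus>\<^bsub>stalk X p\<^esub> y \<otimes>\<^bsub>stalk X p\<^esub> z"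
      by (simp add: stalk_mult stalk_add c)
  qed
qed

lemma germ_hom:
  assumes "openin (pts X) U" "p \<in> U"
  shows "germ X p U \<in> ring_hom (sections X U) (stalk X p)"
  by (rule ring_hom_memI) (use assms in \<open>simp_all add: germ_in_stalk stalk_mult stalk_add stalk_one\<close>)

end

section \<open>Ringed spaces whose local sections are units or nilpotent\<close>

text \<open>
  The defining condition refers only to sections, so it can be glued and transported along
  isomorphisms of sheaves before anything is known about stalks. It forces the stalks to be local
  rings with nil maximal ideal.
\<close>

locale nil_ringed_space = ringed_space +
  assumes unit_or_nilpotent: "\<lbrakk>openin (pts X) U; p \<in> U; s \<in> carrier (sections X U)\<rbrakk> \<Longrightarrow>
      \<exists>W. openin (pts X) W \<and> p \<in> W \<and> W \<subseteq> U \<and>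
        (res X U W s \<in> Units (sections X W) \<or>
         (\<exists>n::nat. res X U W s [^]\<^bsub>sections X W\<^esub> n = \<zero>\<^bsub>sections X W\<^esub>))"
    and nontrivial: "\<lbrakk>openin (pts X) W; W \<noteq> {}\<rbrakk> \<Longrightarrow> \<one>\<^bsub>sections X W\<^esub> \<noteq> \<zero>\<^bsub>sections X W\<^esub>"
begin

lemma stalk_nil_local:
  assumes p: "p \<in> topspace (pts X)"
  shows "nil_local_ring (stalk X p)"
  unfolding nil_local_ring_def
proof (intro conjI ballI)
  show cr: "cring (stalk X p)" by (rule stalk_cring[OF p])
  show "\<one>\<^bsub>stalk X p\<^esub> \<noteq> \<zero>\<^bsub>stalk X p\<^esub>"
  proof
    let ?T = "topspace (pts X)"
    assume "\<one>\<^bsub>stalk X p\<^esub> = \<zero>\<^bsub>stalk X p\<^esub>"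
    then have "germ X p ?T \<one>\<^bsub>sections X ?T\<^esub> = germ X p ?T \<zero>\<^bsub>sections X ?T\<^esub>"
      using stalk_one[OF openin_topspace p] stalk_zero[OF openin_topspace p] by simp
    then have "agree p ?T \<one>\<^bsub>sections X ?T\<^esub> ?T \<zero>\<^bsub>sections X ?T\<^esub>"
      by (rule germ_eqD) (use p cring.cring_simprules(2)[OF sections_cring[OF openin_topspace]] in auto)
    then obtain W where "openin (pts X) W" "p \<in> W" "W \<subseteq> ?T"
      "res X ?T W \<one>\<^bsub>sections X ?T\<^esub> = res X ?T W \<zero>\<^bsub>sections X ?T\<^esub>" by (rule agreeE)
    then show False using nontrivial[of W] res_one[of ?T W] res_zero[of ?T W] by auto
  qed
  fix x assume "x \<in> carrier (stalk X p)"
  then obtain U s where h: "openin (pts X) U" "p \<in> U" "s \<in> carrier (sections X U)" "x = germ X p U s"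
    by (rule stalkE)
  obtain W where W: "openin (pts X) W" "p \<in> W" "W \<subseteq> U"
    and d: "res X U W s \<in> Units (sections X W) \<or>
         (\<exists>n::nat. res X U W s [^]\<^bsub>sections X W\<^esub> n = \<zero>\<^bsub>sections X W\<^esub>)"
    using unit_or_nilpotent[OF h(1-3)] by blast
  have x: "x = germ X p W (res X U W s)" using germ_res h W by simp
  have c: "res X U W s \<in> carrier (sections X W)" using res_closed h W by simp
  note hom = germ_hom[OF W(1,2)]
  from d show "x \<in> Units (stalk X p) \<or> (\<exists>n::nat. x [^]\<^bsub>stalk X p\<^esub> n = \<zero>\<^bsub>stalk X p\<^esub>)"
  proof
    assume "res X U W s \<in> Units (sections X W)"
    then show ?thesis unfolding x using ring_hom_Units[OF sections_cring[OF W(1)] cr hom] by blast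
  next
    assume "\<exists>n::nat. res X U W s [^]\<^bsub>sections X W\<^esub> n = \<zero>\<^bsub>sections X W\<^esub>"
    then obtain n where n: "res X U W s [^]\<^bsub>sections X W\<^esub> (n::nat) = \<zero>\<^bsub>sections X W\<^esub>" by blast
    have "x [^]\<^bsub>stalk X p\<^esub> n = \<zero>\<^bsub>stalk X p\<^esub>"
      unfolding x ring_hom_nat_pow[OF sections_cring[OF W(1)] cr hom c, symmetric] n
      using stalk_zero[OF W(1,2)] by simp
    then show ?thesis by blast
  qed
qed

sublocale locally_ringed_space
  by unfold_locales (rule nil_local_ring_local[OF stalk_nil_local])

text \<open>
  A germ that is a unit spreads out: on a small neighbourhood the section is a unit or nilpotent,
  and a unit of a nonzero ring is not nilpotent.
\<close>

lemma germ_unit_iff: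
  assumes U: "openin (pts X) U" "p \<in> U" and s: "s \<in> carrier (sections X U)"
  shows "germ X p U s \<in> Units (stalk X p) \<longleftrightarrow>
    (\<exists>W. openin (pts X) W \<and> p \<in> W \<and> W \<subseteq> U \<and> res X U W s \<in> Units (sections X W))"
proof
  have p: "p \<in> topspace (pts X)" using U openin_subset by blast
  have cr: "cring (stalk X p)" by (rule stalk_cring[OF p])
  {
    assume u: "germ X p U s \<in> Units (stalk X p)"
    obtain W where W: "openin (pts X) W" "p \<in> W" "W \<subseteq> U"
      and d: "res X U W s \<in> Units (sections X W) \<or>
           (\<exists>n::nat. res X U W s [^]\<^bsub>sections X W\<^esub> n = \<zero>\<^bsub>sections X W\<^esub>)"
      using unit_or_nilpotent[OF U s] by blast
    have x: "germ X p U s = germ X p W (res X U W s)" using germ_res U s W by simp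
    have c: "res X U W s \<in> carrier (sections X W)" using res_closed U s W by simp
    have False if n: "res X U W s [^]\<^bsub>sections X W\<^esub> n = \<zero>\<^bsub>sections X W\<^esub>" for n :: nat
    proof -
      have "germ X p U s [^]\<^bsub>stalk X p\<^esub> n = \<zero>\<^bsub>stalk X p\<^esub>"
        unfolding x ring_hom_nat_pow[OF sections_cring[OF W(1)] cr germ_hom[OF W(1,2)] c, symmetric] n
        using stalk_zero[OF W(1,2)] by simp
      then show False
        using cring.unit_not_nilpotent[OF cr u] stalk_nil_local[OF p] by (auto simp: nil_local_ring_def)
    qed
    then show "\<exists>W. openin (pts X) W \<and> p \<in> W \<and> W \<subseteq> U \<and> res X U W s \<in> Units (sections X W)"
      using W d by blast
  next
    assume "\<exists>W. openin (pts X) W \<and> p \<in> W \<and> W \<subseteq> U \<and> res X U W s \<in> Units (sections X W)"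
    then obtain W where W: "openin (pts X) W" "p \<in> W" "W \<subseteq> U" "res X U W s \<in> Units (sections X W)" by blast
    then show "germ X p U s \<in> Units (stalk X p)"
      using ring_hom_Units[OF sections_cring[OF W(1)] cr germ_hom[OF W(1,2)] W(4)] germ_res U s by simp
  }
qed

end

text \<open>
  Locality of the stalk maps costs nothing here; what has to be verified is that the stalk map is
  a well defined ring homomorphism.
\<close>

lemma lrs_morphism_nil:
  fixes X :: "('p, 'a) rspace" and Y :: "('q, 'b) rspace"
  assumes X: "nil_ringed_space X" and Y: "nil_ringed_space Y"
    and cont: "continuous_map (pts X) (pts Y) f"
    and hom: "\<And>V. openin (pts Y) V \<Longrightarrow> \<phi> V \<in> ring_hom (sections Y V) (sections X (preim X f V))"
    and nat: "\<And>V W t. \<lbrakk>openin (pts Y) V; openin (pts Y) W; W \<subseteq> V; t \<in> carrier (sections Y V)\<rbrakk>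
      \<Longrightarrow> \<phi> W (res Y V W t) = res X (preim X f V) (preim X f W) (\<phi> V t)"
  shows "lrs_morphism X Y f \<phi>"
proof (rule lrs_morphism.intro[OF cont hom nat])
  interpret X: nil_ringed_space X by fact
  interpret Y: nil_ringed_space Y by fact
  fix p assume p: "p \<in> topspace (pts X)"
  have fp: "f p \<in> topspace (pts Y)" using cont p by (auto simp: continuous_map_def)
  have preim: "openin (pts X) (preim X f V)" if "openin (pts Y) V" for V
    using cont that by (simp add: continuous_map_def)
  have map: "stalk_map X f \<phi> p (germ Y (f p) V t) = germ X p (preim X f V) (\<phi> V t)"
    if V: "openin (pts Y) V" "f p \<in> V" and t: "t \<in> carrier (sections Y V)" for V t
  proof -
    have "germ X p (preim X f V') (\<phi> V' t') = germ X p (preim X f V) (\<phi> V t)"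
      if "(V', t') \<in> germ Y (f p) V t" for V' t'
    proof -
      have V': "openin (pts Y) V'" "f p \<in> V'" "t' \<in> carrier (sections Y V')" "Y.agree (f p) V t V' t'"
        using that by (auto simp: Y.germ_agree)
      obtain W where W: "openin (pts Y) W" "f p \<in> W" "W \<subseteq> V" "W \<subseteq> V'" "res Y V W t = res Y V' W t'"
        using V'(4) by (rule Y.agreeE)
      have "X.agree p (preim X f V') (\<phi> V' t') (preim X f V) (\<phi> V t)"
      proof (rule X.agreeI[of "preim X f W"])
        show "res X (preim X f V') (preim X f W) (\<phi> V' t') = res X (preim X f V) (preim X f W) (\<phi> V t)"
          using nat[OF V(1) W(1,3) t] nat[OF V'(1) W(1,4) V'(3)] W(5) by simp
      qed (use W p preim in auto)
      then show ?thesis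
        by (rule X.germ_eqI) (use preim V V' t ring_hom_closed[OF hom] in auto)
    qed
    then show ?thesis using Y.germ_self[OF V t] unfolding stalk_map_def by fast
  qed
  have "stalk_map X f \<phi> p \<in> ring_hom (stalk Y (f p)) (stalk X p)"
  proof (rule ring_hom_memI)
    fix x y assume xy: "x \<in> carrier (stalk Y (f p))" "y \<in> carrier (stalk Y (f p))"
    obtain U s t r where h: "openin (pts Y) U" "f p \<in> U" "s \<in> carrier (sections Y U)"
        "t \<in> carrier (sections Y U)" "r \<in> carrier (sections Y U)"
        "x = germ Y (f p) U s" "y = germ Y (f p) U t" "y = germ Y (f p) U r"
        using Y.stalk_common[OF xy xy(2)] .
    have q: "openin (pts X) (preim X f U)" "p \<in> preim X f U" using preim h p by auto
    note c = cring.cring_simprules(1,5)[OF Y.sections_cring[OF h(1)] h(3,4)]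
    note hc = ring_hom_closed[OF hom[OF h(1)]]
    show "stalk_map X f \<phi> p (x \<otimes>\<^bsub>stalk Y (f p)\<^esub> y) = stalk_map X f \<phi> p x \<otimes>\<^bsub>stalk X p\<^esub> stalk_map X f \<phi> p y"
      unfolding h(6,7) Y.stalk_mult[OF h(1-4)] map[OF h(1,2) c(2)] map[OF h(1-3)] map[OF h(1,2,4)]
        ring_hom_mult[OF hom[OF h(1)] h(3,4)]
      using X.stalk_mult[OF q hc hc] h by simp
    show "stalk_map X f \<phi> p (x \<oplus>\<^bsub>stalk Y (f p)\<^esub> y) = stalk_map X f \<phi> p x \<oplus>\<^bsub>stalk X p\<^esub> stalk_map X f \<phi> p y"
      unfolding h(6,7) Y.stalk_add[OF h(1-4)] map[OF h(1,2) c(1)] map[OF h(1-3)] map[OF h(1,2,4)]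
        ring_hom_add[OF hom[OF h(1)] h(3,4)]
      using X.stalk_add[OF q hc hc] h by simp
    show "stalk_map X f \<phi> p x \<in> carrier (stalk X p)"
      unfolding h(6) map[OF h(1-3)] by (rule X.germ_in_stalk[OF q hc[OF h(3)]])
  next
    let ?T = "topspace (pts Y)"
    have "preim X f ?T = topspace (pts X)" using cont by (auto simp: continuous_map_def)
    then show "stalk_map X f \<phi> p \<one>\<^bsub>stalk Y (f p)\<^esub> = \<one>\<^bsub>stalk X p\<^esub>"
      using Y.stalk_one[OF openin_topspace fp] X.stalk_one[OF openin_topspace p]
        map[OF openin_topspace fp] ring_hom_one[OF hom[OF openin_topspace]]
        cring.cring_simprules(6)[OF Y.sections_cring[OF openin_topspace]] by simp
  qed
  then show "local_ring_hom (stalk Y (f p)) (stalk X p) (stalk_map X f \<phi> p)"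
    by (rule nil_local_ring_hom_local[OF Y.stalk_nil_local[OF fp] X.stalk_nil_local[OF p]])
qed

section \<open>Spectra satisfying the T1 axiom\<close>

context cring begin

lemma spec_section_eqI:
  assumes "s \<in> carrier (spec_sections R U)" "t \<in> carrier (spec_sections R U)"
    and "\<And>P. P \<in> U \<Longrightarrow> s P = t P"
  shows "s = t"
proof -
  have "s = restrict s U" by (rule spec_sections_restrict[OF assms(1), symmetric])
  also have "\<dots> = restrict t U" by (rule restrict_ext) (rule assms(3))
  also have "\<dots> = t" by (rule spec_sections_restrict[OF assms(2)])
  finally show ?thesis .
qed

lemma spec_eval_hom:
  assumes "P \<in> U"
  shows "(\<lambda>s. s P) \<in> ring_hom (spec_sections R U) (local_at R P)"
  by (rule ring_hom_memI) (use assms in \<open>simp_all add: spec_sections_simps spec_sections_at\<close>)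

lemma fraction_pow:
  assumes P: "primeideal P R" and a: "a \<in> carrier R" "b \<in> carrier R - P"
  shows "fraction R (carrier R - P) a b [^]\<^bsub>local_at R P\<^esub> (n::nat)
    = fraction R (carrier R - P) (a [^] n) (b [^] n)"
proof -
  interpret loc: localized_ring R "carrier R - P" using localized_at_prime[OF P] .
  interpret LP: cring "local_at R P" by (rule loc.localization_cring)
  show ?thesis
  proof (induction n)
    case 0
    then show ?case by (simp add: loc.localization_one)
  next
    case (Suc n)
    have "b [^] n \<in> carrier R - P" using prime_pow_notin[OF P, of b n] a by simp
    then show ?case using a Suc by (simp add: loc.fraction_mult)
  qed
qed

text \<open>
  A section is near \<open>P\<close> a fraction \<open>a/b\<close>. If \<open>a\<close> lies outside \<open>P\<close>, then \<open>b/a\<close> is an inverse on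
  the basic open set of \<open>a\<close>. Otherwise \<open>r a^n = 0\<close> for some \<open>r\<close> outside \<open>P\<close>, and the \<open>n\<close>-th power
  of \<open>a/b\<close> vanishes on the basic open set of \<open>r\<close>.
\<close>

lemma nil_ringed_space_Spec:
  assumes T1: "t1_space (zariski R)"
  shows "nil_ringed_space (Spec R)"
proof (rule nil_ringed_space.intro[OF ringed_space_Spec], rule nil_ringed_space_axioms.intro)
  fix W assume W: "openin (pts (Spec R)) W" "W \<noteq> {}"
  then obtain P where P: "P \<in> W" by blast
  have Wz: "openin (zariski R) W" using W by (simp add: Spec_simps)
  note p = open_prime[OF Wz P]
  interpret loc: localized_ring R "carrier R - P" using localized_at_prime[OF p] .
  have one: "\<one> \<notin> P" by (rule one_notin_prime[OF p])
  have "fraction R (carrier R - P) \<one> \<one> \<noteq> fraction R (carrier R - P) \<zero> \<one>"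
  proof
    assume "fraction R (carrier R - P) \<one> \<one> = fraction R (carrier R - P) \<zero> \<one>"
    then obtain u where u: "u \<in> carrier R - P" "u \<otimes> (\<one> \<otimes> \<one>) = u \<otimes> (\<one> \<otimes> \<zero>)"
      by (rule loc.fraction_eqE) (use one in auto)
    then show False using zero_in_prime[OF p] by simp
  qed
  then have "\<one>\<^bsub>spec_sections R W\<^esub> P \<noteq> \<zero>\<^bsub>spec_sections R W\<^esub> P"
    using P by (simp add: spec_sections_simps loc.localization_one loc.localization_zero)
  then show "\<one>\<^bsub>sections (Spec R) W\<^esub> \<noteq> \<zero>\<^bsub>sections (Spec R) W\<^esub>"
    by (auto simp: Spec_simps)
next
  fix U P s assume "openin (pts (Spec R)) U" and P: "P \<in> U" and "s \<in> carrier (sections (Spec R) U)"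
  then have U: "openin (zariski R) U" and s: "s \<in> carrier (spec_sections R U)" by (auto simp: Spec_simps)
  note p = open_prime[OF U P]
  have "locally_fraction U s P" using s P by (simp add: spec_sections_carrier)
  then obtain V a b where V: "openin (zariski R) V" "P \<in> V" "V \<subseteq> U" and ab: "a \<in> carrier R" "b \<in> carrier R"
    and frac: "\<forall>Q\<in>V. b \<notin> Q \<and> s Q = fraction R (carrier R - Q) a b"
    unfolding locally_fraction_def by blast
  have res: "restrict s W \<in> carrier (spec_sections R W)" if "openin (zariski R) W" "W \<subseteq> U" for W
    using ringed_space.res_closed[OF ringed_space_Spec, of U W s] that U s by (simp add: Spec_simps)
  have "\<exists>W. openin (zariski R) W \<and> P \<in> W \<and> W \<subseteq> U \<and> (restrict s W \<in> Units (spec_sections R W) \<or>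
    (\<exists>n::nat. restrict s W [^]\<^bsub>spec_sections R W\<^esub> n = \<zero>\<^bsub>spec_sections R W\<^esub>))"
  proof (cases "a \<in> P")
    case False
    define W where "W = V \<inter> {Q. primeideal Q R \<and> a \<notin> Q}"
    have W: "openin (zariski R) W" "P \<in> W" "W \<subseteq> U" "W \<subseteq> V"
      using V zariski_basic_open[OF ab(1)] False p by (auto simp: W_def)
    have aW: "a \<notin> Q" if "Q \<in> W" for Q using that by (simp add: W_def)
    interpret sec: cring "spec_sections R W" by (rule spec_sections_cring[OF W(1)])
    define t where "t = (\<lambda>Q\<in>W. fraction R (carrier R - Q) b a)"
    have t: "t \<in> carrier (spec_sections R W)"
      unfolding t_def by (rule constant_fraction_section[OF W(1) ab(2,1) aW])
    have "restrict s W \<otimes>\<^bsub>spec_sections R W\<^esub> t = \<one>\<^bsub>spec_sections R W\<^esub>"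
    proof (rule spec_section_eqI)
      fix Q assume Q: "Q \<in> W"
      interpret loc: localized_ring R "carrier R - Q"
        using localized_at_prime[OF open_prime[OF W(1) Q]] .
      have c: "a \<in> carrier R - Q" "b \<in> carrier R - Q" "s Q = fraction R (carrier R - Q) a b"
        using frac ab Q W(4) aW[OF Q] by auto
      have "a \<otimes> b \<in> carrier R - Q" using loc.mult_in_S[OF c(1,2)] .
      then have "fraction R (carrier R - Q) a b \<otimes>\<^bsub>local_at R Q\<^esub> fraction R (carrier R - Q) b a
        = \<one>\<^bsub>local_at R Q\<^esub>"
        using c ab loc.fraction_mult[of a b b a] loc.localization_one_eq[of "a \<otimes> b"] m_comm[of b a] by simp
      then show "(restrict s W \<otimes>\<^bsub>spec_sections R W\<^esub> t) Q = \<one>\<^bsub>spec_sections R W\<^esub> Q"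
        using Q c(3) by (simp add: spec_sections_simps t_def)
    qed (use res[OF W(1,3)] t in auto)
    then have "restrict s W \<in> Units (spec_sections R W)"
      using res[OF W(1,3)] t sec.m_comm[of t "restrict s W"] unfolding Units_def by auto
    then show ?thesis using W by blast
  next
    case True
    obtain r n where r: "r \<in> carrier R - P" "r \<otimes> a [^] (n::nat) = \<zero>"
      using T1_zariski_killed[OF T1 p True] by blast
    define W where "W = V \<inter> {Q. primeideal Q R \<and> r \<notin> Q}"
    have W: "openin (zariski R) W" "P \<in> W" "W \<subseteq> U" "W \<subseteq> V"
      using V zariski_basic_open[of r] r p by (auto simp: W_def)
    interpret sec: cring "spec_sections R W" by (rule spec_sections_cring[OF W(1)])
    have "restrict s W [^]\<^bsub>spec_sections R W\<^esub> n = \<zero>\<^bsub>spec_sections R W\<^esub>"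
    proof (rule spec_section_eqI)
      fix Q assume Q: "Q \<in> W"
      note q = open_prime[OF W(1) Q]
      interpret loc: localized_ring R "carrier R - Q" using localized_at_prime[OF q] .
      have c: "r \<in> carrier R - Q" "b \<in> carrier R - Q" "s Q = fraction R (carrier R - Q) a b"
        using frac ab Q W(4) r by (auto simp: W_def)
      have bn: "b [^] n \<in> carrier R - Q" using prime_pow_notin[OF q, of b n] c by simp
      have "(restrict s W [^]\<^bsub>spec_sections R W\<^esub> n) Q = s Q [^]\<^bsub>local_at R Q\<^esub> n"
        using ring_hom_nat_pow[OF sec.is_cring local_at_cring[OF q] spec_eval_hom[OF Q] res[OF W(1,3)]] Q
        by simp
      also have "\<dots> = fraction R (carrier R - Q) (a [^] n) (b [^] n)"
        unfolding c(3) by (rule fraction_pow[OF q ab(1) c(2)])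
      also have "\<dots> = fraction R (carrier R - Q) \<zero> (b [^] n)"
        by (rule loc.fraction_eqI[OF _ _ _ _ c(1)])
          (use bn ab c r(2) in \<open>simp_all add: m_lcomm[of r "b [^] n" "a [^] n"]\<close>)
      also have "\<dots> = \<zero>\<^bsub>spec_sections R W\<^esub> Q"
        using loc.localization_zero_eq[OF bn] Q by (simp add: spec_sections_simps)
      finally show "(restrict s W [^]\<^bsub>spec_sections R W\<^esub> n) Q = \<zero>\<^bsub>spec_sections R W\<^esub> Q" .
    qed (use res[OF W(1,3)] in auto)
    then show ?thesis using W by blast
  qed
  then show "\<exists>W. openin (pts (Spec R)) W \<and> P \<in> W \<and> W \<subseteq> U \<and>
      (res (Spec R) U W s \<in> Units (sections (Spec R) W) \<or>
       (\<exists>n::nat. res (Spec R) U W s [^]\<^bsub>sections (Spec R) W\<^esub> n = \<zero>\<^bsub>sections (Spec R) W\<^esub>))"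
    by (simp only: Spec_simps)
qed

end

section \<open>Transport along isomorphisms and open subspaces\<close>

lemma lrs_isomorphic_nil:
  assumes iso: "lrs_isomorphic X Y" and X: "ringed_space X" and Y: "nil_ringed_space Y"
  shows "nil_ringed_space X"
proof -
  interpret X: ringed_space X by fact
  interpret Y: nil_ringed_space Y by fact
  obtain f \<phi> g \<psi> where f: "lrs_morphism X Y f \<phi>" and g: "lrs_morphism Y X g \<psi>"
    and gf: "\<forall>x\<in>topspace (pts X). g (f x) = x" and fg: "\<forall>y\<in>topspace (pts Y). f (g y) = y"
    and \<phi>\<psi>: "\<forall>U. openin (pts X) U \<longrightarrow> (\<forall>s\<in>carrier (sections X U). \<phi> (preim Y g U) (\<psi> U s) = s)"
    using iso unfolding lrs_isomorphic_def by (elim exE conjE) (rule that)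
  interpret f: lrs_morphism X Y f \<phi> by fact
  interpret g: lrs_morphism Y X g \<psi> by fact
  have fop: "openin (pts X) (preim X f V)" if "openin (pts Y) V" for V
    using f.continuous that by (simp add: continuous_map_def)
  have gop: "openin (pts Y) (preim Y g V)" if "openin (pts X) V" for V
    using g.continuous that by (simp add: continuous_map_def)
  have fm: "f x \<in> topspace (pts Y)" if "x \<in> topspace (pts X)" for x
    using f.continuous that by (auto simp: continuous_map_def)
  have gm: "g x \<in> topspace (pts X)" if "x \<in> topspace (pts Y)" for x
    using g.continuous that by (auto simp: continuous_map_def)
  show ?thesis
  proof (rule nil_ringed_space.intro[OF X], rule nil_ringed_space_axioms.intro)
    fix U p s assume U: "openin (pts X) U" and p: "p \<in> U" and s: "s \<in> carrier (sections X U)"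
    have UT: "U \<subseteq> topspace (pts X)" by (rule openin_subset[OF U])
    let ?V = "preim Y g U"
    have pT: "p \<in> topspace (pts X)" using p UT by blast
    have V: "openin (pts Y) ?V" "f p \<in> ?V" using gop[OF U] fm[OF pT] bspec[OF gf pT] p by simp_all
    have fV: "preim X f ?V = U" using UT gf fm by fastforce
    have t: "\<psi> U s \<in> carrier (sections Y ?V)" by (rule ring_hom_closed[OF g.sections_hom[OF U] s])
    obtain W where W: "openin (pts Y) W" "f p \<in> W" "W \<subseteq> ?V"
      and d: "res Y ?V W (\<psi> U s) \<in> Units (sections Y W) \<or>
        (\<exists>n::nat. res Y ?V W (\<psi> U s) [^]\<^bsub>sections Y W\<^esub> n = \<zero>\<^bsub>sections Y W\<^esub>)"
      using Y.unit_or_nilpotent[OF V t] by blast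
    let ?W = "preim X f W"
    have rc: "res Y ?V W (\<psi> U s) \<in> carrier (sections Y W)" by (rule Y.res_closed[OF V(1) W(1,3) t])
    have r: "\<phi> W (res Y ?V W (\<psi> U s)) = res X U ?W s"
      using f.sections_natural[OF V(1) W(1,3) t] \<phi>\<psi> U s unfolding fV by simp
    have W': "openin (pts X) ?W" "p \<in> ?W" "?W \<subseteq> U"
      using fop[OF W(1)] W p UT fV by auto
    note cr = Y.sections_cring[OF W(1)] X.sections_cring[OF W'(1)]
    note hom = f.sections_hom[OF W(1)]
    from d have "res X U ?W s \<in> Units (sections X ?W) \<or>
         (\<exists>n::nat. res X U ?W s [^]\<^bsub>sections X ?W\<^esub> n = \<zero>\<^bsub>sections X ?W\<^esub>)"
    proof
      assume "res Y ?V W (\<psi> U s) \<in> Units (sections Y W)"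
      from ring_hom_Units[OF cr hom this] show ?thesis unfolding r by blast
    next
      assume "\<exists>n::nat. res Y ?V W (\<psi> U s) [^]\<^bsub>sections Y W\<^esub> n = \<zero>\<^bsub>sections Y W\<^esub>"
      then obtain n where n: "res Y ?V W (\<psi> U s) [^]\<^bsub>sections Y W\<^esub> (n::nat) = \<zero>\<^bsub>sections Y W\<^esub>" by blast
      have "res X U ?W s [^]\<^bsub>sections X ?W\<^esub> n = \<zero>\<^bsub>sections X ?W\<^esub>"
        unfolding r[symmetric] ring_hom_nat_pow[OF cr hom rc, symmetric] n
        using ring_hom_zero[OF hom] cr by (simp add: cring_def)
      then show ?thesis by blast
    qed
    then show "\<exists>W. openin (pts X) W \<and> p \<in> W \<and> W \<subseteq> U \<and> (res X U W s \<in> Units (sections X W) \<or>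
         (\<exists>n::nat. res X U W s [^]\<^bsub>sections X W\<^esub> n = \<zero>\<^bsub>sections X W\<^esub>))"
      using W' by blast
  next
    fix W assume W: "openin (pts X) W" "W \<noteq> {}"
    then obtain x where x: "x \<in> W" by blast
    have xT: "x \<in> topspace (pts X)" using x openin_subset[OF W(1)] by blast
    then have "f x \<in> preim Y g W" using bspec[OF gf xT] fm x by simp
    then have ne: "preim Y g W \<noteq> {}" by blast
    note hom = g.sections_hom[OF W(1)]
    have "\<psi> W \<one>\<^bsub>sections X W\<^esub> \<noteq> \<psi> W \<zero>\<^bsub>sections X W\<^esub>"
      using Y.nontrivial[OF gop[OF W(1)] ne] ring_hom_one[OF hom] ring_hom_zero[OF hom]
        X.sections_cring[OF W(1)] Y.sections_cring[OF gop[OF W(1)]] by (simp add: cring_def)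
    then show "\<one>\<^bsub>sections X W\<^esub> \<noteq> \<zero>\<^bsub>sections X W\<^esub>" by auto
  qed
qed

lemma lrs_isomorphic_homeomorphic:
  assumes "lrs_isomorphic X Y"
  shows "pts X homeomorphic_space pts Y"
  using assms unfolding lrs_isomorphic_def homeomorphic_space_def homeomorphic_maps_def
  by (meson lrs_morphism.continuous)

lemma restrict_space_simps:
  "pts (restrict_space X U) = subtopology (pts X) U" "sections (restrict_space X U) = sections X"
  "res (restrict_space X U) = res X"
  by (simp_all add: restrict_space_def)

context ringed_space begin

lemma openin_restrict_space:
  "openin (pts X) U \<Longrightarrow> openin (pts (restrict_space X U)) V \<longleftrightarrow> openin (pts X) V \<and> V \<subseteq> U"
  by (simp add: restrict_space_simps openin_open_subtopology)

lemma ringed_restrict_space: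
  assumes U: "openin (pts X) U"
  shows "ringed_space (restrict_space X U)"
proof (rule ringed_space.intro, unfold openin_restrict_space[OF U] restrict_space_simps(2,3))
  fix \<V> and s t
  assume "\<forall>V\<in>\<V>. openin (pts X) V \<and> V \<subseteq> U"
    and "s \<in> carrier (sections X (\<Union>\<V>))" "t \<in> carrier (sections X (\<Union>\<V>))"
      "\<forall>V\<in>\<V>. res X (\<Union>\<V>) V s = res X (\<Union>\<V>) V t"
  then show "s = t" using sheaf_locality by blast
next
  fix \<V> and \<sigma>
  assume "\<forall>V\<in>\<V>. openin (pts X) V \<and> V \<subseteq> U" and "\<forall>V\<in>\<V>. \<sigma> V \<in> carrier (sections X V)"
    "\<forall>V\<in>\<V>. \<forall>W\<in>\<V>. res X V (V \<inter> W) (\<sigma> V) = res X W (V \<inter> W) (\<sigma> W)"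
  then show "\<exists>s\<in>carrier (sections X (\<Union>\<V>)). \<forall>V\<in>\<V>. res X (\<Union>\<V>) V s = \<sigma> V"
    using sheaf_gluing[of \<V> \<sigma>] by blast
qed (auto intro: sections_cring res_hom res_id res_comp)

lemma nil_ringed_space_local:
  assumes "\<And>p. p \<in> topspace (pts X) \<Longrightarrow>
    \<exists>U. openin (pts X) U \<and> p \<in> U \<and> nil_ringed_space (restrict_space X U)"
  shows "nil_ringed_space X"
proof (rule nil_ringed_space.intro[OF ringed_space_axioms], rule nil_ringed_space_axioms.intro)
  fix U p s assume U: "openin (pts X) U" and p: "p \<in> U" and s: "s \<in> carrier (sections X U)"
  have pT: "p \<in> topspace (pts X)" using U p openin_subset by blast
  obtain T where T: "openin (pts X) T" "p \<in> T" and nil: "nil_ringed_space (restrict_space X T)"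
    using assms[OF pT] by blast
  interpret N: nil_ringed_space "restrict_space X T" by fact
  note o = openin_restrict_space[OF T(1)]
  note ops = restrict_space_simps(2,3)
  let ?V = "U \<inter> T"
  have V: "openin (pts (restrict_space X T)) ?V" "p \<in> ?V" using U T p o by auto
  have rc: "res X U ?V s \<in> carrier (sections X ?V)" using res_closed[OF U _ _ s, of ?V] U T by auto
  obtain W where W: "openin (pts (restrict_space X T)) W" "p \<in> W" "W \<subseteq> ?V"
    and d: "res X ?V W (res X U ?V s) \<in> Units (sections X W) \<or>
        (\<exists>n::nat. res X ?V W (res X U ?V s) [^]\<^bsub>sections X W\<^esub> n = \<zero>\<^bsub>sections X W\<^esub>)"
    using N.unit_or_nilpotent[OF V, of "res X U ?V s"] rc unfolding ops by blast
  have "res X ?V W (res X U ?V s) = res X U W s"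
    using res_comp[OF U _ _ W(3) _ s] U T W(1) o by auto
  then show "\<exists>W. openin (pts X) W \<and> p \<in> W \<and> W \<subseteq> U \<and> (res X U W s \<in> Units (sections X W) \<or>
         (\<exists>n::nat. res X U W s [^]\<^bsub>sections X W\<^esub> n = \<zero>\<^bsub>sections X W\<^esub>))"
    using d W o by auto
next
  fix W assume W: "openin (pts X) W" "W \<noteq> {}"
  then obtain p where p: "p \<in> W" by blast
  have pT: "p \<in> topspace (pts X)" using W p openin_subset by blast
  obtain T where T: "openin (pts X) T" "p \<in> T" and nil: "nil_ringed_space (restrict_space X T)"
    using assms[OF pT] by blast
  interpret N: nil_ringed_space "restrict_space X T" by fact
  have WT: "openin (pts X) (W \<inter> T)" using W T by blast
  have "\<one>\<^bsub>sections X (W \<inter> T)\<^esub> \<noteq> \<zero>\<^bsub>sections X (W \<inter> T)\<^esub>"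
    using N.nontrivial[of "W \<inter> T"] WT p T(2) unfolding openin_restrict_space[OF T(1)] restrict_space_simps(2)
    by blast
  then show "\<one>\<^bsub>sections X W\<^esub> \<noteq> \<zero>\<^bsub>sections X W\<^esub>"
    using res_one[OF W(1) WT Int_lower1] res_zero[OF W(1) WT Int_lower1] by auto
qed

end

lemma (in nil_ringed_space) nil_restrict_space:
  assumes U: "openin (pts X) U"
  shows "nil_ringed_space (restrict_space X U)"
proof (rule nil_ringed_space.intro[OF ringed_restrict_space[OF U]], rule nil_ringed_space_axioms.intro,
    unfold openin_restrict_space[OF U] restrict_space_simps(2,3))
  fix V p s assume "openin (pts X) V \<and> V \<subseteq> U" "p \<in> V" "s \<in> carrier (sections X V)"
  then show "\<exists>W. (openin (pts X) W \<and> W \<subseteq> U) \<and> p \<in> W \<and> W \<subseteq> V \<and> (res X V W s \<in> Units (sections X W) \<or>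
         (\<exists>n::nat. res X V W s [^]\<^bsub>sections X W\<^esub> n = \<zero>\<^bsub>sections X W\<^esub>))"
    using unit_or_nilpotent[of V p s] by (meson order_trans)
qed (use nontrivial in blast)

text \<open>
  What an affine Hausdorff scheme inherits from its spectrum. The ring and its prime ideals do not
  occur in these three properties, which is why different affine opens of one scheme can be
  combined through them.
\<close>

lemma affine_scheme_Hausdorff:
  assumes "affine_scheme X" and "Hausdorff_space (pts X)"
  shows "nil_ringed_space X" and "compact_space (pts X)"
    and "\<And>W p. openin (pts X) W \<Longrightarrow> p \<in> W \<Longrightarrow> \<exists>C. openin (pts X) C \<and> closedin (pts X) C \<and> p \<in> C \<and> C \<subseteq> W"
proof -
  obtain R :: "'b ring" where R: "cring R" and iso: "lrs_isomorphic X (Spec R)"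
    and X: "locally_ringed_space X"
    using assms(1) unfolding affine_scheme_def by blast
  interpret cring R by fact
  have homeo: "pts X homeomorphic_space zariski R"
    using lrs_isomorphic_homeomorphic[OF iso] by (simp add: Spec_simps)
  have T1: "t1_space (zariski R)"
    using homeomorphic_Hausdorff_space[OF homeo] assms(2) Hausdorff_imp_t1_space by blast
  show "nil_ringed_space X"
    using lrs_isomorphic_nil[OF iso _ nil_ringed_space_Spec[OF T1]] X
    by (simp add: locally_ringed_space_def)
  show "compact_space (pts X)"
    using homeomorphic_compact_space[OF homeo] compact_zariski by simp
  obtain f g where fg: "homeomorphic_maps (pts X) (zariski R) f g"
    using homeo unfolding homeomorphic_space_def by blast
  fix W p assume W: "openin (pts X) W" and p: "p \<in> W"
  have pT: "p \<in> topspace (pts X)" using p openin_subset[OF W] by blast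
  have cont: "continuous_map (pts X) (zariski R) f" "continuous_map (zariski R) (pts X) g"
    and gf: "\<And>x. x \<in> topspace (pts X) \<Longrightarrow> g (f x) = x"
    using fg unfolding homeomorphic_maps_def by auto
  have fT: "f p \<in> topspace (zariski R)" using cont(1) pT by (auto simp: continuous_map_def)
  have V: "openin (zariski R) {y \<in> topspace (zariski R). g y \<in> W}"
    using cont(2) W by (simp add: continuous_map_def)
  obtain a where a: "a \<in> carrier R" "a \<notin> f p"
    and sub: "{P. primeideal P R \<and> a \<notin> P} \<subseteq> {y \<in> topspace (zariski R). g y \<in> W}"
    using openin_zariskiE[OF V, of "f p"] fT gf[OF pT] p by auto
  define D where "D = {P. primeideal P R \<and> a \<notin> P}"
  have "topspace (zariski R) - D = {P. primeideal P R \<and> a \<in> P}"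
    by (auto simp: D_def topspace_zariski)
  then have D: "openin (zariski R) D" "closedin (zariski R) D"
    using zariski_basic_open[OF a(1)] T1_zariski_closed_basic[OF T1 a(1)] 
    by (auto simp: closedin_def D_def topspace_zariski)
  let ?C = "{x \<in> topspace (pts X). f x \<in> D}"
  have "openin (pts X) ?C" "closedin (pts X) ?C"
    using openin_continuous_map_preimage[OF cont(1) D(1)] closedin_continuous_map_preimage[OF cont(1) D(2)] .
  moreover have "p \<in> ?C" using pT fT a by (simp add: D_def topspace_zariski)
  moreover have "?C \<subseteq> W"
  proof
    fix x assume x: "x \<in> ?C"
    then have "g (f x) \<in> W" using sub by (auto simp: D_def)
    then show "x \<in> W" using x gf by simp
  qed
  ultimately show "\<exists>C. openin (pts X) C \<and> closedin (pts X) C \<and> p \<in> C \<and> C \<subseteq> W" by blast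
qed

section \<open>Clopen sets and idempotents of global sections\<close>

text \<open>
  The underlying spaces are exactly the Stone spaces, the spectra of Boolean rings.
\<close>

locale stone_ringed_space = nil_ringed_space X for X :: "('p, 'a) rspace" +
  assumes compact: "compact_space (pts X)" and Hausdorff: "Hausdorff_space (pts X)"
    and clopen_base: "\<lbrakk>openin (pts X) W; p \<in> W\<rbrakk>
      \<Longrightarrow> \<exists>C. openin (pts X) C \<and> closedin (pts X) C \<and> p \<in> C \<and> C \<subseteq> W"
begin

abbreviation T where "T \<equiv> topspace (pts X)"
abbreviation A where "A \<equiv> sections X T"
abbreviation gm where "gm p \<equiv> germ X p T"

sublocale A: cring A
  by (rule sections_cring[OF openin_topspace])

lemma open_sub: "openin (pts X) U \<Longrightarrow> U \<subseteq> T"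
  by (rule openin_subset)

lemma glob_res: "openin (pts X) U \<Longrightarrow> a \<in> carrier A \<Longrightarrow> res X T U a \<in> carrier (sections X U)"
  by (rule res_closed[OF openin_topspace _ open_sub])

lemma empty_sections_eq:
  assumes "s \<in> carrier (sections X {})" "t \<in> carrier (sections X {})"
  shows "s = t"
  using sheaf_locality[of "{}" s t] assms by simp

text \<open>
  Separatedness for a cover by two open sets. Applied to a clopen set and its complement, it
  reduces an identity between global sections to the two parts.
\<close>

lemma sections_eqI2:
  assumes U: "openin (pts X) U" and V: "openin (pts X) V"
    and s: "s \<in> carrier (sections X (U \<union> V))" "t \<in> carrier (sections X (U \<union> V))"
    and "res X (U \<union> V) U s = res X (U \<union> V) U t" "res X (U \<union> V) V s = res X (U \<union> V) V t"
  shows "s = t"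
  using sheaf_locality[of "{U, V}" s t] assms by simp

lemma sections_eqI:
  assumes U: "openin (pts X) U" and s: "s \<in> carrier (sections X U)" "t \<in> carrier (sections X U)"
    and eq: "\<And>p. p \<in> U \<Longrightarrow> germ X p U s = germ X p U t"
  shows "s = t"
proof -
  define \<V> where "\<V> = {W. openin (pts X) W \<and> W \<subseteq> U \<and> res X U W s = res X U W t}"
  have "\<exists>W\<in>\<V>. p \<in> W" if p: "p \<in> U" for p
  proof -
    have "agree p U s U t" by (rule germ_eqD[OF eq[OF p] U p s(2)])
    then obtain W where "openin (pts X) W" "p \<in> W" "W \<subseteq> U" "res X U W s = res X U W t"
      by (rule agreeE)
    then show ?thesis unfolding \<V>_def by blast
  qed
  then have un: "\<Union>\<V> = U" unfolding \<V>_def by blast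
  show ?thesis
    by (rule sheaf_locality[of \<V>]; (unfold un)?) (use s in \<open>simp_all add: \<V>_def\<close>)
qed

lemma complement_open: "closedin (pts X) C \<Longrightarrow> openin (pts X) (T - C)"
  by (simp add: closedin_def)

text \<open>
  Glue the section on \<open>C\<close> with zero on the complement; on the empty intersection all sections
  agree.
\<close>

lemma extend_by_zero:
  assumes C: "openin (pts X) C" "closedin (pts X) C" and s: "s \<in> carrier (sections X C)"
  obtains a where "a \<in> carrier A" "res X T C a = s" "res X T (T - C) a = \<zero>\<^bsub>sections X (T - C)\<^esub>"
proof -
  have D: "openin (pts X) (T - C)" by (rule complement_open[OF C(2)])
  \<comment> \<open>If C equals its complement, both are empty and the zero ring of sections takes care of it.\<close>
  define \<sigma> where "\<sigma> V = (if V = C then s else \<zero>\<^bsub>sections X (T - C)\<^esub>)" for V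
  have z: "\<zero>\<^bsub>sections X (T - C)\<^esub> \<in> carrier (sections X (T - C))"
    by (rule cring.cring_simprules(2)[OF sections_cring[OF D]])
  have un: "\<Union>{C, T - C} = T" using open_sub[OF C(1)] by auto
  have c: "\<forall>V\<in>{C, T - C}. \<sigma> V \<in> carrier (sections X V)" using s z by (auto simp: \<sigma>_def)
  have "res X V (V \<inter> W) (\<sigma> V) = res X W (V \<inter> W) (\<sigma> W)" if VW: "V \<in> {C, T - C}" "W \<in> {C, T - C}" for V W
  proof (cases "V = W")
    case False
    then have e: "V \<inter> W = {}" using VW by auto
    have "openin (pts X) V" "openin (pts X) W" using VW C D by auto
    then show ?thesis unfolding e
      by (intro empty_sections_eq res_closed) (use c VW in auto)
  qed simp
  then have compat: "\<forall>V\<in>{C, T - C}. \<forall>W\<in>{C, T - C}. res X V (V \<inter> W) (\<sigma> V) = res X W (V \<inter> W) (\<sigma> W)"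
    by blast
  have "\<exists>a\<in>carrier (sections X (\<Union>{C, T - C})). \<forall>V\<in>{C, T - C}. res X (\<Union>{C, T - C}) V a = \<sigma> V"
    by (rule sheaf_gluing[OF _ c compat]) (use C D in simp)
  then obtain a where a: "a \<in> carrier A" "res X T C a = \<sigma> C" "res X T (T - C) a = \<sigma> (T - C)"
    unfolding un by blast
  have "res X T (T - C) a = \<zero>\<^bsub>sections X (T - C)\<^esub>"
  proof (cases "T - C = C")
    case True
    then have e: "T - C = {}" by blast
    show ?thesis
      by (rule empty_sections_eq; unfold e[symmetric]) (use glob_res[OF D a(1)] z in auto)
  qed (use a in \<open>simp add: \<sigma>_def\<close>)
  then show ?thesis using that[OF a(1)] a(2) by (simp add: \<sigma>_def)
qed

definition idem where
  "idem C = (SOME e. e \<in> carrier A \<and> res X T C e = \<one>\<^bsub>sections X C\<^esub> \<and>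
     res X T (T - C) e = \<zero>\<^bsub>sections X (T - C)\<^esub>)"

lemma idem:
  assumes C: "openin (pts X) C" "closedin (pts X) C"
  shows "idem C \<in> carrier A" "res X T C (idem C) = \<one>\<^bsub>sections X C\<^esub>"
    "res X T (T - C) (idem C) = \<zero>\<^bsub>sections X (T - C)\<^esub>"
proof -
  have "\<one>\<^bsub>sections X C\<^esub> \<in> carrier (sections X C)"
    by (rule cring.cring_simprules(6)[OF sections_cring[OF C(1)]])
  then obtain e where "e \<in> carrier A \<and> res X T C e = \<one>\<^bsub>sections X C\<^esub> \<and>
     res X T (T - C) e = \<zero>\<^bsub>sections X (T - C)\<^esub>"
    using extend_by_zero[OF C] by blast
  then have "idem C \<in> carrier A \<and> res X T C (idem C) = \<one>\<^bsub>sections X C\<^esub> \<and>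
     res X T (T - C) (idem C) = \<zero>\<^bsub>sections X (T - C)\<^esub>"
    unfolding idem_def by (rule someI)
  then show "idem C \<in> carrier A" "res X T C (idem C) = \<one>\<^bsub>sections X C\<^esub>"
    "res X T (T - C) (idem C) = \<zero>\<^bsub>sections X (T - C)\<^esub>" by blast+
qed

text \<open>
  Multiplication by the idempotent of \<open>C\<close> forgets everything off \<open>C\<close>. This turns an equality near
  a point into an equality of global sections, with a multiplier that is invertible at the point.
\<close>

lemma idem_mult_eq:
  assumes C: "openin (pts X) C" "closedin (pts X) C" and x: "x \<in> carrier A" "y \<in> carrier A"
    and eq: "res X T C x = res X T C y"
  shows "idem C \<otimes>\<^bsub>A\<^esub> x = idem C \<otimes>\<^bsub>A\<^esub> y"
proof -
  have D: "openin (pts X) (T - C)" by (rule complement_open[OF C(2)])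
  have un: "C \<union> (T - C) = T" using open_sub[OF C(1)] by auto
  note e = idem[OF C]
  note m = res_mult[OF openin_topspace C(1) open_sub[OF C(1)] e(1)]
    res_mult[OF openin_topspace D open_sub[OF D] e(1)]
  show ?thesis
  proof (rule sections_eqI2[OF C(1) D]; unfold un)
    show "res X T C (idem C \<otimes>\<^bsub>A\<^esub> x) = res X T C (idem C \<otimes>\<^bsub>A\<^esub> y)"
      unfolding m(1)[OF x(1)] m(1)[OF x(2)] eq ..
    interpret D: cring "sections X (T - C)" by (rule sections_cring[OF D])
    show "res X T (T - C) (idem C \<otimes>\<^bsub>A\<^esub> x) = res X T (T - C) (idem C \<otimes>\<^bsub>A\<^esub> y)"
      unfolding m(2)[OF x(1)] m(2)[OF x(2)] e(3) using glob_res[OF D] x by simp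
  qed (use e(1) x in simp_all)
qed

text \<open>
  Shrink the neighbourhood to a clopen one and extend by zero.
\<close>

lemma local_global:
  assumes U: "openin (pts X) U" "p \<in> U" and s: "s \<in> carrier (sections X U)"
  obtains a where "a \<in> carrier A" "gm p a = germ X p U s"
proof -
  obtain C where C: "openin (pts X) C" "closedin (pts X) C" "p \<in> C" "C \<subseteq> U" using clopen_base[OF U] by blast
  obtain a where a: "a \<in> carrier A" "res X T C a = res X U C s"
    using extend_by_zero[OF C(1,2) res_closed[OF U(1) C(1,4) s]] by blast
  have "gm p a = germ X p C (res X T C a)"
    using germ_res[OF openin_topspace C(1) open_sub[OF C(1)] C(3) a(1)] by simp
  also have "\<dots> = germ X p U s" unfolding a(2) by (rule germ_res[OF U(1) C(1,4,3) s])
  finally show ?thesis using that a by blast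
qed

section \<open>Points as prime ideals of global sections\<close>

definition pt_ideal where
  "pt_ideal p = {a \<in> carrier A. gm p a \<notin> Units (stalk X p)}"

lemma pt_ideal_prime:
  assumes p: "p \<in> T"
  shows "primeideal (pt_ideal p) A"
proof -
  interpret S: cring "stalk X p" by (rule stalk_cring[OF p])
  note h = germ_hom[OF openin_topspace p]
  have "maximalideal {x \<in> carrier (stalk X p). x \<notin> Units (stalk X p)} (stalk X p)"
    using nil_local_ring_maximalideal_iff[OF stalk_nil_local[OF p]] by blast
  then have "primeideal {x \<in> carrier (stalk X p). x \<notin> Units (stalk X p)} (stalk X p)"
    by (rule S.maximalideal_prime)
  then have "primeideal {a \<in> carrier A. gm p a \<in> {x \<in> carrier (stalk X p). x \<notin> Units (stalk X p)}} A"
    by (rule primeideal_vimage[OF A.is_cring S.is_cring h])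
  moreover have "{a \<in> carrier A. gm p a \<in> {x \<in> carrier (stalk X p). x \<notin> Units (stalk X p)}} = pt_ideal p"
    unfolding pt_ideal_def using ring_hom_closed[OF h] by blast
  ultimately show ?thesis by simp
qed

lemma not_in_pt_ideal:
  assumes "p \<in> T" "a \<in> carrier A"
  shows "a \<notin> pt_ideal p \<longleftrightarrow> (\<exists>W. openin (pts X) W \<and> p \<in> W \<and> res X T W a \<in> Units (sections X W))"
  using germ_unit_iff[OF openin_topspace assms] assms open_sub unfolding pt_ideal_def by blast

text \<open>
  Near \<open>p\<close> the section is a unit or nilpotent, and the first alternative is excluded.
\<close>

lemma in_pt_ideal_nilpotent:
  assumes "p \<in> T" "a \<in> pt_ideal p"
  shows "\<exists>W n. openin (pts X) W \<and> p \<in> W \<and> res X T W a [^]\<^bsub>sections X W\<^esub> (n::nat) = \<zero>\<^bsub>sections X W\<^esub>"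
proof -
  have a: "a \<in> carrier A" using assms(2) by (simp add: pt_ideal_def)
  show ?thesis
    using unit_or_nilpotent[OF openin_topspace assms(1) a] not_in_pt_ideal[OF assms(1) a] assms(2) by blast
qed

lemma idem_pt_ideal:
  assumes C: "openin (pts X) C" "closedin (pts X) C" and p: "p \<in> T"
  shows "idem C \<in> pt_ideal p \<longleftrightarrow> p \<notin> C"
proof -
  note e = idem[OF C]
  have "idem C \<notin> pt_ideal p" if "p \<in> C"
    unfolding not_in_pt_ideal[OF p e(1)] using C that e(2) monoid.Units_one_closed
      cring.axioms(2)[OF sections_cring[OF C(1)]] comm_monoid.axioms(1) by (metis)
  moreover have "idem C \<in> pt_ideal p" if "p \<notin> C"
  proof -
    have D: "openin (pts X) (T - C)" "p \<in> T - C" using complement_open[OF C(2)] that p by auto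
    have "gm p (idem C) = \<zero>\<^bsub>stalk X p\<^esub>"
      using germ_res[OF openin_topspace D(1) open_sub[OF D(1)] D(2) e(1)] e(3) stalk_zero[OF D] by simp
    moreover have "\<zero>\<^bsub>stalk X p\<^esub> \<notin> Units (stalk X p)"
    proof -
      interpret S: cring "stalk X p" by (rule stalk_cring[OF p])
      have "\<zero>\<^bsub>stalk X p\<^esub> [^]\<^bsub>stalk X p\<^esub> (1::nat) = \<zero>\<^bsub>stalk X p\<^esub>" by simp
      then show ?thesis
        using S.unit_not_nilpotent stalk_nil_local[OF p] unfolding nil_local_ring_def by blast
    qed
    ultimately show ?thesis using e(1) by (simp add: pt_ideal_def)
  qed
  ultimately show ?thesis by blast
qed

text \<open>
  If every point had a neighbourhood on which some element of \<open>Q\<close> equals one, then finitely many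
  such neighbourhoods would cover the space, and the corresponding elements could be combined into
  one element of \<open>Q\<close> that equals one everywhere. So some point \<open>p\<close> has no such neighbourhood.
  An element of \<open>pt_ideal p\<close> is nilpotent on a clopen neighbourhood of \<open>p\<close> whose idempotent lies
  outside \<open>Q\<close>, hence it lies in \<open>Q\<close>; an element of \<open>Q\<close> outside \<open>pt_ideal p\<close> would be invertible near
  \<open>p\<close>, and a multiple of it would equal one there.
\<close>

lemma pt_ideal_surj:
  assumes Q: "primeideal Q A"
  shows "\<exists>p\<in>T. pt_ideal p = Q"
proof -
  interpret Q: primeideal Q A by fact
  define \<C> where "\<C> = {C. openin (pts X) C \<and> (\<exists>e\<in>Q. res X T C e = \<one>\<^bsub>sections X C\<^esub>)}"
  have union: "C \<union> D \<in> \<C>" if CD: "C \<in> \<C>" "D \<in> \<C>" for C D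
  proof -
    obtain e d where C: "openin (pts X) C" "e \<in> Q" "res X T C e = \<one>\<^bsub>sections X C\<^esub>"
      and D: "openin (pts X) D" "d \<in> Q" "res X T D d = \<one>\<^bsub>sections X D\<^esub>"
      using CD unfolding \<C>_def by blast
    have ed: "e \<in> carrier A" "d \<in> carrier A" using C D Q.Icarr by auto
    define y where "y = \<one>\<^bsub>A\<^esub> \<ominus>\<^bsub>A\<^esub> e"
    have y: "y \<in> carrier A" "y \<oplus>\<^bsub>A\<^esub> e = \<one>\<^bsub>A\<^esub>"
      using ed by (simp_all add: y_def A.minus_eq A.a_assoc A.l_neg)
    \<comment> \<open>With y = 1 - e, the element x = e + d (1 - e) is one wherever e or d is one.\<close>
    define x where "x = e \<oplus>\<^bsub>A\<^esub> d \<otimes>\<^bsub>A\<^esub> y"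
    have x: "x \<in> Q" "x \<in> carrier A" unfolding x_def using C D y(1) ed by (auto intro: Q.a_closed Q.I_r_closed)
    have dy: "d \<otimes>\<^bsub>A\<^esub> y \<in> carrier A" using ed y by simp
    have rx: "res X T V x = res X T V e \<oplus>\<^bsub>sections X V\<^esub> res X T V d \<otimes>\<^bsub>sections X V\<^esub> res X T V y"
      if V: "openin (pts X) V" for V
      unfolding x_def res_add[OF openin_topspace V open_sub[OF V] ed(1) dy]
        res_mult[OF openin_topspace V open_sub[OF V] ed(2) y(1)] ..
    have ry: "res X T V y \<oplus>\<^bsub>sections X V\<^esub> res X T V e = \<one>\<^bsub>sections X V\<^esub>"
      if V: "openin (pts X) V" for V
      unfolding res_add[OF openin_topspace V open_sub[OF V] y(1) ed(1), symmetric] y(2)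
      by (rule res_one[OF openin_topspace V open_sub[OF V]])
    have xC: "res X T C x = \<one>\<^bsub>sections X C\<^esub>"
    proof -
      interpret G: cring "sections X C" by (rule sections_cring[OF C(1)])
      have c: "res X T C y \<in> carrier (sections X C)" "res X T C d \<in> carrier (sections X C)"
        using glob_res[OF C(1)] y ed by auto
      have "res X T C y \<oplus>\<^bsub>sections X C\<^esub> \<one>\<^bsub>sections X C\<^esub> = \<zero>\<^bsub>sections X C\<^esub> \<oplus>\<^bsub>sections X C\<^esub> \<one>\<^bsub>sections X C\<^esub>"
        using ry[OF C(1)] unfolding C(3) by simp
      then have "res X T C y = \<zero>\<^bsub>sections X C\<^esub>" using c by simp
      then show ?thesis unfolding rx[OF C(1)] C(3) using c by simp
    qed
    have xD: "res X T D x = \<one>\<^bsub>sections X D\<^esub>"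
    proof -
      interpret G: cring "sections X D" by (rule sections_cring[OF D(1)])
      have c: "res X T D y \<in> carrier (sections X D)" "res X T D e \<in> carrier (sections X D)"
        using glob_res[OF D(1)] y ed by auto
      show ?thesis unfolding rx[OF D(1)] D(3) using c ry[OF D(1)] by (simp add: G.a_comm)
    qed
    have o: "openin (pts X) (C \<union> D)" using C D by blast
    have "res X T (C \<union> D) x = \<one>\<^bsub>sections X (C \<union> D)\<^esub>"
    proof (rule sections_eqI2[OF C(1) D(1)])
      show "res X T (C \<union> D) x \<in> carrier (sections X (C \<union> D))" by (rule glob_res[OF o x(2)])
      show "\<one>\<^bsub>sections X (C \<union> D)\<^esub> \<in> carrier (sections X (C \<union> D))"
        by (rule cring.cring_simprules(6)[OF sections_cring[OF o]])
      show "res X (C \<union> D) C (res X T (C \<union> D) x) = res X (C \<union> D) C \<one>\<^bsub>sections X (C \<union> D)\<^esub>"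
        using res_comp[OF openin_topspace o C(1) Un_upper1 open_sub[OF o] x(2)] res_one[OF o C(1) Un_upper1] xC
        by simp
      show "res X (C \<union> D) D (res X T (C \<union> D) x) = res X (C \<union> D) D \<one>\<^bsub>sections X (C \<union> D)\<^esub>"
        using res_comp[OF openin_topspace o D(1) Un_upper2 open_sub[OF o] x(2)] res_one[OF o D(1) Un_upper2] xD
        by simp
    qed
    then show ?thesis using o x unfolding \<C>_def by blast
  qed
  have emp: "{} \<in> \<C>"
  proof -
    have "openin (pts X) {}" by simp
    then have "res X T {} \<zero>\<^bsub>A\<^esub> = \<one>\<^bsub>sections X {}\<^esub>"
      using glob_res[of "{}"] cring.cring_simprules(6)[OF sections_cring[of "{}"]]
      by (intro empty_sections_eq) auto
    then show ?thesis using Q.zero_closed unfolding \<C>_def by auto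
  qed
  have fin: "\<Union>F \<in> \<C>" if "finite F" "F \<subseteq> \<C>" for F
    using that by (induction F rule: finite_induct) (simp_all add: emp union)
  have "T \<notin> \<C>"
  proof
    assume "T \<in> \<C>"
    then obtain e where "e \<in> Q" "res X T T e = \<one>\<^bsub>A\<^esub>" unfolding \<C>_def by blast
    then have "\<one>\<^bsub>A\<^esub> \<in> Q" using res_id[OF openin_topspace Q.Icarr] by simp
    then show False using A.one_notin_prime[OF Q] by simp
  qed
  have "\<exists>p\<in>T. \<forall>C\<in>\<C>. p \<notin> C"
  proof (rule ccontr)
    assume "\<not> ?thesis"
    then have "T \<subseteq> \<Union>\<C>" by blast
    moreover have "\<forall>C\<in>\<C>. openin (pts X) C" unfolding \<C>_def by blast
    ultimately obtain F where F: "finite F" "F \<subseteq> \<C>" "T \<subseteq> \<Union>F"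
      using compact unfolding compact_space_alt by meson
    have "\<Union>F \<subseteq> T" using F(2) open_sub unfolding \<C>_def by blast
    then have "\<Union>F = T" using F(3) by blast
    then show False using fin[OF F(1,2)] \<open>T \<notin> \<C>\<close> by simp
  qed
  then obtain p where p: "p \<in> T" and pC: "\<And>C e. openin (pts X) C \<Longrightarrow> p \<in> C \<Longrightarrow> e \<in> Q \<Longrightarrow> res X T C e \<noteq> \<one>\<^bsub>sections X C\<^esub>"
    unfolding \<C>_def by blast
  have "pt_ideal p \<subseteq> Q"
  proof
    fix a assume a: "a \<in> pt_ideal p"
    have ac: "a \<in> carrier A" using a by (simp add: pt_ideal_def)
    obtain W n where W: "openin (pts X) W" "p \<in> W"
      and n: "res X T W a [^]\<^bsub>sections X W\<^esub> (n::nat) = \<zero>\<^bsub>sections X W\<^esub>"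
      using in_pt_ideal_nilpotent[OF p a] by blast
    obtain C where C: "openin (pts X) C" "closedin (pts X) C" "p \<in> C" "C \<subseteq> W" using clopen_base[OF W] by blast
    have an: "a [^]\<^bsub>A\<^esub> n \<in> carrier A" using ac by simp
    have "res X T C (a [^]\<^bsub>A\<^esub> n) = res X W C (res X T W (a [^]\<^bsub>A\<^esub> n))"
      using res_comp[OF openin_topspace W(1) C(1,4) open_sub[OF W(1)] an] by simp
    also have "\<dots> = res X W C \<zero>\<^bsub>sections X W\<^esub>"
      using res_pow[OF openin_topspace W(1) open_sub[OF W(1)] ac] n by simp
    also have "\<dots> = res X T C \<zero>\<^bsub>A\<^esub>"
      using res_zero[OF W(1) C(1,4)] res_zero[OF openin_topspace C(1) open_sub[OF C(1)]] by simp
    finally have "idem C \<otimes>\<^bsub>A\<^esub> a [^]\<^bsub>A\<^esub> n = idem C \<otimes>\<^bsub>A\<^esub> \<zero>\<^bsub>A\<^esub>"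
      by (rule idem_mult_eq[OF C(1,2) an A.zero_closed])
    then have "idem C \<otimes>\<^bsub>A\<^esub> a [^]\<^bsub>A\<^esub> n \<in> Q" using idem(1)[OF C(1,2)] Q.zero_closed by simp
    moreover have "idem C \<notin> Q" using pC[OF C(1,3)] idem(2)[OF C(1,2)] by blast
    ultimately have "a [^]\<^bsub>A\<^esub> n \<in> Q" using Q.I_prime[OF idem(1)[OF C(1,2)] an] by blast
    then show "a \<in> Q" using A.prime_pow_notin[OF Q ac] by blast
  qed
  moreover have "Q \<subseteq> pt_ideal p"
  proof
    fix a assume a: "a \<in> Q"
    have ac: "a \<in> carrier A" using a Q.Icarr by simp
    show "a \<in> pt_ideal p"
    proof (rule ccontr)
      assume "a \<notin> pt_ideal p"
      then obtain W where W: "openin (pts X) W" "p \<in> W" and u: "res X T W a \<in> Units (sections X W)"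
        unfolding not_in_pt_ideal[OF p ac] by blast
      obtain C where C: "openin (pts X) C" "closedin (pts X) C" "p \<in> C" "C \<subseteq> W" using clopen_base[OF W] by blast
      have "res X T C a \<in> Units (sections X C)"
        using res_Units[OF W(1) C(1,4) u] res_comp[OF openin_topspace W(1) C(1,4) open_sub[OF W(1)] ac] by simp
      then obtain b0 where b0: "b0 \<in> carrier (sections X C)" "res X T C a \<otimes>\<^bsub>sections X C\<^esub> b0 = \<one>\<^bsub>sections X C\<^esub>"
        unfolding Units_def by blast
      obtain b where b: "b \<in> carrier A" "res X T C b = b0" using extend_by_zero[OF C(1,2) b0(1)] by blast
      have "res X T C (a \<otimes>\<^bsub>A\<^esub> b) = \<one>\<^bsub>sections X C\<^esub>"
        using res_mult[OF openin_topspace C(1) open_sub[OF C(1)] ac b(1)] b0 b by simp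
      then show False using pC[OF C(1,3)] Q.I_r_closed[OF a b(1)] by blast
    qed
  qed
  ultimately show ?thesis using p by blast
qed

lemma pt_ideal_inj: "inj_on pt_ideal T"
proof (rule inj_onI, rule ccontr)
  fix p q assume p: "p \<in> T" and q: "q \<in> T" and eq: "pt_ideal p = pt_ideal q" and ne: "p \<noteq> q"
  then obtain W where W: "openin (pts X) W" "p \<in> W" "q \<notin> W"
    using Hausdorff unfolding Hausdorff_space_def by (metis disjnt_iff)
  obtain C where C: "openin (pts X) C" "closedin (pts X) C" "p \<in> C" "C \<subseteq> W" using clopen_base[OF W(1,2)] by blast
  then show False using idem_pt_ideal[OF C(1,2) p] idem_pt_ideal[OF C(1,2) q] eq W(3) by blast
qed

definition pt where "pt = inv_into T pt_ideal"

lemma pt_pt_ideal: "p \<in> T \<Longrightarrow> pt (pt_ideal p) = p"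
  unfolding pt_def by (rule inv_into_f_f[OF pt_ideal_inj])

lemma pt_ideal_pt: "primeideal Q A \<Longrightarrow> pt_ideal (pt Q) = Q" and pt_in: "primeideal Q A \<Longrightarrow> pt Q \<in> T"
proof -
  assume "primeideal Q A"
  then have "Q \<in> pt_ideal ` T" using pt_ideal_surj by blast
  then show "pt_ideal (pt Q) = Q" "pt Q \<in> T" unfolding pt_def
    by (rule f_inv_into_f, rule inv_into_into)
qed

lemma continuous_pt_ideal: "continuous_map (pts X) (zariski A) pt_ideal"
  unfolding continuous_map_def
proof (intro conjI allI impI)
  show "pt_ideal \<in> T \<rightarrow> topspace (zariski A)" using pt_ideal_prime by (simp add: A.topspace_zariski)
  fix V assume V: "openin (zariski A) V"
  show "openin (pts X) {p \<in> T. pt_ideal p \<in> V}"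
  proof (subst openin_subopen, intro ballI)
    fix p assume "p \<in> {p \<in> T. pt_ideal p \<in> V}"
    then have p: "p \<in> T" "pt_ideal p \<in> V" by auto
    obtain a where a: "a \<in> carrier A" "a \<notin> pt_ideal p" "{P. primeideal P A \<and> a \<notin> P} \<subseteq> V"
      using A.openin_zariskiE[OF V p(2)] by blast
    obtain W where W: "openin (pts X) W" "p \<in> W" "res X T W a \<in> Units (sections X W)"
      using a(2) unfolding not_in_pt_ideal[OF p(1) a(1)] by blast
    have "q \<in> T \<and> pt_ideal q \<in> V" if q: "q \<in> W" for q
    proof -
      have qT: "q \<in> T" using q open_sub[OF W(1)] by blast
      have "a \<notin> pt_ideal q" unfolding not_in_pt_ideal[OF qT a(1)] using W q by blast
      then show ?thesis using qT a(3) pt_ideal_prime[OF qT] by blast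
    qed
    then show "\<exists>W. openin (pts X) W \<and> p \<in> W \<and> W \<subseteq> {p \<in> T. pt_ideal p \<in> V}" using W by blast
  qed
qed

text \<open>
  The image of \<open>U\<close> under \<open>pt_ideal\<close>, written as a preimage under the inverse bijection so that it
  has the form required of a morphism from the spectrum.
\<close>

definition spec_open where "spec_open U = {Q \<in> topspace (zariski A). pt Q \<in> U}"

lemma spec_open_iff: "Q \<in> spec_open U \<longleftrightarrow> primeideal Q A \<and> pt Q \<in> U"
  by (simp add: spec_open_def A.topspace_zariski)

text \<open>
  The idempotent of a clopen set \<open>C\<close> lies outside \<open>pt_ideal p\<close> exactly for \<open>p\<close> in \<open>C\<close>, so clopen
  sets correspond to basic open sets of the spectrum.
\<close>

lemma openin_spec_open:
  assumes U: "openin (pts X) U"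
  shows "openin (zariski A) (spec_open U)"
proof (subst openin_subopen, intro ballI)
  fix Q assume "Q \<in> spec_open U"
  then have Q: "primeideal Q A" "pt Q \<in> U" by (auto simp: spec_open_iff)
  obtain C where C: "openin (pts X) C" "closedin (pts X) C" "pt Q \<in> C" "C \<subseteq> U"
    using clopen_base[OF U Q(2)] by blast
  have i: "idem C \<in> P \<longleftrightarrow> pt P \<notin> C" if "primeideal P A" for P
    using idem_pt_ideal[OF C(1,2) pt_in[OF that]] pt_ideal_pt[OF that] by simp
  show "\<exists>V. openin (zariski A) V \<and> Q \<in> V \<and> V \<subseteq> spec_open U"
  proof (intro exI conjI)
    show "openin (zariski A) {P. primeideal P A \<and> idem C \<notin> P}"
      by (rule A.zariski_basic_open[OF idem(1)[OF C(1,2)]])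
    show "Q \<in> {P. primeideal P A \<and> idem C \<notin> P}" using i Q C by simp
    show "{P. primeideal P A \<and> idem C \<notin> P} \<subseteq> spec_open U" using i C(4) by (auto simp: spec_open_iff)
  qed
qed

lemma continuous_pt: "continuous_map (zariski A) (pts X) pt"
  unfolding continuous_map_def using openin_spec_open pt_in by (simp add: spec_open_def A.topspace_zariski)

lemma spec_open_preim: "openin (zariski A) V \<Longrightarrow> spec_open {p \<in> T. pt_ideal p \<in> V} = V"
  using openin_subset[of "zariski A" V] pt_ideal_pt pt_in by (auto simp: spec_open_iff A.topspace_zariski)

lemma preim_spec_open: "openin (pts X) U \<Longrightarrow> {p \<in> T. pt_ideal p \<in> spec_open U} = U"
  using open_sub[of U] pt_pt_ideal pt_ideal_prime by (auto simp: spec_open_iff)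

lemma t1_zariski_global: "t1_space (zariski A)"
proof -
  have "homeomorphic_maps (pts X) (zariski A) pt_ideal pt"
    unfolding homeomorphic_maps_def using continuous_pt_ideal continuous_pt pt_pt_ideal pt_ideal_pt
    by (simp add: A.topspace_zariski)
  then have "pts X homeomorphic_space zariski A" unfolding homeomorphic_space_def by blast
  then show ?thesis using homeomorphic_Hausdorff_space Hausdorff Hausdorff_imp_t1_space by blast
qed

end

context stone_ringed_space begin

section \<open>Sections as sections of the structure sheaf\<close>

text \<open>
  This identifies the local ring of \<open>A\<close> at \<open>pt_ideal p\<close> with a subring of the stalk at \<open>p\<close>. From
  germs to fractions, the multiplier in the definition of equality of fractions is the idempotent
  of a clopen neighbourhood on which the two sections coincide.
\<close>

lemma fraction_eq_iff_germ:
  assumes p: "p \<in> T" and ab: "a \<in> carrier A" "b \<in> carrier A"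
    and st: "s \<in> carrier A - pt_ideal p" "t \<in> carrier A - pt_ideal p"
  shows "fraction A (carrier A - pt_ideal p) a s = fraction A (carrier A - pt_ideal p) b t \<longleftrightarrow>
    gm p (t \<otimes>\<^bsub>A\<^esub> a) = gm p (s \<otimes>\<^bsub>A\<^esub> b)"
proof -
  interpret loc: localized_ring A "carrier A - pt_ideal p"
    by (rule A.localized_at_prime[OF pt_ideal_prime[OF p]])
  interpret S: cring "stalk X p" by (rule stalk_cring[OF p])
  note h = germ_hom[OF openin_topspace p]
  have c: "t \<otimes>\<^bsub>A\<^esub> a \<in> carrier A" "s \<otimes>\<^bsub>A\<^esub> b \<in> carrier A" using ab st by auto
  show ?thesis
  proof
    assume e: "fraction A (carrier A - pt_ideal p) a s = fraction A (carrier A - pt_ideal p) b t"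
    obtain u where u: "u \<in> carrier A - pt_ideal p" "u \<otimes>\<^bsub>A\<^esub> (t \<otimes>\<^bsub>A\<^esub> a) = u \<otimes>\<^bsub>A\<^esub> (s \<otimes>\<^bsub>A\<^esub> b)"
      using loc.fraction_eqE[OF e ab(2) st(2)] .
    have uc: "u \<in> carrier A" and un: "gm p u \<in> Units (stalk X p)" using u(1) unfolding pt_ideal_def by blast+
    have "gm p u \<otimes>\<^bsub>stalk X p\<^esub> gm p (t \<otimes>\<^bsub>A\<^esub> a) = gm p u \<otimes>\<^bsub>stalk X p\<^esub> gm p (s \<otimes>\<^bsub>A\<^esub> b)"
      using ring_hom_mult[OF h uc c(1)] ring_hom_mult[OF h uc c(2)] u(2) by simp
    then show "gm p (t \<otimes>\<^bsub>A\<^esub> a) = gm p (s \<otimes>\<^bsub>A\<^esub> b)"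
      using S.Units_l_cancel[OF un] ring_hom_closed[OF h c(1)] ring_hom_closed[OF h c(2)] by simp
  next
    assume "gm p (t \<otimes>\<^bsub>A\<^esub> a) = gm p (s \<otimes>\<^bsub>A\<^esub> b)"
    then have "agree p T (t \<otimes>\<^bsub>A\<^esub> a) T (s \<otimes>\<^bsub>A\<^esub> b)" by (rule germ_eqD[OF _ openin_topspace p c(2)])
    then obtain W where W: "openin (pts X) W" "p \<in> W" "W \<subseteq> T"
      "res X T W (t \<otimes>\<^bsub>A\<^esub> a) = res X T W (s \<otimes>\<^bsub>A\<^esub> b)" by (rule agreeE)
    obtain C where C: "openin (pts X) C" "closedin (pts X) C" "p \<in> C" "C \<subseteq> W"
      using clopen_base[OF W(1,2)] by blast
    have "res X T C (t \<otimes>\<^bsub>A\<^esub> a) = res X T C (s \<otimes>\<^bsub>A\<^esub> b)"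
      by (rule agree_restrict[OF openin_topspace openin_topspace c W(1,3,3,4) C(1,4)])
    then have "idem C \<otimes>\<^bsub>A\<^esub> (t \<otimes>\<^bsub>A\<^esub> a) = idem C \<otimes>\<^bsub>A\<^esub> (s \<otimes>\<^bsub>A\<^esub> b)"
      by (rule idem_mult_eq[OF C(1,2) c])
    moreover have "idem C \<in> carrier A - pt_ideal p"
      using idem(1)[OF C(1,2)] idem_pt_ideal[OF C(1,2) p] C(3) by blast
    ultimately show "fraction A (carrier A - pt_ideal p) a s = fraction A (carrier A - pt_ideal p) b t"
      using ab st by (intro loc.fraction_eqI) auto
  qed
qed

lemma spec_open_point:
  assumes "openin (pts X) U" "Q \<in> spec_open U"
  shows "primeideal Q A" "pt Q \<in> U" "pt Q \<in> T" "pt_ideal (pt Q) = Q" "\<one>\<^bsub>A\<^esub> \<in> carrier A - Q"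
  using assms spec_open_iff pt_in pt_ideal_pt A.one_notin_prime by auto

text \<open>
  The value at \<open>Q\<close> is the germ of \<open>s\<close> at the corresponding point, written as a fraction with
  denominator one by means of a global section with that germ. By \<open>fraction_eq_iff_germ\<close> the
  choice does not matter.
\<close>

definition to_spec where
  "to_spec U s = (\<lambda>Q\<in>spec_open U. fraction A (carrier A - Q)
     (SOME a. a \<in> carrier A \<and> gm (pt Q) a = germ X (pt Q) U s) \<one>\<^bsub>A\<^esub>)"

text \<open>
  Fractions with other denominators are admitted because the sections of the spectrum, whose
  preimages are sought, are given locally in that form.
\<close>

lemma to_spec_eq:
  assumes U: "openin (pts X) U" and s: "s \<in> carrier (sections X U)" and Q: "Q \<in> spec_open U"
    and a: "a \<in> carrier A" and b: "b \<in> carrier A - Q"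
    and eq: "gm (pt Q) a = gm (pt Q) b \<otimes>\<^bsub>stalk X (pt Q)\<^esub> germ X (pt Q) U s"
  shows "to_spec U s Q = fraction A (carrier A - Q) a b"
proof -
  note q = spec_open_point[OF U Q]
  define c where "c = (SOME a. a \<in> carrier A \<and> gm (pt Q) a = germ X (pt Q) U s)"
  have "\<exists>a. a \<in> carrier A \<and> gm (pt Q) a = germ X (pt Q) U s" using local_global[OF U q(2) s] by metis
  then have c: "c \<in> carrier A" "gm (pt Q) c = germ X (pt Q) U s" unfolding c_def by (rule someI2_ex; blast)+
  have "gm (pt Q) (b \<otimes>\<^bsub>A\<^esub> c) = gm (pt Q) b \<otimes>\<^bsub>stalk X (pt Q)\<^esub> gm (pt Q) c"
    using ring_hom_mult[OF germ_hom[OF openin_topspace q(3)] _ c(1)] b by blast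
  also have "\<dots> = gm (pt Q) (\<one>\<^bsub>A\<^esub> \<otimes>\<^bsub>A\<^esub> a)" using c(2) eq a by simp
  finally have "fraction A (carrier A - Q) c \<one>\<^bsub>A\<^esub> = fraction A (carrier A - Q) a b"
    using fraction_eq_iff_germ[OF q(3) c(1) a, of "\<one>\<^bsub>A\<^esub>" b] b q(4,5) by simp
  then show ?thesis using Q by (simp add: to_spec_def c_def)
qed

lemma to_spec_eq_one:
  assumes U: "openin (pts X) U" and s: "s \<in> carrier (sections X U)" and Q: "Q \<in> spec_open U"
    and a: "a \<in> carrier A" and eq: "gm (pt Q) a = germ X (pt Q) U s"
  shows "to_spec U s Q = fraction A (carrier A - Q) a \<one>\<^bsub>A\<^esub>"
proof (rule to_spec_eq[OF U s Q a])
  note q = spec_open_point[OF U Q]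
  interpret S: cring "stalk X (pt Q)" by (rule stalk_cring[OF q(3)])
  show "\<one>\<^bsub>A\<^esub> \<in> carrier A - Q" by (rule q(5))
  show "gm (pt Q) a = gm (pt Q) \<one>\<^bsub>A\<^esub> \<otimes>\<^bsub>stalk X (pt Q)\<^esub> germ X (pt Q) U s"
    using stalk_one[OF openin_topspace q(3), symmetric] germ_in_stalk[OF U q(2) s] eq by simp
qed

lemma to_spec_rep:
  assumes U: "openin (pts X) U" and s: "s \<in> carrier (sections X U)" and Q: "Q \<in> spec_open U"
  obtains a where "a \<in> carrier A" "gm (pt Q) a = germ X (pt Q) U s"
    "to_spec U s Q = fraction A (carrier A - Q) a \<one>\<^bsub>A\<^esub>"
  using local_global[OF U spec_open_point(2)[OF U Q] s] to_spec_eq_one[OF U s Q] by metis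

lemma to_spec_closed:
  assumes U: "openin (pts X) U" and s: "s \<in> carrier (sections X U)"
  shows "to_spec U s \<in> carrier (spec_sections A (spec_open U))"
  unfolding A.spec_sections_carrier
proof (intro conjI ballI PiE_I)
  fix Q assume Q: "Q \<in> spec_open U"
  note q = spec_open_point[OF U Q]
  obtain a where a: "a \<in> carrier A" "gm (pt Q) a = germ X (pt Q) U s"
    "to_spec U s Q = fraction A (carrier A - Q) a \<one>\<^bsub>A\<^esub>"
    using to_spec_rep[OF U s Q] .
  show "to_spec U s Q \<in> carrier (local_at A Q)"
    unfolding a(3) by (rule localized_ring.fraction_carrier[OF A.localized_at_prime[OF q(1)] a(1) q(5)])
  have "agree (pt Q) T a U s" by (rule germ_eqD[OF a(2) U q(2) s])
  then obtain W where W: "openin (pts X) W" "pt Q \<in> W" "W \<subseteq> T" "W \<subseteq> U" "res X T W a = res X U W s"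
    by (rule agreeE)
  have sub: "spec_open W \<subseteq> spec_open U" using W(4) by (auto simp: spec_open_iff)
  show "A.locally_fraction (spec_open U) (to_spec U s) Q"
  proof (rule A.locally_fractionI[OF openin_spec_open[OF W(1)] _ sub a(1) A.one_closed])
    show "Q \<in> spec_open W" using W(2) q(1) by (simp add: spec_open_iff)
    fix Q' assume Q': "Q' \<in> spec_open W"
    note q' = spec_open_point[OF W(1) Q']
    have "gm (pt Q') a = germ X (pt Q') W (res X T W a)"
      using germ_res[OF openin_topspace W(1,3) q'(2) a(1)] by simp
    also have "\<dots> = germ X (pt Q') U s" unfolding W(5) by (rule germ_res[OF U W(1,4) q'(2) s])
    finally have "to_spec U s Q' = fraction A (carrier A - Q') a \<one>\<^bsub>A\<^esub>"
      by (rule to_spec_eq_one[OF U s subsetD[OF sub Q'] a(1)])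
    then show "\<one>\<^bsub>A\<^esub> \<notin> Q' \<and> to_spec U s Q' = fraction A (carrier A - Q') a \<one>\<^bsub>A\<^esub>"
      using q'(5) by blast
  qed
qed (simp add: to_spec_def)

lemma to_spec_hom:
  assumes U: "openin (pts X) U"
  shows "to_spec U \<in> ring_hom (sections X U) (spec_sections A (spec_open U))"
proof (rule ring_hom_memI)
  interpret G: cring "sections X U" by (rule sections_cring[OF U])
  have o: "openin (zariski A) (spec_open U)" by (rule openin_spec_open[OF U])
  fix s t assume s: "s \<in> carrier (sections X U)" and t: "t \<in> carrier (sections X U)"
  show "to_spec U s \<in> carrier (spec_sections A (spec_open U))" by (rule to_spec_closed[OF U s])
  show "to_spec U (s \<otimes>\<^bsub>sections X U\<^esub> t) = to_spec U s \<otimes>\<^bsub>spec_sections A (spec_open U)\<^esub> to_spec U t"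
  proof (rule A.spec_section_eqI)
    fix Q assume Q: "Q \<in> spec_open U"
    note q = spec_open_point[OF U Q]
    interpret loc: localized_ring A "carrier A - Q" by (rule A.localized_at_prime[OF q(1)])
    obtain a where a: "a \<in> carrier A" "gm (pt Q) a = germ X (pt Q) U s"
      "to_spec U s Q = fraction A (carrier A - Q) a \<one>\<^bsub>A\<^esub>" using to_spec_rep[OF U s Q] .
    obtain b where b: "b \<in> carrier A" "gm (pt Q) b = germ X (pt Q) U t"
      "to_spec U t Q = fraction A (carrier A - Q) b \<one>\<^bsub>A\<^esub>" using to_spec_rep[OF U t Q] .
    have "gm (pt Q) (a \<otimes>\<^bsub>A\<^esub> b) = germ X (pt Q) U (s \<otimes>\<^bsub>sections X U\<^esub> t)"
      using ring_hom_mult[OF germ_hom[OF openin_topspace q(3)] a(1) b(1)]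
        ring_hom_mult[OF germ_hom[OF U q(2)] s t] a b by simp
    then have "to_spec U (s \<otimes>\<^bsub>sections X U\<^esub> t) Q = fraction A (carrier A - Q) (a \<otimes>\<^bsub>A\<^esub> b) \<one>\<^bsub>A\<^esub>"
      by (rule to_spec_eq_one[OF U G.m_closed[OF s t] Q A.m_closed[OF a(1) b(1)]])
    also have "\<dots> = to_spec U s Q \<otimes>\<^bsub>local_at A Q\<^esub> to_spec U t Q"
      unfolding a(3) b(3) loc.fraction_mult[OF a(1) b(1) q(5) q(5)] by simp
    finally show "to_spec U (s \<otimes>\<^bsub>sections X U\<^esub> t) Q =
      (to_spec U s \<otimes>\<^bsub>spec_sections A (spec_open U)\<^esub> to_spec U t) Q" using Q by (simp add: spec_sections_simps)
  qed (use s t in \<open>simp_all add: to_spec_closed[OF U] A.spec_sections_closed[OF o]\<close>)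
  show "to_spec U (s \<oplus>\<^bsub>sections X U\<^esub> t) = to_spec U s \<oplus>\<^bsub>spec_sections A (spec_open U)\<^esub> to_spec U t"
  proof (rule A.spec_section_eqI)
    fix Q assume Q: "Q \<in> spec_open U"
    note q = spec_open_point[OF U Q]
    interpret loc: localized_ring A "carrier A - Q" by (rule A.localized_at_prime[OF q(1)])
    obtain a where a: "a \<in> carrier A" "gm (pt Q) a = germ X (pt Q) U s"
      "to_spec U s Q = fraction A (carrier A - Q) a \<one>\<^bsub>A\<^esub>" using to_spec_rep[OF U s Q] .
    obtain b where b: "b \<in> carrier A" "gm (pt Q) b = germ X (pt Q) U t"
      "to_spec U t Q = fraction A (carrier A - Q) b \<one>\<^bsub>A\<^esub>" using to_spec_rep[OF U t Q] .
    have "gm (pt Q) (a \<oplus>\<^bsub>A\<^esub> b) = germ X (pt Q) U (s \<oplus>\<^bsub>sections X U\<^esub> t)"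
      using ring_hom_add[OF germ_hom[OF openin_topspace q(3)] a(1) b(1)]
        ring_hom_add[OF germ_hom[OF U q(2)] s t] a b by simp
    then have "to_spec U (s \<oplus>\<^bsub>sections X U\<^esub> t) Q = fraction A (carrier A - Q) (a \<oplus>\<^bsub>A\<^esub> b) \<one>\<^bsub>A\<^esub>"
      by (rule to_spec_eq_one[OF U G.a_closed[OF s t] Q A.a_closed[OF a(1) b(1)]])
    also have "\<dots> = to_spec U s Q \<oplus>\<^bsub>local_at A Q\<^esub> to_spec U t Q"
      unfolding a(3) b(3) loc.fraction_add_same[OF a(1) b(1) q(5)] by simp
    finally show "to_spec U (s \<oplus>\<^bsub>sections X U\<^esub> t) Q =
      (to_spec U s \<oplus>\<^bsub>spec_sections A (spec_open U)\<^esub> to_spec U t) Q" using Q by (simp add: spec_sections_simps)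
  qed (use s t in \<open>simp_all add: to_spec_closed[OF U] A.spec_sections_closed[OF o]\<close>)
next
  interpret G: cring "sections X U" by (rule sections_cring[OF U])
  show "to_spec U \<one>\<^bsub>sections X U\<^esub> = \<one>\<^bsub>spec_sections A (spec_open U)\<^esub>"
  proof (rule A.spec_section_eqI)
    fix Q assume Q: "Q \<in> spec_open U"
    note q = spec_open_point[OF U Q]
    interpret loc: localized_ring A "carrier A - Q" by (rule A.localized_at_prime[OF q(1)])
    have "gm (pt Q) \<one>\<^bsub>A\<^esub> = germ X (pt Q) U \<one>\<^bsub>sections X U\<^esub>"
      using stalk_one[OF openin_topspace q(3)] stalk_one[OF U q(2)] by simp
    then have "to_spec U \<one>\<^bsub>sections X U\<^esub> Q = fraction A (carrier A - Q) \<one>\<^bsub>A\<^esub> \<one>\<^bsub>A\<^esub>"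
      by (rule to_spec_eq_one[OF U G.one_closed Q A.one_closed])
    then show "to_spec U \<one>\<^bsub>sections X U\<^esub> Q = \<one>\<^bsub>spec_sections A (spec_open U)\<^esub> Q"
      using Q by (simp add: spec_sections_simps loc.localization_one)
  qed (simp_all add: to_spec_closed[OF U] A.spec_sections_one_zero[OF openin_spec_open[OF U]])
qed

lemma to_spec_res:
  assumes U: "openin (pts X) U" and V: "openin (pts X) V" "V \<subseteq> U" and s: "s \<in> carrier (sections X U)"
  shows "to_spec V (res X U V s) = restrict (to_spec U s) (spec_open V)"
proof -
  have r: "res X U V s \<in> carrier (sections X V)" by (rule res_closed[OF U V s])
  have "to_spec V (res X U V s) Q = to_spec U s Q" if Q: "Q \<in> spec_open V" for Q
  proof -
    have QU: "Q \<in> spec_open U" using Q V(2) by (auto simp: spec_open_iff)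
    obtain a where a: "a \<in> carrier A" "gm (pt Q) a = germ X (pt Q) U s"
      "to_spec U s Q = fraction A (carrier A - Q) a \<one>\<^bsub>A\<^esub>" using to_spec_rep[OF U s QU] .
    have "gm (pt Q) a = germ X (pt Q) V (res X U V s)"
      using a(2) germ_res[OF U V spec_open_point(2)[OF V(1) Q] s] by simp
    then show ?thesis unfolding a(3) by (rule to_spec_eq_one[OF V(1) r Q a(1)])
  qed
  then have "restrict (to_spec V (res X U V s)) (spec_open V) = restrict (to_spec U s) (spec_open V)"
    by (rule restrict_ext)
  then show ?thesis using A.spec_sections_restrict[OF to_spec_closed[OF V(1) r]] by simp
qed

lemma to_spec_inj:
  assumes U: "openin (pts X) U"
  shows "inj_on (to_spec U) (carrier (sections X U))"
proof (rule inj_onI)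
  fix s t assume s: "s \<in> carrier (sections X U)" and t: "t \<in> carrier (sections X U)"
    and eq: "to_spec U s = to_spec U t"
  show "s = t"
  proof (rule sections_eqI[OF U s t])
    fix p assume p: "p \<in> U"
    have pT: "p \<in> T" using p open_sub[OF U] by blast
    have pt: "pt (pt_ideal p) = p" by (rule pt_pt_ideal[OF pT])
    have Q: "pt_ideal p \<in> spec_open U" using pt_ideal_prime[OF pT] pt p by (simp add: spec_open_iff)
    have one: "\<one>\<^bsub>A\<^esub> \<in> carrier A - pt_ideal p" by (rule spec_open_point(5)[OF U Q])
    obtain a where a: "a \<in> carrier A" "gm p a = germ X p U s"
      "to_spec U s (pt_ideal p) = fraction A (carrier A - pt_ideal p) a \<one>\<^bsub>A\<^esub>"
      using to_spec_rep[OF U s Q] unfolding pt .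
    obtain b where b: "b \<in> carrier A" "gm p b = germ X p U t"
      "to_spec U t (pt_ideal p) = fraction A (carrier A - pt_ideal p) b \<one>\<^bsub>A\<^esub>"
      using to_spec_rep[OF U t Q] unfolding pt .
    have "gm p a = gm p b"
      using fraction_eq_iff_germ[OF pT a(1) b(1) one one] a(1,3) b(1,3) eq by simp
    then show "germ X p U s = germ X p U t" using a(2) b(2) by simp
  qed
qed

text \<open>
  Where the given section is \<open>a/b\<close>, the denominator is outside \<open>pt_ideal p\<close> and so is invertible on
  a neighbourhood of \<open>p\<close>; the preimage is the restriction of \<open>a\<close> times that inverse.
\<close>

lemma to_spec_local_surj:
  assumes U: "openin (pts X) U" and t: "t \<in> carrier (spec_sections A (spec_open U))" and p: "p \<in> U"
  shows "\<exists>W s. openin (pts X) W \<and> p \<in> W \<and> W \<subseteq> U \<and> s \<in> carrier (sections X W) \<and>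
    to_spec W s = restrict t (spec_open W)"
proof -
  have pT: "p \<in> T" using p open_sub[OF U] by blast
  have pt: "pt (pt_ideal p) = p" by (rule pt_pt_ideal[OF pT])
  have Q: "pt_ideal p \<in> spec_open U" using pt_ideal_prime[OF pT] pt p by (simp add: spec_open_iff)
  have "A.locally_fraction (spec_open U) t (pt_ideal p)" using t Q unfolding A.spec_sections_carrier by blast
  then obtain V a b where V: "openin (zariski A) V" "pt_ideal p \<in> V" "V \<subseteq> spec_open U"
    and ab: "a \<in> carrier A" "b \<in> carrier A"
    and fr: "\<forall>Q\<in>V. b \<notin> Q \<and> t Q = fraction A (carrier A - Q) a b"
    unfolding A.locally_fraction_def by blast
  obtain W0 where W0: "openin (pts X) W0" "p \<in> W0" "res X T W0 b \<in> Units (sections X W0)"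
    using fr V(2) not_in_pt_ideal[OF pT ab(2)] by blast
  define W where "W = W0 \<inter> {q \<in> T. pt_ideal q \<in> V}"
  have W: "openin (pts X) W" "p \<in> W" "W \<subseteq> W0"
    using W0 openin_continuous_map_preimage[OF continuous_pt_ideal V(1)] pT V(2) by (auto simp: W_def)
  have WV: "spec_open W \<subseteq> V"
  proof
    fix Q assume "Q \<in> spec_open W"
    then have "primeideal Q A" "pt_ideal (pt Q) \<in> V" by (auto simp: spec_open_iff W_def)
    then show "Q \<in> V" using pt_ideal_pt by simp
  qed
  have WU: "W \<subseteq> U"
  proof
    fix q assume "q \<in> W"
    then have q: "q \<in> T" "pt_ideal q \<in> spec_open U" using V(3) by (auto simp: W_def)
    then show "q \<in> U" using pt_pt_ideal[OF q(1)] by (simp add: spec_open_iff)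
  qed
  interpret G: cring "sections X W" by (rule sections_cring[OF W(1)])
  have u: "res X T W b \<in> Units (sections X W)"
    using res_Units[OF W0(1) W(1,3) W0(3)] res_comp[OF openin_topspace W0(1) W(1,3) open_sub[OF W0(1)] ab(2)]
    by simp
  then obtain v where v: "v \<in> carrier (sections X W)" "res X T W b \<otimes>\<^bsub>sections X W\<^esub> v = \<one>\<^bsub>sections X W\<^esub>"
    using G.Units_r_inv_ex by blast
  have rab: "res X T W a \<in> carrier (sections X W)" "res X T W b \<in> carrier (sections X W)"
    using glob_res[OF W(1)] ab by auto
  define s where "s = v \<otimes>\<^bsub>sections X W\<^esub> res X T W a"
  have s: "s \<in> carrier (sections X W)" "res X T W b \<otimes>\<^bsub>sections X W\<^esub> s = res X T W a"
    unfolding s_def using v rab by (simp_all flip: G.m_assoc)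
  have "to_spec W s Q = t Q" if Q: "Q \<in> spec_open W" for Q
  proof -
    note q = spec_open_point[OF W(1) Q]
    have gW: "gm (pt Q) x = germ X (pt Q) W (res X T W x)" if "x \<in> carrier A" for x
      using germ_res[OF openin_topspace W(1) open_sub[OF W(1)] q(2) that] by simp
    have "gm (pt Q) a = gm (pt Q) b \<otimes>\<^bsub>stalk X (pt Q)\<^esub> germ X (pt Q) W s"
      unfolding gW[OF ab(1)] gW[OF ab(2)] stalk_mult[OF W(1) q(2) rab(2) s(1)] s(2) ..
    moreover have "b \<in> carrier A - Q" "t Q = fraction A (carrier A - Q) a b" using fr WV Q ab(2) by auto
    ultimately show ?thesis using to_spec_eq[OF W(1) s(1) Q ab(1)] by simp
  qed
  then have "restrict (to_spec W s) (spec_open W) = restrict t (spec_open W)" by (rule restrict_ext)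
  then have "to_spec W s = restrict t (spec_open W)"
    using A.spec_sections_restrict[OF to_spec_closed[OF W(1) s(1)]] by simp
  then show ?thesis using W WU s(1) by blast
qed

text \<open>
  The local preimages are unique by injectivity, so they are compatible and can be glued.
\<close>

lemma to_spec_surj:
  assumes U: "openin (pts X) U" and t: "t \<in> carrier (spec_sections A (spec_open U))"
  shows "\<exists>s\<in>carrier (sections X U). to_spec U s = t"
proof -
  define \<V> where "\<V> = {W. openin (pts X) W \<and> W \<subseteq> U \<and> (\<exists>s\<in>carrier (sections X W). to_spec W s = restrict t (spec_open W))}"
  define \<sigma> where "\<sigma> W = (SOME s. s \<in> carrier (sections X W) \<and> to_spec W s = restrict t (spec_open W))" for W
  have V: "openin (pts X) W" "W \<subseteq> U" if "W \<in> \<V>" for W using that unfolding \<V>_def by auto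
  have \<sigma>: "\<sigma> W \<in> carrier (sections X W) \<and> to_spec W (\<sigma> W) = restrict t (spec_open W)" if "W \<in> \<V>" for W
    unfolding \<sigma>_def by (rule someI_ex) (use that in \<open>auto simp: \<V>_def\<close>)
  have un: "\<Union>\<V> = U"
  proof
    show "U \<subseteq> \<Union>\<V>"
    proof
      fix p assume "p \<in> U"
      then obtain W s where "openin (pts X) W" "p \<in> W" "W \<subseteq> U" "s \<in> carrier (sections X W)"
        "to_spec W s = restrict t (spec_open W)" using to_spec_local_surj[OF U t] by metis
      then show "p \<in> \<Union>\<V>" unfolding \<V>_def by blast
    qed
    show "\<Union>\<V> \<subseteq> U" by (rule Union_least) (rule V(2))
  qed
  have "res X V (V \<inter> W) (\<sigma> V) = res X W (V \<inter> W) (\<sigma> W)" if VW: "V \<in> \<V>" "W \<in> \<V>" for V W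
  proof -
    have o: "openin (pts X) (V \<inter> W)" using V VW by blast
    have sub: "spec_open (V \<inter> W) \<subseteq> spec_open V" "spec_open (V \<inter> W) \<subseteq> spec_open W" by (auto simp: spec_open_iff)
    have "to_spec (V \<inter> W) (res X V (V \<inter> W) (\<sigma> V)) = restrict t (spec_open (V \<inter> W))"
      using to_spec_res[OF V(1)[OF VW(1)] o Int_lower1] \<sigma>[OF VW(1)] sub by (simp add: Int_absorb1)
    moreover have "to_spec (V \<inter> W) (res X W (V \<inter> W) (\<sigma> W)) = restrict t (spec_open (V \<inter> W))"
      using to_spec_res[OF V(1)[OF VW(2)] o Int_lower2] \<sigma>[OF VW(2)] sub by (simp add: Int_absorb1)
    ultimately have "to_spec (V \<inter> W) (res X V (V \<inter> W) (\<sigma> V)) = to_spec (V \<inter> W) (res X W (V \<inter> W) (\<sigma> W))"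
      by simp
    then show ?thesis
      by (rule inj_onD[OF to_spec_inj[OF o]])
        (use res_closed[OF V(1) o] \<sigma> VW in auto)
  qed
  then have "\<exists>s\<in>carrier (sections X (\<Union>\<V>)). \<forall>V\<in>\<V>. res X (\<Union>\<V>) V s = \<sigma> V"
    by (intro sheaf_gluing ballI) (use V(1) \<sigma> in simp_all)
  then obtain s where s: "s \<in> carrier (sections X U)" "\<forall>V\<in>\<V>. res X U V s = \<sigma> V" unfolding un by blast
  have "to_spec U s = t"
  proof (rule A.spec_section_eqI[OF to_spec_closed[OF U s(1)] t])
    fix Q assume Q: "Q \<in> spec_open U"
    then obtain W where W: "W \<in> \<V>" "pt Q \<in> W" using spec_open_point(2)[OF U Q] un by blast
    have QW: "Q \<in> spec_open W" using Q W(2) by (simp add: spec_open_iff)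
    have "restrict (to_spec U s) (spec_open W) = restrict t (spec_open W)"
      using to_spec_res[OF U V(1)[OF W(1)] V(2)[OF W(1)] s(1)] s(2) W(1) \<sigma>[OF W(1)] by simp
    then have "restrict (to_spec U s) (spec_open W) Q = restrict t (spec_open W) Q" by simp
    then show "to_spec U s Q = t Q" using QW by simp
  qed
  then show ?thesis using s(1) by blast
qed

definition of_spec where
  "of_spec V = inv_into (carrier (sections X {p \<in> T. pt_ideal p \<in> V})) (to_spec {p \<in> T. pt_ideal p \<in> V})"

lemma preim_open: "openin (zariski A) V \<Longrightarrow> openin (pts X) {p \<in> T. pt_ideal p \<in> V}"
  by (rule openin_continuous_map_preimage[OF continuous_pt_ideal])

lemma of_spec:
  assumes V: "openin (zariski A) V" and t: "t \<in> carrier (spec_sections A V)"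
  shows "of_spec V t \<in> carrier (sections X {p \<in> T. pt_ideal p \<in> V})"
    and "to_spec {p \<in> T. pt_ideal p \<in> V} (of_spec V t) = t"
proof -
  let ?U = "{p \<in> T. pt_ideal p \<in> V}"
  have "t \<in> to_spec ?U ` carrier (sections X ?U)"
    using to_spec_surj[OF preim_open[OF V]] t unfolding spec_open_preim[OF V] by blast
  then show "of_spec V t \<in> carrier (sections X ?U)" "to_spec ?U (of_spec V t) = t"
    unfolding of_spec_def by (rule inv_into_into, rule f_inv_into_f)
qed

lemma of_spec_eq:
  assumes V: "openin (zariski A) V" and s: "s \<in> carrier (sections X {p \<in> T. pt_ideal p \<in> V})"
    and "to_spec {p \<in> T. pt_ideal p \<in> V} s = t"
  shows "of_spec V t = s"
  unfolding of_spec_def assms(3)[symmetric] by (rule inv_into_f_f[OF to_spec_inj[OF preim_open[OF V]] s])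

lemma of_spec_hom:
  assumes V: "openin (zariski A) V"
  shows "of_spec V \<in> ring_hom (spec_sections A V) (sections X {p \<in> T. pt_ideal p \<in> V})"
proof -
  let ?U = "{p \<in> T. pt_ideal p \<in> V}"
  interpret G: cring "sections X ?U" by (rule sections_cring[OF preim_open[OF V]])
  have h: "to_spec ?U \<in> ring_hom (sections X ?U) (spec_sections A V)"
    using to_spec_hom[OF preim_open[OF V]] unfolding spec_open_preim[OF V] .
  show ?thesis
  proof (rule ring_hom_memI)
    fix s t assume s: "s \<in> carrier (spec_sections A V)" and t: "t \<in> carrier (spec_sections A V)"
    note s' = of_spec[OF V s] and t' = of_spec[OF V t]
    show "of_spec V s \<in> carrier (sections X ?U)" by (rule s'(1))
    show "of_spec V (s \<otimes>\<^bsub>spec_sections A V\<^esub> t) = of_spec V s \<otimes>\<^bsub>sections X ?U\<^esub> of_spec V t"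
      by (rule of_spec_eq[OF V G.m_closed[OF s'(1) t'(1)]])
        (simp only: ring_hom_mult[OF h s'(1) t'(1)] s'(2) t'(2))
    show "of_spec V (s \<oplus>\<^bsub>spec_sections A V\<^esub> t) = of_spec V s \<oplus>\<^bsub>sections X ?U\<^esub> of_spec V t"
      by (rule of_spec_eq[OF V G.a_closed[OF s'(1) t'(1)]])
        (simp only: ring_hom_add[OF h s'(1) t'(1)] s'(2) t'(2))
  next
    show "of_spec V \<one>\<^bsub>spec_sections A V\<^esub> = \<one>\<^bsub>sections X ?U\<^esub>"
      by (rule of_spec_eq[OF V G.one_closed ring_hom_one[OF h]])
  qed
qed

text \<open>
  The spectrum of \<open>A\<close> is homeomorphic to the Hausdorff space \<open>X\<close>, so its sections are locally units
  or nilpotent as well. Hence the maps \<open>of_spec\<close> and \<open>to_spec\<close>, which are inverse to each other, are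
  automatically local on stalks in both directions.
\<close>

theorem affine: "affine_scheme X"
proof -
  interpret Sp: nil_ringed_space "Spec A" by (rule A.nil_ringed_space_Spec[OF t1_zariski_global])
  have f: "lrs_morphism X (Spec A) pt_ideal of_spec"
  proof (rule lrs_morphism_nil[OF nil_ringed_space_axioms Sp.nil_ringed_space_axioms]; unfold A.Spec_simps)
    fix V W t assume V: "openin (zariski A) V" and W: "openin (zariski A) W" "W \<subseteq> V"
      and t: "t \<in> carrier (spec_sections A V)"
    let ?U = "{p \<in> T. pt_ideal p \<in> V}" and ?U' = "{p \<in> T. pt_ideal p \<in> W}"
    have sub: "?U' \<subseteq> ?U" using W(2) by blast
    show "of_spec W (restrict t W) = res X ?U ?U' (of_spec V t)"
    proof (rule of_spec_eq[OF W(1)])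
      show "res X ?U ?U' (of_spec V t) \<in> carrier (sections X ?U')"
        by (rule res_closed[OF preim_open[OF V] preim_open[OF W(1)] sub of_spec(1)[OF V t]])
      show "to_spec ?U' (res X ?U ?U' (of_spec V t)) = restrict t W"
        unfolding to_spec_res[OF preim_open[OF V] preim_open[OF W(1)] sub of_spec(1)[OF V t]]
          spec_open_preim[OF W(1)] of_spec(2)[OF V t] ..
    qed
  qed (rule continuous_pt_ideal, rule of_spec_hom)
  have spec_open: "{Q \<in> topspace (zariski A). pt Q \<in> U} = spec_open U" for U by (simp add: spec_open_def)
  have g: "lrs_morphism (Spec A) X pt to_spec"
  proof (rule lrs_morphism_nil[OF Sp.nil_ringed_space_axioms nil_ringed_space_axioms]; unfold A.Spec_simps spec_open)
  qed (rule continuous_pt to_spec_hom to_spec_res; assumption)+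
  have "lrs_isomorphic X (Spec A)"
    unfolding lrs_isomorphic_def A.Spec_simps
  proof (rule exI[of _ pt_ideal], rule exI[of _ of_spec], rule exI[of _ pt], rule exI[of _ to_spec],
      unfold spec_open, intro conjI ballI allI impI)
    show "lrs_morphism X (Spec A) pt_ideal of_spec" "lrs_morphism (Spec A) X pt to_spec" by (rule f, rule g)
  next
    fix U s assume U: "openin (pts X) U" and s: "s \<in> carrier (sections X U)"
    show "of_spec (spec_open U) (to_spec U s) = s"
      by (rule of_spec_eq[OF openin_spec_open[OF U]]; unfold preim_spec_open[OF U]) (rule s refl)+
  next
    fix V t assume "openin (zariski A) V" "t \<in> carrier (spec_sections A V)"
    then show "to_spec {p \<in> T. pt_ideal p \<in> V} (of_spec V t) = t" by (rule of_spec(2))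
  qed (simp_all add: pt_pt_ideal pt_ideal_pt A.topspace_zariski)
  then show ?thesis
    unfolding affine_scheme_def using locally_ringed_space_axioms A.is_cring by blast
qed

end

section \<open>Hausdorff schemes\<close>

text \<open>
  The Hausdorff property of the whole space enters in that compact sets, in particular affine
  opens, are closed. A clopen subset of an affine open is then closed in \<open>X\<close>.
\<close>

lemma scheme_Hausdorff_facts:
  assumes X: "scheme X" and H: "Hausdorff_space (pts X)"
  shows "nil_ringed_space X"
    and "\<And>U. affine_open X U \<Longrightarrow> compactin (pts X) U"
    and "\<And>W p. openin (pts X) W \<Longrightarrow> p \<in> W \<Longrightarrow> \<exists>C. openin (pts X) C \<and> closedin (pts X) C \<and> p \<in> C \<and> C \<subseteq> W"
proof -
  interpret ringed_space X using X by (simp add: scheme_def locally_ringed_space_def)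
  have loc: "openin (pts X) U \<and> nil_ringed_space (restrict_space X U) \<and> compactin (pts X) U \<and>
    (\<forall>W p. openin (pts X) W \<longrightarrow> W \<subseteq> U \<longrightarrow> p \<in> W \<longrightarrow>
      (\<exists>C. openin (pts X) C \<and> closedin (subtopology (pts X) U) C \<and> p \<in> C \<and> C \<subseteq> W))"
    if "affine_open X U" for U
  proof -
    have U: "openin (pts X) U" and aff: "affine_scheme (restrict_space X U)"
      using that by (auto simp: affine_open_def)
    have H': "Hausdorff_space (pts (restrict_space X U))"
      using Hausdorff_space_subtopology[OF H] by (simp add: restrict_space_simps)
    note facts = affine_scheme_Hausdorff[OF aff H']
    have "compactin (pts X) U"
      using facts(2) openin_subset[OF U] by (simp add: restrict_space_simps compactin_subspace)
    moreover have "\<exists>C. openin (pts X) C \<and> closedin (subtopology (pts X) U) C \<and> p \<in> C \<and> C \<subseteq> W"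
      if W: "openin (pts X) W" "W \<subseteq> U" "p \<in> W" for W p
    proof -
      have "openin (pts (restrict_space X U)) W" using W openin_restrict_space[OF U] by simp
      then obtain C where C: "openin (pts (restrict_space X U)) C" "closedin (pts (restrict_space X U)) C"
        "p \<in> C" "C \<subseteq> W" using facts(3)[OF _ W(3)] by metis
      then show ?thesis using openin_restrict_space[OF U] unfolding restrict_space_simps(1) by metis
    qed
    ultimately show ?thesis using U facts(1) by (intro conjI allI impI) simp_all
  qed
  show comp: "compactin (pts X) U" if "affine_open X U" for U using loc[OF that] by blast
  have cover: "\<exists>U. p \<in> U \<and> affine_open X U" if "p \<in> topspace (pts X)" for p
    using X that by (auto simp: scheme_def)
  show "nil_ringed_space X"
  proof (rule nil_ringed_space_local)
    fix p assume "p \<in> topspace (pts X)"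
    then obtain U where "p \<in> U" "affine_open X U" using cover by blast
    then show "\<exists>U. openin (pts X) U \<and> p \<in> U \<and> nil_ringed_space (restrict_space X U)"
      using loc[of U] by blast
  qed
  fix W p assume W: "openin (pts X) W" and p: "p \<in> W"
  have "p \<in> topspace (pts X)" using p openin_subset[OF W] by blast
  then obtain U where U: "p \<in> U" "affine_open X U" using cover by blast
  have UO: "openin (pts X) U" using loc[OF U(2)] by blast
  have UC: "closedin (pts X) U" by (rule compactin_imp_closedin[OF H comp[OF U(2)]])
  have "openin (pts X) (W \<inter> U)" using W UO by blast
  then obtain C where C: "openin (pts X) C" "closedin (subtopology (pts X) U) C" "p \<in> C" "C \<subseteq> W \<inter> U"
    using loc[OF U(2)] p U(1) by blast
  have "closedin (pts X) C" by (rule closedin_trans_full[OF C(2) UC])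
  then show "\<exists>C. openin (pts X) C \<and> closedin (pts X) C \<and> p \<in> C \<and> C \<subseteq> W" using C by blast
qed

text \<open>
  The properties of \<open>X\<close> collected in \<open>scheme_Hausdorff_facts\<close> pass to every open subset; together
  with compactness they suffice for being affine, by \<open>stone_ringed_space.affine\<close>.
\<close>

lemma compact_open_affine:
  assumes X: "scheme X" and H: "Hausdorff_space (pts X)" and U: "openin (pts X) U" "compactin (pts X) U"
  shows "affine_open X U"
proof -
  note facts = scheme_Hausdorff_facts[OF X H]
  interpret N: nil_ringed_space X by (rule facts(1))
  have "stone_ringed_space (restrict_space X U)"
  proof (rule stone_ringed_space.intro[OF N.nil_restrict_space[OF U(1)]], rule stone_ringed_space_axioms.intro;
      (unfold N.openin_restrict_space[OF U(1)])?)
    show "compact_space (pts (restrict_space X U))"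
      using compact_space_subtopology[OF U(2)] by (simp add: restrict_space_simps)
    show "Hausdorff_space (pts (restrict_space X U))"
      using Hausdorff_space_subtopology[OF H] by (simp add: restrict_space_simps)
    fix W p assume W: "openin (pts X) W \<and> W \<subseteq> U" and p: "p \<in> W"
    obtain C where C: "openin (pts X) C" "closedin (pts X) C" "p \<in> C" "C \<subseteq> W"
      using facts(3)[of W p] W p by blast
    have "closedin (pts (restrict_space X U)) C"
      unfolding restrict_space_simps by (rule closedin_subset_topspace[OF C(2)]) (use C W in blast)
    then show "\<exists>C. (openin (pts X) C \<and> C \<subseteq> U) \<and> closedin (pts (restrict_space X U)) C \<and> p \<in> C \<and> C \<subseteq> W"
      using C W by blast
  qed
  then have "affine_scheme (restrict_space X U)" by (rule stone_ringed_space.affine)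
  then show ?thesis using U(1) by (simp add: affine_open_def)
qed

theorem theorem3p4:
  fixes X :: "('p, 'a) rspace"
  assumes "scheme X"
  shows "(Hausdorff_space (pts X) \<longrightarrow>
           (\<forall>\<U>. finite \<U> \<and> (\<forall>U\<in>\<U>. affine_open X U) \<longrightarrow> affine_open X (\<Union>\<U>))) \<and>
         (compact_scheme X \<longrightarrow> affine_scheme X)"
proof (intro conjI impI allI)
  fix \<U> assume H: "Hausdorff_space (pts X)" and \<U>: "finite \<U> \<and> (\<forall>U\<in>\<U>. affine_open X U)"
  have "openin (pts X) (\<Union>\<U>)" using \<U> by (auto simp: affine_open_def)
  moreover have "compactin (pts X) (\<Union>\<U>)"
    using \<U> scheme_Hausdorff_facts(2)[OF assms H] by (intro compactin_Union) auto
  ultimately show "affine_open X (\<Union>\<U>)" by (rule compact_open_affine[OF assms H])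
next
  assume X: "compact_scheme X"
  then have "affine_open X (topspace (pts X))"
    by (intro compact_open_affine[OF assms]) (auto simp: compact_scheme_def compact_space_def)
  then show "affine_scheme X" by (simp add: affine_open_def restrict_space_def)
qed

end
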